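(* Let $R$ be a commutative ring, $Q$ a finite quiver with double $\overline{Q}$, $\mathcal{C}$ a $\otimes$-cocomplete $R$-linear symmetric monoidal category, and $c_i\in\mathcal{C}$ a dualisable object for each vertex $i$ of $\overline{Q}$. Put $h_a^\vee=c_{s(a)}\otimes c_{t(a)}^\vee$ for each arrow $a$ of $\overline{Q}$ and $h^\vee=\bigoplus_{a\in\overline{Q}_1}h_a^\vee$. Let $\{-,-\}:Sh^\vee\otimes Sh^\vee\to Sh^\vee$ be the unique bi-derivation whose restriction to $h_a^\vee\otimes h_b^\vee$, for all arrows $a,b$, is $\langle a,b\rangle\,\varepsilon_{ab}$ followed by the unit $1\to Sh^\vee$. Then $(Sh^\vee,\{-,-\})$ is a Poisson algebra in $\mathcal{C}$.
   Context: The double $\overline{Q}$ of $Q=(s,t:Q_1\to Q_0)$ has the same vertices and arrows $Q_1\sqcup\{\overline{a}\mid a\in Q_1\}$, with $s(\overline{a})=t(a)$, $t(\overline{a})=s(a)$. The pairing on arrows of $\overline{Q}$ is $\langle a,b\rangle=1$ if $a\in Q_1$, $b=\overline{a}$; $-1$ if $b\in Q_1$, $a=\overline{b}$; $0$ otherwise. Two arrows are in involution if one is the double of the other. $\otimes$-cocomplete: all small colimits exist and $\otimes$ preserves them in each variable. $Sx=\bigsqcup_n(x^{\otimes n})_{S_n}$ is the free commutative monoid on $x$. Duality data of $c$: $\mathrm{ev}:c^\vee\otimes c\to1$, $\mathrm{coev}:1\to c\otimes c^\vee$ satisfying the snake identities. $\sigma$ is the symmetry. For $a,b$ in involution, with $i=s(a)=t(b)$,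 $j=t(a)=s(b)$, so $h_a^\vee=c_i\otimes c_j^\vee$ and $h_b^\vee=c_j\otimes c_i^\vee$, let $\varepsilon_{ab}:c_i\otimes c_j^\vee\otimes c_j\otimes c_i^\vee\xrightarrow{\mathrm{id}\otimes\mathrm{ev}\otimes\mathrm{id}}c_i\otimes c_i^\vee\xrightarrow{\mathrm{ev}\circ\sigma}1.$ If $a,b$ are not in involution the component $\langle a,b\rangle\varepsilon_{ab}$ is $0$. For a commutative monoid $m$ in $\mathcal C$, with multiplication $\mu$, a bi-derivation is a map $m\otimes m\to m$ satisfying the Leibniz rule (with respect to $\mu$) in each variable separately and vanishing when the unit is inserted in either variable; bi-derivations on $Sx$ are in bijection, by restriction, with maps $x\otimes x\to Sx$. A Poisson algebra in $\mathcal{C}$ is a commutative monoid $m$ with a bi-derivation $\{-,-\}$ satisfying $\{-,-\}\circ\sigma_{m,m}=-\{-,-\}$ and the Jacobi identity $\{-,-\}\circ(\mathrm{id}\otimes\{-,-\})\circ\mathfrak{S}_3=0$, where $\mathfrak{S}_3$ is the sum of the three cyclic permutations of $m^{\otimes3}$. *)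

theory Defs
  imports "Graph_Theory.Digraph" "HOL-Combinatorics.Permutations" "HOL-Algebra.Module"
begin

section \<open>Categories and colimits\<close>

record ('o, 'm) cat =
  Obj :: "'o set"
  Arr :: "'m set"
  Dom :: "'m \<Rightarrow> 'o"
  Cod :: "'m \<Rightarrow> 'o"
  Ide :: "'o \<Rightarrow> 'm"
  Comp :: "'m \<Rightarrow> 'm \<Rightarrow> 'm"  (infixr \<open>\<cdot>\<index>\<close> 70)

definition Hom :: "('o, 'm, 'z) cat_scheme \<Rightarrow> 'o \<Rightarrow> 'o \<Rightarrow> 'm set" where
  "Hom C x y = {f \<in> Arr C. Dom C f = x \<and> Cod C f = y}"

locale category =
  fixes C :: "('o, 'm, 'z) cat_scheme" (structure)
  assumes dom_obj: "f \<in> Arr C \<Longrightarrow> Dom C f \<in> Obj C"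
    and cod_obj: "f \<in> Arr C \<Longrightarrow> Cod C f \<in> Obj C"
    and ide_hom: "x \<in> Obj C \<Longrightarrow> Ide C x \<in> Hom C x x"
    and comp_hom: "\<lbrakk>f \<in> Hom C x y; g \<in> Hom C y z\<rbrakk> \<Longrightarrow> g \<cdot> f \<in> Hom C x z"
    and comp_assoc: "\<lbrakk>f \<in> Hom C w x; g \<in> Hom C x y; h \<in> Hom C y z\<rbrakk> \<Longrightarrow> (h \<cdot> g) \<cdot> f = h \<cdot> (g \<cdot> f)"
    and comp_ide: "f \<in> Hom C x y \<Longrightarrow> f \<cdot> Ide C x = f"
    and ide_comp: "f \<in> Hom C x y \<Longrightarrow> Ide C y \<cdot> f = f"

definition inverse_arrows :: "('o, 'm, 'z) cat_scheme \<Rightarrow> 'm \<Rightarrow> 'm \<Rightarrow> bool" where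
  "inverse_arrows C f g \<longleftrightarrow>
     f \<in> Arr C \<and> g \<in> Hom C (Cod C f) (Dom C f) \<and>
     g \<cdot>\<^bsub>C\<^esub> f = Ide C (Dom C f) \<and> f \<cdot>\<^bsub>C\<^esub> g = Ide C (Cod C f)"

definition is_iso :: "('o, 'm, 'z) cat_scheme \<Rightarrow> 'm \<Rightarrow> bool" where
  "is_iso C f \<longleftrightarrow> (\<exists>g. inverse_arrows C f g)"

definition inverse_arrow :: "('o, 'm, 'z) cat_scheme \<Rightarrow> 'm \<Rightarrow> 'm" where
  "inverse_arrow C f = (THE g. inverse_arrows C f g)"

definition is_functor ::
  "('i, 'j, 'y) cat_scheme \<Rightarrow> ('o, 'm, 'z) cat_scheme \<Rightarrow> ('i \<Rightarrow> 'o) \<Rightarrow> ('j \<Rightarrow> 'm) \<Rightarrow> bool" where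
  "is_functor J C Fo Fa \<longleftrightarrow>
     (\<forall>i \<in> Obj J. Fo i \<in> Obj C) \<and>
     (\<forall>u \<in> Arr J. Fa u \<in> Hom C (Fo (Dom J u)) (Fo (Cod J u))) \<and>
     (\<forall>i \<in> Obj J. Fa (Ide J i) = Ide C (Fo i)) \<and>
     (\<forall>u \<in> Arr J. \<forall>v \<in> Arr J. Cod J u = Dom J v \<longrightarrow> Fa (v \<cdot>\<^bsub>J\<^esub> u) = Fa v \<cdot>\<^bsub>C\<^esub> Fa u)"

definition is_cocone ::
  "('i, 'j, 'y) cat_scheme \<Rightarrow> ('o, 'm, 'z) cat_scheme \<Rightarrow> ('i \<Rightarrow> 'o) \<Rightarrow> ('j \<Rightarrow> 'm) \<Rightarrow>
   'o \<Rightarrow> ('i \<Rightarrow> 'm) \<Rightarrow> bool" where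
  "is_cocone J C Fo Fa L l \<longleftrightarrow>
     L \<in> Obj C \<and> (\<forall>i \<in> Obj J. l i \<in> Hom C (Fo i) L) \<and>
     (\<forall>u \<in> Arr J. l (Cod J u) \<cdot>\<^bsub>C\<^esub> Fa u = l (Dom J u))"

definition is_colimit ::
  "('i, 'j, 'y) cat_scheme \<Rightarrow> ('o, 'm, 'z) cat_scheme \<Rightarrow> ('i \<Rightarrow> 'o) \<Rightarrow> ('j \<Rightarrow> 'm) \<Rightarrow>
   'o \<Rightarrow> ('i \<Rightarrow> 'm) \<Rightarrow> bool" where
  "is_colimit J C Fo Fa L l \<longleftrightarrow>
     is_cocone J C Fo Fa L l \<and>
     (\<forall>M k. is_cocone J C Fo Fa M k \<longrightarrow>
        (\<exists>!g. g \<in> Hom C L M \<and> (\<forall>i \<in> Obj J. g \<cdot>\<^bsub>C\<^esub> l i = k i)))"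

definition discrete_cat :: "'i set \<Rightarrow> ('i, 'i) cat" where
  "discrete_cat I =
     \<lparr>Obj = I, Arr = I, Dom = (\<lambda>i. i), Cod = (\<lambda>i. i), Ide = (\<lambda>i. i), Comp = (\<lambda>g f. f)\<rparr>"

definition is_coproduct ::
  "('o, 'm, 'z) cat_scheme \<Rightarrow> 'i set \<Rightarrow> ('i \<Rightarrow> 'o) \<Rightarrow> 'o \<Rightarrow> ('i \<Rightarrow> 'm) \<Rightarrow> bool" where
  "is_coproduct C I X L l \<longleftrightarrow> is_colimit (discrete_cat I) C X (\<lambda>i. Ide C (X i)) L l"

text \<open>
  The colimit of an action of a monoid or group on \<open>x\<close>, where \<open>G\<close> is the set of endomorphisms
  of \<open>x\<close> by which it acts.
\<close>

definition is_coinvariants ::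
  "('o, 'm, 'z) cat_scheme \<Rightarrow> 'o \<Rightarrow> 'm set \<Rightarrow> 'o \<Rightarrow> 'm \<Rightarrow> bool" where
  "is_coinvariants C x G y q \<longleftrightarrow>
     y \<in> Obj C \<and> q \<in> Hom C x y \<and> (\<forall>g \<in> G. q \<cdot>\<^bsub>C\<^esub> g = q) \<and>
     (\<forall>z. \<forall>f \<in> Hom C x z. (\<forall>g \<in> G. f \<cdot>\<^bsub>C\<^esub> g = f) \<longrightarrow>
        (\<exists>!k. k \<in> Hom C y z \<and> k \<cdot>\<^bsub>C\<^esub> q = f))"


section \<open>Symmetric monoidal and linear categories\<close>

record ('o, 'm) smcat = "('o, 'm) cat" +
  Tens :: "'o \<Rightarrow> 'o \<Rightarrow> 'o"  (infixr \<open>\<boxtimes>\<index>\<close> 80)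
  TensA :: "'m \<Rightarrow> 'm \<Rightarrow> 'm"  (infixr \<open>\<boxdot>\<index>\<close> 80)
  Unit :: "'o"
  Asc :: "'o \<Rightarrow> 'o \<Rightarrow> 'o \<Rightarrow> 'm"
  LUnit :: "'o \<Rightarrow> 'm"
  RUnit :: "'o \<Rightarrow> 'm"
  Sym :: "'o \<Rightarrow> 'o \<Rightarrow> 'm"

locale symmetric_monoidal_category = category C
  for C :: "('o, 'm, 'z) smcat_scheme" (structure) +
  assumes tens_obj: "\<lbrakk>x \<in> Obj C; y \<in> Obj C\<rbrakk> \<Longrightarrow> x \<boxtimes> y \<in> Obj C"
    and tens_hom: "\<lbrakk>f \<in> Hom C x x'; g \<in> Hom C y y'\<rbrakk> \<Longrightarrow> f \<boxdot> g \<in> Hom C (x \<boxtimes> y) (x' \<boxtimes> y')"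
    and tens_ide: "\<lbrakk>x \<in> Obj C; y \<in> Obj C\<rbrakk> \<Longrightarrow> Ide C x \<boxdot> Ide C y = Ide C (x \<boxtimes> y)"
    and tens_comp:
      "\<lbrakk>f \<in> Hom C x x'; f' \<in> Hom C x' x''; g \<in> Hom C y y'; g' \<in> Hom C y' y''\<rbrakk>
         \<Longrightarrow> (f' \<cdot> f) \<boxdot> (g' \<cdot> g) = (f' \<boxdot> g') \<cdot> (f \<boxdot> g)"
    and unit_obj: "Unit C \<in> Obj C"
    and asc_hom:
      "\<lbrakk>x \<in> Obj C; y \<in> Obj C; z \<in> Obj C\<rbrakk> \<Longrightarrow> Asc C x y z \<in> Hom C ((x \<boxtimes> y) \<boxtimes> z) (x \<boxtimes> (y \<boxtimes> z))"
    and asc_iso: "\<lbrakk>x \<in> Obj C; y \<in> Obj C; z \<in> Obj C\<rbrakk> \<Longrightarrow> is_iso C (Asc C x y z)"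
    and asc_natural:
      "\<lbrakk>f \<in> Hom C x x'; g \<in> Hom C y y'; h \<in> Hom C z z'\<rbrakk>
         \<Longrightarrow> Asc C x' y' z' \<cdot> ((f \<boxdot> g) \<boxdot> h) = (f \<boxdot> (g \<boxdot> h)) \<cdot> Asc C x y z"
    and lunit_hom: "x \<in> Obj C \<Longrightarrow> LUnit C x \<in> Hom C (Unit C \<boxtimes> x) x"
    and lunit_iso: "x \<in> Obj C \<Longrightarrow> is_iso C (LUnit C x)"
    and lunit_natural: "f \<in> Hom C x x' \<Longrightarrow> LUnit C x' \<cdot> (Ide C (Unit C) \<boxdot> f) = f \<cdot> LUnit C x"
    and runit_hom: "x \<in> Obj C \<Longrightarrow> RUnit C x \<in> Hom C (x \<boxtimes> Unit C) x"
    and runit_iso: "x \<in> Obj C \<Longrightarrow> is_iso C (RUnit C x)"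
    and runit_natural: "f \<in> Hom C x x' \<Longrightarrow> RUnit C x' \<cdot> (f \<boxdot> Ide C (Unit C)) = f \<cdot> RUnit C x"
    and sym_hom: "\<lbrakk>x \<in> Obj C; y \<in> Obj C\<rbrakk> \<Longrightarrow> Sym C x y \<in> Hom C (x \<boxtimes> y) (y \<boxtimes> x)"
    and sym_natural:
      "\<lbrakk>f \<in> Hom C x x'; g \<in> Hom C y y'\<rbrakk> \<Longrightarrow> Sym C x' y' \<cdot> (f \<boxdot> g) = (g \<boxdot> f) \<cdot> Sym C x y"
    and sym_sym: "\<lbrakk>x \<in> Obj C; y \<in> Obj C\<rbrakk> \<Longrightarrow> Sym C y x \<cdot> Sym C x y = Ide C (x \<boxtimes> y)"
    and pentagon:
      "\<lbrakk>w \<in> Obj C; x \<in> Obj C; y \<in> Obj C; z \<in> Obj C\<rbrakk> \<Longrightarrow>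
         Asc C w x (y \<boxtimes> z) \<cdot> Asc C (w \<boxtimes> x) y z =
         (Ide C w \<boxdot> Asc C x y z) \<cdot> Asc C w (x \<boxtimes> y) z \<cdot> (Asc C w x y \<boxdot> Ide C z)"
    and triangle:
      "\<lbrakk>x \<in> Obj C; y \<in> Obj C\<rbrakk> \<Longrightarrow>
         (Ide C x \<boxdot> LUnit C y) \<cdot> Asc C x (Unit C) y = RUnit C x \<boxdot> Ide C y"
    and hexagon:
      "\<lbrakk>x \<in> Obj C; y \<in> Obj C; z \<in> Obj C\<rbrakk> \<Longrightarrow>
         Asc C y z x \<cdot> Sym C x (y \<boxtimes> z) \<cdot> Asc C x y z =
         (Ide C y \<boxdot> Sym C x z) \<cdot> Asc C y x z \<cdot> (Sym C x y \<boxdot> Ide C z)"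

record ('o, 'm, 'r) linear_smcat = "('o, 'm) smcat" +
  Plus :: "'m \<Rightarrow> 'm \<Rightarrow> 'm"  (infixl \<open>\<boxplus>\<index>\<close> 65)
  Zero :: "'o \<Rightarrow> 'o \<Rightarrow> 'm"
  Scale :: "'r \<Rightarrow> 'm \<Rightarrow> 'm"

text \<open>The multiplicative part of the \<open>module\<close> record plays no role in the locale \<open>module\<close>.\<close>

definition hom_module ::
  "('o, 'm, 'r, 'z) linear_smcat_scheme \<Rightarrow> 'o \<Rightarrow> 'o \<Rightarrow> ('r, 'm) module" where
  "hom_module C x y =
     \<lparr>carrier = Hom C x y, monoid.mult = undefined, one = undefined,
      zero = Zero C x y, add = Plus C, smult = Scale C\<rparr>"

locale linear_symmetric_monoidal_category =
  symmetric_monoidal_category C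
  for R :: "('r, 'u) ring_scheme" and C :: "('o, 'm, 'r, 'z) linear_smcat_scheme" (structure) +
  assumes hom_is_module: "\<lbrakk>x \<in> Obj C; y \<in> Obj C\<rbrakk> \<Longrightarrow> module R (hom_module C x y)"
    and comp_plus_right:
      "\<lbrakk>f \<in> Hom C x y; f' \<in> Hom C x y; g \<in> Hom C y z\<rbrakk> \<Longrightarrow> g \<cdot> (f \<boxplus> f') = g \<cdot> f \<boxplus> g \<cdot> f'"
    and comp_plus_left:
      "\<lbrakk>f \<in> Hom C x y; g \<in> Hom C y z; g' \<in> Hom C y z\<rbrakk> \<Longrightarrow> (g \<boxplus> g') \<cdot> f = g \<cdot> f \<boxplus> g' \<cdot> f"
    and comp_scale_right:
      "\<lbrakk>r \<in> carrier R; f \<in> Hom C x y; g \<in> Hom C y z\<rbrakk> \<Longrightarrow> g \<cdot> Scale C r f = Scale C r (g \<cdot> f)"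
    and comp_scale_left:
      "\<lbrakk>r \<in> carrier R; f \<in> Hom C x y; g \<in> Hom C y z\<rbrakk> \<Longrightarrow> Scale C r g \<cdot> f = Scale C r (g \<cdot> f)"
    and tens_plus_right:
      "\<lbrakk>f \<in> Hom C x x'; g \<in> Hom C y y'; g' \<in> Hom C y y'\<rbrakk> \<Longrightarrow> f \<boxdot> (g \<boxplus> g') = f \<boxdot> g \<boxplus> f \<boxdot> g'"
    and tens_plus_left:
      "\<lbrakk>f \<in> Hom C x x'; f' \<in> Hom C x x'; g \<in> Hom C y y'\<rbrakk> \<Longrightarrow> (f \<boxplus> f') \<boxdot> g = f \<boxdot> g \<boxplus> f' \<boxdot> g"
    and tens_scale_right:
      "\<lbrakk>r \<in> carrier R; f \<in> Hom C x x'; g \<in> Hom C y y'\<rbrakk> \<Longrightarrow> f \<boxdot> Scale C r g = Scale C r (f \<boxdot> g)"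
    and tens_scale_left:
      "\<lbrakk>r \<in> carrier R; f \<in> Hom C x x'; g \<in> Hom C y y'\<rbrakk> \<Longrightarrow> Scale C r f \<boxdot> g = Scale C r (f \<boxdot> g)"

text \<open>
  HOL has no universes. A diagram counts as small if the objects and the arrows of its shape are
  elements of the type \<open>'j\<close>, which is a free type variable and is only ever assumed to be infinite.
\<close>

definition tensor_cocomplete :: "'j itself \<Rightarrow> ('o, 'm, 'z) smcat_scheme \<Rightarrow> bool" where
  "tensor_cocomplete _ C \<longleftrightarrow>
     (\<forall>(J :: ('j, 'j) cat) Fo Fa. category J \<and> is_functor J C Fo Fa \<longrightarrow>
        (\<exists>L l. is_colimit J C Fo Fa L l) \<and>
        (\<forall>L l. \<forall>x \<in> Obj C. is_colimit J C Fo Fa L l \<longrightarrow>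
           is_colimit J C (\<lambda>i. x \<boxtimes>\<^bsub>C\<^esub> Fo i) (\<lambda>u. Ide C x \<boxdot>\<^bsub>C\<^esub> Fa u)
             (x \<boxtimes>\<^bsub>C\<^esub> L) (\<lambda>i. Ide C x \<boxdot>\<^bsub>C\<^esub> l i) \<and>
           is_colimit J C (\<lambda>i. Fo i \<boxtimes>\<^bsub>C\<^esub> x) (\<lambda>u. Fa u \<boxdot>\<^bsub>C\<^esub> Ide C x)
             (L \<boxtimes>\<^bsub>C\<^esub> x) (\<lambda>i. l i \<boxdot>\<^bsub>C\<^esub> Ide C x)))"


section \<open>Duals, commutative monoids and symmetric algebras\<close>

context
  fixes C :: "('o, 'm, 'z) smcat_scheme" (structure)
begin

definition duality :: "'o \<Rightarrow> 'o \<Rightarrow> 'm \<Rightarrow> 'm \<Rightarrow> bool" where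
  "duality c d ev coev \<longleftrightarrow>
     c \<in> Obj C \<and> d \<in> Obj C \<and>
     ev \<in> Hom C (d \<boxtimes> c) (Unit C) \<and> coev \<in> Hom C (Unit C) (c \<boxtimes> d) \<and>
     RUnit C c \<cdot> (Ide C c \<boxdot> ev) \<cdot> Asc C c d c \<cdot> (coev \<boxdot> Ide C c) \<cdot> inverse_arrow C (LUnit C c)
       = Ide C c \<and>
     LUnit C d \<cdot> (ev \<boxdot> Ide C d) \<cdot> inverse_arrow C (Asc C d c d) \<cdot> (Ide C d \<boxdot> coev) \<cdot>
       inverse_arrow C (RUnit C d) = Ide C d"

definition commutative_monoid :: "'o \<Rightarrow> 'm \<Rightarrow> 'm \<Rightarrow> bool" where
  "commutative_monoid m \<mu> \<eta> \<longleftrightarrow>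
     m \<in> Obj C \<and> \<mu> \<in> Hom C (m \<boxtimes> m) m \<and> \<eta> \<in> Hom C (Unit C) m \<and>
     \<mu> \<cdot> (\<mu> \<boxdot> Ide C m) = \<mu> \<cdot> (Ide C m \<boxdot> \<mu>) \<cdot> Asc C m m m \<and>
     \<mu> \<cdot> (\<eta> \<boxdot> Ide C m) = LUnit C m \<and> \<mu> \<cdot> (Ide C m \<boxdot> \<eta>) = RUnit C m \<and>
     \<mu> \<cdot> Sym C m m = \<mu>"

primrec tensor_pow :: "'o \<Rightarrow> nat \<Rightarrow> 'o" where
  "tensor_pow x 0 = Unit C"
| "tensor_pow x (Suc n) = tensor_pow x n \<boxtimes> x"

text \<open>
  \<open>adjacent_swap x n k\<close>, for \<open>Suc k < n\<close>, interchanges the tensor factors \<open>k\<close> and \<open>Suc k\<close>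
  (counted from 0) of the \<open>n\<close>-th tensor power of \<open>x\<close>.
\<close>

fun adjacent_swap :: "'o \<Rightarrow> nat \<Rightarrow> nat \<Rightarrow> 'm" where
  "adjacent_swap x (Suc (Suc m)) k =
     (if k = m
      then inverse_arrow C (Asc C (tensor_pow x m) x x) \<cdot>
             (Ide C (tensor_pow x m) \<boxdot> Sym C x x) \<cdot> Asc C (tensor_pow x m) x x
      else adjacent_swap x (Suc m) k \<boxdot> Ide C x)"
| "adjacent_swap x _ k = Ide C x"

text \<open>
  \<open>permutation_arrow x n \<pi> f\<close> holds if \<open>f\<close> is the action of the permutation \<open>\<pi>\<close> of
  \<open>{0, \<dots>, n - 1}\<close> on the \<open>n\<close>-th tensor power of \<open>x\<close>, calculated from some expression of \<open>\<pi>\<close> as a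
  product of adjacent transpositions.
\<close>

inductive permutation_arrow :: "'o \<Rightarrow> nat \<Rightarrow> (nat \<Rightarrow> nat) \<Rightarrow> 'm \<Rightarrow> bool" for x n where
  identity: "permutation_arrow x n id (Ide C (tensor_pow x n))"
| adjacent: "\<lbrakk>permutation_arrow x n \<pi> f; Suc k < n\<rbrakk> \<Longrightarrow>
    permutation_arrow x n (transpose k (Suc k) \<circ> \<pi>) (adjacent_swap x n k \<cdot> f)"

definition symmetric_group_action :: "'o \<Rightarrow> nat \<Rightarrow> 'm set" where
  "symmetric_group_action x n = {f. \<exists>\<pi>. \<pi> permutes {..<n} \<and> permutation_arrow x n \<pi> f}"

primrec concatenation :: "'o \<Rightarrow> nat \<Rightarrow> nat \<Rightarrow> 'm" where
  "concatenation x n 0 = RUnit C (tensor_pow x n)"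
| "concatenation x n (Suc m) =
     (concatenation x n m \<boxdot> Ide C x) \<cdot> inverse_arrow C (Asc C (tensor_pow x n) (tensor_pow x m) x)"

text \<open>
  \<open>(S, \<mu>, \<eta>)\<close> is the free commutative monoid on \<open>x\<close>: its object is the coproduct of the
  coinvariants of the tensor powers of \<open>x\<close>, with the maps \<open>p n\<close> from the \<open>n\<close>-th tensor power to \<open>S\<close>
  as structure maps, and it is multiplied by concatenation.
\<close>

definition symmetric_algebra :: "'o \<Rightarrow> (nat \<Rightarrow> 'm) \<Rightarrow> 'o \<Rightarrow> 'm \<Rightarrow> 'm \<Rightarrow> bool" where
  "symmetric_algebra x p S \<mu> \<eta> \<longleftrightarrow>
     x \<in> Obj C \<and>
     (\<exists>y q i. (\<forall>n. is_coinvariants C (tensor_pow x n) (symmetric_group_action x n) (y n) (q n)) \<and>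
        is_coproduct C (UNIV :: nat set) y S i \<and>
        (\<forall>n. p n = i n \<cdot> q n)) \<and>
     commutative_monoid S \<mu> \<eta> \<and> \<eta> = p 0 \<and>
     (\<forall>n m. \<mu> \<cdot> (p n \<boxdot> p m) = p (n + m) \<cdot> concatenation x n m)"

text \<open>The first tensor power of \<open>x\<close> is \<open>Unit C \<boxtimes> x\<close> rather than \<open>x\<close>.\<close>

definition generator_inclusion :: "'o \<Rightarrow> (nat \<Rightarrow> 'm) \<Rightarrow> 'm" where
  "generator_inclusion x p = p 1 \<cdot> inverse_arrow C (LUnit C x)"

end


section \<open>Poisson algebras\<close>

context
  fixes C :: "('o, 'm, 'r, 'z) linear_smcat_scheme" (structure)
begin

text \<open>The Leibniz rules are \<open>{xy, z} = x{y, z} + {x, z}y\<close> and \<open>{x, yz} = {x, y}z + y{x, z}\<close>.\<close>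

definition biderivation :: "'o \<Rightarrow> 'm \<Rightarrow> 'm \<Rightarrow> 'm \<Rightarrow> bool" where
  "biderivation m \<mu> \<eta> d \<longleftrightarrow>
     d \<in> Hom C (m \<boxtimes> m) m \<and>
     d \<cdot> (\<mu> \<boxdot> Ide C m) =
       \<mu> \<cdot> (Ide C m \<boxdot> d) \<cdot> Asc C m m m \<boxplus>
       \<mu> \<cdot> (d \<boxdot> Ide C m) \<cdot>
         inverse_arrow C (Asc C m m m) \<cdot> (Ide C m \<boxdot> Sym C m m) \<cdot> Asc C m m m \<and>
     d \<cdot> (Ide C m \<boxdot> \<mu>) =
       \<mu> \<cdot> (d \<boxdot> Ide C m) \<cdot> inverse_arrow C (Asc C m m m) \<boxplus>
       \<mu> \<cdot> (Ide C m \<boxdot> d) \<cdot>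
         Asc C m m m \<cdot> (Sym C m m \<boxdot> Ide C m) \<cdot> inverse_arrow C (Asc C m m m) \<and>
     d \<cdot> (\<eta> \<boxdot> Ide C m) = Zero C (Unit C \<boxtimes> m) m \<and>
     d \<cdot> (Ide C m \<boxdot> \<eta>) = Zero C (m \<boxtimes> Unit C) m"

definition cyclic_permutation :: "'o \<Rightarrow> 'm" where
  "cyclic_permutation m = Asc C m m m \<cdot> Sym C m (m \<boxtimes> m)"

definition cyclic_sum :: "'o \<Rightarrow> 'm" where
  "cyclic_sum m =
     Ide C (m \<boxtimes> (m \<boxtimes> m)) \<boxplus> cyclic_permutation m \<boxplus>
     cyclic_permutation m \<cdot> cyclic_permutation m"

definition poisson_algebra :: "'o \<Rightarrow> 'm \<Rightarrow> 'm \<Rightarrow> 'm \<Rightarrow> bool" where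
  "poisson_algebra m \<mu> \<eta> d \<longleftrightarrow>
     commutative_monoid C m \<mu> \<eta> \<and> biderivation m \<mu> \<eta> d \<and>
     d \<cdot> Sym C m m = \<ominus>\<^bsub>hom_module C (m \<boxtimes> m) m\<^esub> d \<and>
     d \<cdot> (Ide C m \<boxdot> d) \<cdot> cyclic_sum m = Zero C (m \<boxtimes> (m \<boxtimes> m)) m"

end


section \<open>Quivers\<close>

text \<open>
  Quivers are directed multigraphs, possibly with loops; \<open>tail\<close> and \<open>head\<close> are the source and
  target maps. In the double, \<open>Inl a\<close> is the arrow \<open>a\<close> and \<open>Inr a\<close> is its double.
\<close>

definition double_quiver :: "('v, 'q) pre_digraph \<Rightarrow> ('v, 'q + 'q) pre_digraph" where
  "double_quiver Q =
     \<lparr>verts = verts Q, arcs = arcs Q <+> arcs Q,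
      tail = case_sum (tail Q) (head Q), head = case_sum (head Q) (tail Q)\<rparr>"

definition involution_pair :: "'q + 'q \<Rightarrow> 'q + 'q \<Rightarrow> bool" where
  "involution_pair a b \<longleftrightarrow> (\<exists>e. a = Inl e \<and> b = Inr e \<or> a = Inr e \<and> b = Inl e)"

definition arrow_pairing :: "('r, 'u) ring_scheme \<Rightarrow> 'q + 'q \<Rightarrow> 'q + 'q \<Rightarrow> 'r" where
  "arrow_pairing R a b =
     (if \<exists>e. a = Inl e \<and> b = Inr e then \<one>\<^bsub>R\<^esub>
      else if \<exists>e. a = Inr e \<and> b = Inl e then \<ominus>\<^bsub>R\<^esub> \<one>\<^bsub>R\<^esub>
      else \<zero>\<^bsub>R\<^esub>)"

definition arrow_object ::
  "('o, 'm, 'z) smcat_scheme \<Rightarrow> ('v, 'q) pre_digraph \<Rightarrow> ('v \<Rightarrow> 'o) \<Rightarrow> ('v \<Rightarrow> 'o) \<Rightarrow> 'q + 'q \<Rightarrow> 'o" where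
  "arrow_object C Q c d a =
     c (tail (double_quiver Q) a) \<boxtimes>\<^bsub>C\<^esub> d (head (double_quiver Q) a)"

text \<open>Here \<open>d i\<close> is the dual of \<open>c i\<close> and \<open>ev i : d i \<boxtimes> c i \<rightarrow> Unit C\<close> its evaluation.\<close>

definition double_evaluation ::
  "('o, 'm, 'z) smcat_scheme \<Rightarrow> ('v \<Rightarrow> 'o) \<Rightarrow> ('v \<Rightarrow> 'o) \<Rightarrow> ('v \<Rightarrow> 'm) \<Rightarrow> 'v \<Rightarrow> 'v \<Rightarrow> 'm" where
  "double_evaluation C c d ev i j =
     ev i \<cdot>\<^bsub>C\<^esub> Sym C (c i) (d i) \<cdot>\<^bsub>C\<^esub>
     (Ide C (c i) \<boxdot>\<^bsub>C\<^esub>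
        (LUnit C (d i) \<cdot>\<^bsub>C\<^esub> (ev j \<boxdot>\<^bsub>C\<^esub> Ide C (d i)) \<cdot>\<^bsub>C\<^esub>
         inverse_arrow C (Asc C (d j) (c j) (d i)))) \<cdot>\<^bsub>C\<^esub>
     Asc C (c i) (d j) (c j \<boxtimes>\<^bsub>C\<^esub> d i)"

text \<open>
  The component with index \<open>a, b\<close>. The case distinction is needed since \<open>\<epsilon>\<close> has the domain
  \<open>arrow_object a \<boxtimes> arrow_object b\<close> only for arrows in involution.
\<close>

definition bracket_component ::
  "('r, 'u) ring_scheme \<Rightarrow> ('o, 'm, 'r, 'z) linear_smcat_scheme \<Rightarrow> ('v, 'q) pre_digraph \<Rightarrow>
   ('v \<Rightarrow> 'o) \<Rightarrow> ('v \<Rightarrow> 'o) \<Rightarrow> ('v \<Rightarrow> 'm) \<Rightarrow> 'q + 'q \<Rightarrow> 'q + 'q \<Rightarrow> 'm" where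
  "bracket_component R C Q c d ev a b =
     (if involution_pair a b
      then Scale C (arrow_pairing R a b)
             (double_evaluation C c d ev (tail (double_quiver Q) a) (head (double_quiver Q) a))
      else Zero C (arrow_object C Q c d a \<boxtimes>\<^bsub>C\<^esub> arrow_object C Q c d b) (Unit C))"

text \<open>
  Here \<open>(S, \<mu>, \<eta>)\<close> is the symmetric algebra, with structure maps \<open>p\<close>, of the object \<open>h\<close>, which is
  the direct sum of the arrow objects with inclusions \<open>incl\<close>.
\<close>

definition quiver_bracket ::
  "('r, 'u) ring_scheme \<Rightarrow> ('o, 'm, 'r, 'z) linear_smcat_scheme \<Rightarrow> ('v, 'q) pre_digraph \<Rightarrow>
   ('v \<Rightarrow> 'o) \<Rightarrow> ('v \<Rightarrow> 'o) \<Rightarrow> ('v \<Rightarrow> 'm) \<Rightarrow> 'o \<Rightarrow> ('q + 'q \<Rightarrow> 'm) \<Rightarrow>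
   (nat \<Rightarrow> 'm) \<Rightarrow> 'o \<Rightarrow> 'm \<Rightarrow> 'm \<Rightarrow> 'm \<Rightarrow> bool" where
  "quiver_bracket R C Q c d ev h incl p S \<mu> \<eta> br \<longleftrightarrow>
     biderivation C S \<mu> \<eta> br \<and>
     (\<forall>a \<in> arcs (double_quiver Q). \<forall>b \<in> arcs (double_quiver Q).
        br \<cdot>\<^bsub>C\<^esub> ((generator_inclusion C h p \<cdot>\<^bsub>C\<^esub> incl a) \<boxdot>\<^bsub>C\<^esub>
                (generator_inclusion C h p \<cdot>\<^bsub>C\<^esub> incl b))
          = \<eta> \<cdot>\<^bsub>C\<^esub> bracket_component R C Q c d ev a b)"

end

theory Submission
  imports Defs
begin

text \<open>
  A map \<open>D : S \<otimes> z \<rightarrow> S\<close> that is a derivation in its first argument is determined by its restriction to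
  \<open>h \<otimes> z\<close>, and every map \<open>\<phi> : h \<otimes> z \<rightarrow> S\<close> extends to one: on the tensor powers of \<open>h\<close> put
  \<open>D (u \<otimes> v, w) = u \<phi>(v, w) + D (u, w) v\<close>, which is invariant under adjacent transpositions and
  hence descends to \<open>S\<close>. Using this twice, once in each argument, gives existence and uniqueness of
  the bracket. It is skew since its symmetrisation is a biderivation that vanishes on generators. Its
  Jacobiator is a derivation in each argument and vanishes on generators, where the inner bracket
  factors through the unit.

  The computations are done with generalised elements (locale \<open>stages\<close>): an element of \<open>y\<close> is a map to
  \<open>y\<close> from the tensor product of a finite set of variables, and elements over disjoint sets of
  variables can be paired. The coherence isomorphisms then act by rebracketing and reordering pairs,
  so that identities between arrows become identities in an ordinary commutative algebra.
\<close>

section \<open>Coherence in symmetric monoidal categories\<close>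

text \<open>The quiver enters only through skewness: every skew pairing
  \<open>h \<boxtimes> h -> Unit C\<close> gives a Poisson algebra in this way. For the quiver,
  skewness is the sign change of \<open>arrow_pairing\<close> against the symmetry of
  \<open>double_evaluation\<close>, and the latter holds because both orders of evaluation produce
  the product of the same two scalars. The obstacle is that \<open>S\<close> is known as a colimit
  of tensor powers, while the Leibniz rules and the Jacobi identity have several arguments. Hence
  derivations carry a parameter object \<open>z\<close>, the colimit must be known after tensoring
  with \<open>z\<close>, and an argument is treated only once the symmetry has brought it to the
  front. That the Jacobiator is a derivation is not formal. Expanding two nested brackets on a
  product \<open>ab\<close> leaves crossed terms such as \<open>{x, a}{y, b}\<close>, which cancel
  only by skewness of the bracket on all of \<open>S\<close>, so that skewness has to be proved
  before the Jacobi identity.\<close>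

context category begin

text \<open>Arrows are typed by equations between \<open>Dom\<close> and \<open>Cod\<close> rather
  than by membership in \<open>Hom\<close>, so that the simplifier can compute the side conditions.
  Composites are then normalised to the right.\<close>

lemma arr_comp [simp]:
  assumes "f \<in> Arr C" "g \<in> Arr C" "Dom C g = Cod C f"
  shows "g \<cdot> f \<in> Arr C" "Dom C (g \<cdot> f) = Dom C f" "Cod C (g \<cdot> f) = Cod C g"
  using comp_hom[of f "Dom C f" "Cod C f" g "Cod C g"] assms by (auto simp: Hom_def)

lemma arr_ide [simp]:
  assumes "x \<in> Obj C"
  shows "Ide C x \<in> Arr C" "Dom C (Ide C x) = x" "Cod C (Ide C x) = x"
  using ide_hom[OF assms] by (auto simp: Hom_def)

declare dom_obj [simp] cod_obj [simp]

lemma assoc [simp]: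
  assumes "f \<in> Arr C" "g \<in> Arr C" "h \<in> Arr C" "Dom C g = Cod C f" "Dom C h = Cod C g"
  shows "(h \<cdot> g) \<cdot> f = h \<cdot> g \<cdot> f"
  using comp_assoc[of f "Dom C f" "Cod C f" g "Cod C g" h "Cod C h"] assms by (auto simp: Hom_def)

lemma ide_left [simp]: "f \<in> Arr C \<Longrightarrow> Cod C f = x \<Longrightarrow> Ide C x \<cdot> f = f"
  using ide_comp[of f "Dom C f" x] by (auto simp: Hom_def)

lemma ide_right [simp]: "f \<in> Arr C \<Longrightarrow> Dom C f = x \<Longrightarrow> f \<cdot> Ide C x = f"
  using comp_ide[of f x "Cod C f"] by (auto simp: Hom_def)

lemma inverse_arrowsI:
  assumes "f \<in> Arr C" "g \<in> Arr C" "Dom C g = Cod C f" "Cod C g = Dom C f"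
    "g \<cdot> f = Ide C (Dom C f)" "f \<cdot> g = Ide C (Cod C f)"
  shows "inverse_arrows C f g"
  using assms by (auto simp: inverse_arrows_def Hom_def)

lemma inverse_arrows_unique:
  assumes "inverse_arrows C f g" "inverse_arrows C f g'"
  shows "g = g'"
proof -
  have "g = g \<cdot> f \<cdot> g'"
    using assms by (auto simp: inverse_arrows_def Hom_def)
  also have "\<dots> = (g \<cdot> f) \<cdot> g'"
    using assms by (intro assoc[symmetric]) (auto simp: inverse_arrows_def Hom_def)
  also have "\<dots> = g'"
    using assms by (auto simp: inverse_arrows_def Hom_def)
  finally show ?thesis .
qed

lemma inverse_arrows_inverse_arrow:
  assumes "is_iso C f"
  shows "inverse_arrows C f (inverse_arrow C f)"
proof -
  obtain g where g: "inverse_arrows C f g"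
    using assms by (auto simp: is_iso_def)
  then have "inverse_arrow C f = g"
    unfolding inverse_arrow_def by (rule the_equality) (rule inverse_arrows_unique[OF _ g])
  then show ?thesis
    using g by simp
qed

lemma is_iso_arr: "is_iso C f \<Longrightarrow> f \<in> Arr C"
  by (auto simp: is_iso_def inverse_arrows_def)

lemma arr_inverse [simp]:
  assumes "is_iso C f"
  shows "inverse_arrow C f \<in> Arr C" "Dom C (inverse_arrow C f) = Cod C f"
    "Cod C (inverse_arrow C f) = Dom C f"
    "inverse_arrow C f \<cdot> f = Ide C (Dom C f)" "f \<cdot> inverse_arrow C f = Ide C (Cod C f)"
  using inverse_arrows_inverse_arrow[OF assms] by (auto simp: inverse_arrows_def Hom_def)

lemma inverse_cancel [simp]:
  assumes "is_iso C f" "k \<in> Arr C"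
  shows "Cod C k = Dom C f \<Longrightarrow> inverse_arrow C f \<cdot> f \<cdot> k = k"
    "Cod C k = Cod C f \<Longrightarrow> f \<cdot> inverse_arrow C f \<cdot> k = k"
  using assms is_iso_arr[OF assms(1)] by (simp_all flip: assoc)

lemma iso_inverse [simp]:
  assumes "is_iso C f"
  shows "is_iso C (inverse_arrow C f)"
  unfolding is_iso_def
  by (rule exI[of _ f], rule inverse_arrowsI) (use assms is_iso_arr[OF assms] in auto)

lemma iso_comp [simp]:
  assumes "is_iso C f" "is_iso C g" "Dom C g = Cod C f"
  shows "is_iso C (g \<cdot> f)"
  unfolding is_iso_def
  by (rule exI[of _ "inverse_arrow C f \<cdot> inverse_arrow C g"], rule inverse_arrowsI)
    (use assms is_iso_arr in auto)

lemma iso_ide [simp]: "x \<in> Obj C \<Longrightarrow> is_iso C (Ide C x)"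
  unfolding is_iso_def by (rule exI[of _ "Ide C x"], rule inverse_arrowsI) auto

lemma iso_cancel_left:
  assumes "is_iso C i" "f \<in> Arr C" "g \<in> Arr C" "Cod C f = Dom C i" "Cod C g = Dom C i"
    "i \<cdot> f = i \<cdot> g"
  shows "f = g"
  using arg_cong[OF assms(6), of "\<lambda>k. inverse_arrow C i \<cdot> k"] assms(1-5) by simp

lemma iso_cancel_right:
  assumes "is_iso C i" "f \<in> Arr C" "g \<in> Arr C" "Dom C f = Cod C i" "Dom C g = Cod C i"
    "f \<cdot> i = g \<cdot> i"
  shows "f = g"
  using arg_cong[OF assms(6), of "\<lambda>k. k \<cdot> inverse_arrow C i"] assms(1-5) is_iso_arr[OF assms(1)] by simp

text \<open>Once composites are bracketed to the right, an equation
  \<open>g \<cdot> f = g' \<cdot> f'\<close> no longer matches inside a longer composite. The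
  \<open>_tail\<close> variants of the naturality rules are obtained from this.\<close>

lemma comp_tail:
  assumes "g \<cdot> f = g' \<cdot> f'" "k \<in> Arr C" "Dom C f = Cod C k" "Dom C f' = Cod C k"
    "f \<in> Arr C" "g \<in> Arr C" "Dom C g = Cod C f" "f' \<in> Arr C" "g' \<in> Arr C" "Dom C g' = Cod C f'"
  shows "g \<cdot> f \<cdot> k = g' \<cdot> f' \<cdot> k"
  using arg_cong[OF assms(1), of "\<lambda>l. l \<cdot> k"] assms(2-) by simp

end

section \<open>Coherence for unitors, associator and symmetry\<close>

context symmetric_monoidal_category begin

declare tens_obj [simp] unit_obj [simp] asc_iso [simp] lunit_iso [simp] runit_iso [simp]

lemma arr_tens [simp]:
  assumes "f \<in> Arr C" "g \<in> Arr C"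
  shows "f \<boxdot> g \<in> Arr C" "Dom C (f \<boxdot> g) = Dom C f \<boxtimes> Dom C g" "Cod C (f \<boxdot> g) = Cod C f \<boxtimes> Cod C g"
  using tens_hom[of f "Dom C f" "Cod C f" g "Dom C g" "Cod C g"] assms by (auto simp: Hom_def)

lemma arr_asc [simp]:
  assumes "x \<in> Obj C" "y \<in> Obj C" "z \<in> Obj C"
  shows "Asc C x y z \<in> Arr C" "Dom C (Asc C x y z) = (x \<boxtimes> y) \<boxtimes> z"
    "Cod C (Asc C x y z) = x \<boxtimes> y \<boxtimes> z"
  using asc_hom[OF assms] by (auto simp: Hom_def)

lemma arr_unit [simp]:
  assumes "x \<in> Obj C"
  shows "LUnit C x \<in> Arr C" "Dom C (LUnit C x) = Unit C \<boxtimes> x" "Cod C (LUnit C x) = x"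
    "RUnit C x \<in> Arr C" "Dom C (RUnit C x) = x \<boxtimes> Unit C" "Cod C (RUnit C x) = x"
  using lunit_hom[OF assms] runit_hom[OF assms] by (auto simp: Hom_def)

lemma arr_sym [simp]:
  assumes "x \<in> Obj C" "y \<in> Obj C"
  shows "Sym C x y \<in> Arr C" "Dom C (Sym C x y) = x \<boxtimes> y" "Cod C (Sym C x y) = y \<boxtimes> x"
  using sym_hom[OF assms] by (auto simp: Hom_def)

declare tens_ide [simp] sym_sym [simp]

lemma interchange [simp]:
  assumes "f \<in> Arr C" "f' \<in> Arr C" "g \<in> Arr C" "g' \<in> Arr C" "Dom C f' = Cod C f" "Dom C g' = Cod C g"
  shows "(f' \<boxdot> g') \<cdot> (f \<boxdot> g) = (f' \<cdot> f) \<boxdot> (g' \<cdot> g)"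
  using tens_comp[of f "Dom C f" "Cod C f" f' "Cod C f'" g "Dom C g" "Cod C g" g' "Cod C g'"] assms
  by (auto simp: Hom_def)

lemma interchange_tail [simp]:
  assumes "f \<in> Arr C" "f' \<in> Arr C" "g \<in> Arr C" "g' \<in> Arr C" "Dom C f' = Cod C f" "Dom C g' = Cod C g"
    "k \<in> Arr C" "Cod C k = Dom C f \<boxtimes> Dom C g"
  shows "(f' \<boxdot> g') \<cdot> (f \<boxdot> g) \<cdot> k = ((f' \<cdot> f) \<boxdot> (g' \<cdot> g)) \<cdot> k"
  using assms by (simp flip: assoc)

lemma sym_cancel [simp]:
  assumes "x \<in> Obj C" "y \<in> Obj C" "k \<in> Arr C" "Cod C k = x \<boxtimes> y"
  shows "Sym C y x \<cdot> Sym C x y \<cdot> k = k"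
  using assms by (simp flip: assoc)

lemma iso_sym [simp]: "x \<in> Obj C \<Longrightarrow> y \<in> Obj C \<Longrightarrow> is_iso C (Sym C x y)"
  unfolding is_iso_def by (rule exI[of _ "Sym C y x"], rule inverse_arrowsI) auto

lemma iso_tens [simp]:
  assumes "is_iso C f" "is_iso C g"
  shows "is_iso C (f \<boxdot> g)"
  unfolding is_iso_def
  by (rule exI[of _ "inverse_arrow C f \<boxdot> inverse_arrow C g"], rule inverse_arrowsI)
    (use assms is_iso_arr in auto)

lemma asc_nat:
  assumes "f \<in> Arr C" "g \<in> Arr C" "k \<in> Arr C"
    "Cod C f = x" "Cod C g = y" "Cod C k = z"
  shows "Asc C x y z \<cdot> ((f \<boxdot> g) \<boxdot> k) = (f \<boxdot> g \<boxdot> k) \<cdot> Asc C (Dom C f) (Dom C g) (Dom C k)"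
  using asc_natural[of f "Dom C f" x g "Dom C g" y k "Dom C k" z] assms
  by (auto simp: Hom_def)

lemma asc_nat_tail:
  assumes "f \<in> Arr C" "g \<in> Arr C" "k \<in> Arr C"
    "Cod C f = x" "Cod C g = y" "Cod C k = z"
    "l \<in> Arr C" "Cod C l = (Dom C f \<boxtimes> Dom C g) \<boxtimes> Dom C k"
  shows "Asc C x y z \<cdot> ((f \<boxdot> g) \<boxdot> k) \<cdot> l = (f \<boxdot> g \<boxdot> k) \<cdot> Asc C (Dom C f) (Dom C g) (Dom C k) \<cdot> l"
  by (rule comp_tail[OF asc_nat]) (use assms in auto)

lemma sym_nat:
  assumes "f \<in> Arr C" "g \<in> Arr C" "Cod C f = x" "Cod C g = y"
  shows "Sym C x y \<cdot> (f \<boxdot> g) = (g \<boxdot> f) \<cdot> Sym C (Dom C f) (Dom C g)"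
  using sym_natural[of f "Dom C f" x g "Dom C g" y] assms by (auto simp: Hom_def)

lemma sym_nat_tail:
  assumes "f \<in> Arr C" "g \<in> Arr C" "Cod C f = x" "Cod C g = y" "l \<in> Arr C"
    "Cod C l = Dom C f \<boxtimes> Dom C g"
  shows "Sym C x y \<cdot> (f \<boxdot> g) \<cdot> l = (g \<boxdot> f) \<cdot> Sym C (Dom C f) (Dom C g) \<cdot> l"
  by (rule comp_tail[OF sym_nat]) (use assms in auto)

lemma lunit_nat:
  assumes "f \<in> Arr C" "Cod C f = x"
  shows "LUnit C x \<cdot> (Ide C (Unit C) \<boxdot> f) = f \<cdot> LUnit C (Dom C f)"
  using lunit_natural[of f "Dom C f" x] assms by (auto simp: Hom_def)

lemma runit_nat:
  assumes "f \<in> Arr C" "Cod C f = x"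
  shows "RUnit C x \<cdot> (f \<boxdot> Ide C (Unit C)) = f \<cdot> RUnit C (Dom C f)"
  using runit_natural[of f "Dom C f" x] assms by (auto simp: Hom_def)

text \<open>The invertible unitor conjugates \<open>Ide C (Unit C) \<boxdot> f\<close> into
  \<open>f\<close> by naturality. So an equation may be tensored with the unit first, which makes
  room for instances of pentagon and hexagon with additional unit factors.\<close>

lemma unit_tens_faithful:
  assumes "f \<in> Arr C" "g \<in> Arr C" "Dom C f = Dom C g" "Cod C f = Cod C g"
    "Ide C (Unit C) \<boxdot> f = Ide C (Unit C) \<boxdot> g"
  shows "f = g"
proof (rule iso_cancel_right)
  show "f \<cdot> LUnit C (Dom C g) = g \<cdot> LUnit C (Dom C g)"
    using lunit_nat[of f] lunit_nat[of g] assms by simp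
qed (use assms in auto)

lemma tens_unit_faithful:
  assumes "f \<in> Arr C" "g \<in> Arr C" "Dom C f = Dom C g" "Cod C f = Cod C g"
    "f \<boxdot> Ide C (Unit C) = g \<boxdot> Ide C (Unit C)"
  shows "f = g"
proof (rule iso_cancel_right)
  show "f \<cdot> RUnit C (Dom C g) = g \<cdot> RUnit C (Dom C g)"
    using runit_nat[of f] runit_nat[of g] assms by simp
qed (use assms in auto)

text \<open>Kelly's argument: tensor with the unit on the left, then combine the pentagon for
  \<open>Unit C\<close>, \<open>Unit C\<close>, \<open>x\<close>, \<open>y\<close> with two
  triangles.\<close>

lemma lunit_tens:
  assumes x: "x \<in> Obj C" and y: "y \<in> Obj C"
  shows "LUnit C (x \<boxtimes> y) \<cdot> Asc C (Unit C) x y = LUnit C x \<boxdot> Ide C y"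
proof (rule unit_tens_faithful)
  let ?I = "Unit C"
  let ?i = "Ide C (Unit C)"
  let ?k = "Asc C ?I (?I \<boxtimes> x) y \<cdot> (Asc C ?I ?I x \<boxdot> Ide C y)"
  show "?i \<boxdot> (LUnit C (x \<boxtimes> y) \<cdot> Asc C ?I x y) = ?i \<boxdot> LUnit C x \<boxdot> Ide C y"
  proof (rule iso_cancel_right)
    have "(?i \<boxdot> (LUnit C (x \<boxtimes> y) \<cdot> Asc C ?I x y)) \<cdot> ?k
        = (?i \<boxdot> LUnit C (x \<boxtimes> y)) \<cdot> (?i \<boxdot> Asc C ?I x y) \<cdot> ?k"
      using x y by simp
    also have "\<dots> = (?i \<boxdot> LUnit C (x \<boxtimes> y)) \<cdot> Asc C ?I ?I (x \<boxtimes> y) \<cdot> Asc C (?I \<boxtimes> ?I) x y"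
      using x y by (simp only: pentagon unit_obj)
    also have "\<dots> = (RUnit C ?I \<boxdot> Ide C (x \<boxtimes> y)) \<cdot> Asc C (?I \<boxtimes> ?I) x y"
      using x y by (simp add: triangle flip: assoc)
    also have "\<dots> = Asc C ?I x y \<cdot> ((RUnit C ?I \<boxdot> Ide C x) \<boxdot> Ide C y)"
      using x y by (simp add: asc_nat)
    also have "\<dots> = Asc C ?I x y \<cdot> ((?i \<boxdot> LUnit C x) \<boxdot> Ide C y) \<cdot> (Asc C ?I ?I x \<boxdot> Ide C y)"
      using x y by (simp add: triangle)
    also have "\<dots> = (?i \<boxdot> LUnit C x \<boxdot> Ide C y) \<cdot> ?k"
      using x y by (subst asc_nat_tail) simp_all
    finally show "(?i \<boxdot> (LUnit C (x \<boxtimes> y) \<cdot> Asc C ?I x y)) \<cdot> ?k = (?i \<boxdot> LUnit C x \<boxdot> Ide C y) \<cdot> ?k" .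
  qed (use x y in auto)
qed (use assms in auto)

text \<open>Tensor with the unit on the right and use the hexagon for \<open>x\<close>,
  \<open>Unit C\<close>, \<open>Unit C\<close>. Naturality of the symmetry and of the left unitor
  leaves an invertible factor \<open>Sym C x (Unit C)\<close> on both sides.\<close>

lemma lunit_sym:
  assumes x: "x \<in> Obj C"
  shows "LUnit C x \<cdot> Sym C x (Unit C) = RUnit C x"
proof (rule tens_unit_faithful)
  let ?I = "Unit C"
  let ?i = "Ide C (Unit C)"
  show "(LUnit C x \<cdot> Sym C x ?I) \<boxdot> ?i = RUnit C x \<boxdot> ?i"
  proof (rule iso_cancel_left)
    have "Sym C x ?I \<cdot> (RUnit C x \<boxdot> ?i) = Sym C x ?I \<cdot> (Ide C x \<boxdot> LUnit C ?I) \<cdot> Asc C x ?I ?I"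
      using x by (simp add: triangle)
    also have "\<dots> = (LUnit C ?I \<boxdot> Ide C x) \<cdot> Sym C x (?I \<boxtimes> ?I) \<cdot> Asc C x ?I ?I"
      using x by (subst sym_nat_tail) simp_all
    also have "\<dots> = LUnit C (?I \<boxtimes> x) \<cdot> Asc C ?I ?I x \<cdot> Sym C x (?I \<boxtimes> ?I) \<cdot> Asc C x ?I ?I"
      using x by (simp flip: lunit_tens)
    also have "\<dots> = LUnit C (?I \<boxtimes> x) \<cdot> (?i \<boxdot> Sym C x ?I) \<cdot> Asc C ?I x ?I \<cdot> (Sym C x ?I \<boxdot> ?i)"
      using x by (simp only: hexagon unit_obj)
    also have "\<dots> = (LUnit C (?I \<boxtimes> x) \<cdot> (?i \<boxdot> Sym C x ?I)) \<cdot> Asc C ?I x ?I \<cdot> (Sym C x ?I \<boxdot> ?i)"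
      using x by simp
    also have "\<dots> = Sym C x ?I \<cdot> (LUnit C (x \<boxtimes> ?I) \<cdot> Asc C ?I x ?I) \<cdot> (Sym C x ?I \<boxdot> ?i)"
      using x by (subst lunit_nat) simp_all
    also have "\<dots> = Sym C x ?I \<cdot> ((LUnit C x \<cdot> Sym C x ?I) \<boxdot> ?i)"
      using x by (subst lunit_tens) simp_all
    finally show "Sym C x ?I \<cdot> ((LUnit C x \<cdot> Sym C x ?I) \<boxdot> ?i) = Sym C x ?I \<cdot> (RUnit C x \<boxdot> ?i)" ..
  qed (use x in auto)
qed (use assms in auto)

lemma lunit_unit_tens:
  assumes "x \<in> Obj C"
  shows "LUnit C (Unit C \<boxtimes> x) = Ide C (Unit C) \<boxdot> LUnit C x"
  by (rule iso_cancel_left[of "LUnit C x"]) (use assms lunit_nat[of "LUnit C x"] in auto)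

text \<open>By \<open>lunit_unit_tens\<close> the left-hand sides of \<open>lunit_tens\<close> and
  of the triangle agree at the unit.\<close>

lemma lunit_unit: "LUnit C (Unit C) = RUnit C (Unit C)"
proof (rule tens_unit_faithful)
  show "LUnit C (Unit C) \<boxdot> Ide C (Unit C) = RUnit C (Unit C) \<boxdot> Ide C (Unit C)"
    using lunit_tens[of "Unit C" "Unit C"] triangle[of "Unit C" "Unit C"] lunit_unit_tens[of "Unit C"]
    by simp
qed auto

text \<open>This composite occurs both as the transposition of the last two factors in
  \<open>adjacent_swap\<close> and in the second summand of the Leibniz rule for the left
  argument.\<close>

definition swap_right :: "'o \<Rightarrow> 'o \<Rightarrow> 'o \<Rightarrow> 'm" where
  "swap_right x y z = inverse_arrow C (Asc C x z y) \<cdot> (Ide C x \<boxdot> Sym C y z) \<cdot> Asc C x y z"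

lemma arr_swap_right [simp]:
  assumes "x \<in> Obj C" "y \<in> Obj C" "z \<in> Obj C"
  shows "swap_right x y z \<in> Arr C" "Dom C (swap_right x y z) = (x \<boxtimes> y) \<boxtimes> z"
    "Cod C (swap_right x y z) = (x \<boxtimes> z) \<boxtimes> y" "is_iso C (swap_right x y z)"
  using assms by (simp_all add: swap_right_def)

lemma swap_right_swap_right [simp]:
  assumes "x \<in> Obj C" "y \<in> Obj C" "z \<in> Obj C"
  shows "swap_right x z y \<cdot> swap_right x y z = Ide C ((x \<boxtimes> y) \<boxtimes> z)"
  using assms by (simp add: swap_right_def)

lemma swap_right_nat:
  assumes "f \<in> Arr C" "g \<in> Arr C" "k \<in> Arr C" "Cod C f = x" "Cod C g = y" "Cod C k = z"
  shows "swap_right x y z \<cdot> ((f \<boxdot> g) \<boxdot> k)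
    = ((f \<boxdot> k) \<boxdot> g) \<cdot> swap_right (Dom C f) (Dom C g) (Dom C k)"
proof (rule iso_cancel_left[of "Asc C x z y"])
  have "Asc C x z y \<cdot> swap_right x y z \<cdot> ((f \<boxdot> g) \<boxdot> k)
      = (Ide C x \<boxdot> Sym C y z) \<cdot> Asc C x y z \<cdot> ((f \<boxdot> g) \<boxdot> k)"
    using assms by (auto simp: swap_right_def)
  also have "\<dots> = (f \<boxdot> k \<boxdot> g) \<cdot> (Ide C (Dom C f) \<boxdot> Sym C (Dom C g) (Dom C k))
      \<cdot> Asc C (Dom C f) (Dom C g) (Dom C k)"
    using assms by (auto simp: asc_nat sym_nat)
  also have "\<dots> = (f \<boxdot> k \<boxdot> g) \<cdot> Asc C (Dom C f) (Dom C k) (Dom C g) \<cdot>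
      swap_right (Dom C f) (Dom C g) (Dom C k)"
    using assms by (auto simp: swap_right_def)
  also have "\<dots> = Asc C x z y \<cdot> ((f \<boxdot> k) \<boxdot> g) \<cdot> swap_right (Dom C f) (Dom C g) (Dom C k)"
    using assms by (subst asc_nat_tail) auto
  finally show "Asc C x z y \<cdot> swap_right x y z \<cdot> ((f \<boxdot> g) \<boxdot> k)
    = Asc C x z y \<cdot> ((f \<boxdot> k) \<boxdot> g) \<cdot> swap_right (Dom C f) (Dom C g) (Dom C k)" .
qed (use assms in auto)

text \<open>The hexagon solved for the symmetry of a product; as the symmetry is its own inverse,
  one hexagon suffices.\<close>

lemma sym_tens_left:
  assumes "x \<in> Obj C" "y \<in> Obj C" "z \<in> Obj C"
  shows "Asc C x y z \<cdot> (Sym C y x \<boxdot> Ide C z) \<cdot> swap_right y z x = Sym C (y \<boxtimes> z) x"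
proof (rule iso_cancel_left[of "Asc C y z x \<cdot> Sym C x (y \<boxtimes> z)"])
  have "(Asc C y z x \<cdot> Sym C x (y \<boxtimes> z)) \<cdot> Asc C x y z \<cdot> (Sym C y x \<boxdot> Ide C z) \<cdot> swap_right y z x
     = (Asc C y z x \<cdot> Sym C x (y \<boxtimes> z) \<cdot> Asc C x y z) \<cdot> (Sym C y x \<boxdot> Ide C z) \<cdot> swap_right y z x"
    using assms by simp
  also have "\<dots> = Asc C y z x"
    using assms unfolding hexagon[OF assms] by (simp add: swap_right_def)
  finally show "(Asc C y z x \<cdot> Sym C x (y \<boxtimes> z)) \<cdot> Asc C x y z \<cdot> (Sym C y x \<boxdot> Ide C z) \<cdot> swap_right y z x
    = (Asc C y z x \<cdot> Sym C x (y \<boxtimes> z)) \<cdot> Sym C (y \<boxtimes> z) x"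
    using assms by simp
qed (use assms in auto)

lemma sym_swap_right:
  assumes "x \<in> Obj C" "y \<in> Obj C" "z \<in> Obj C"
  shows "Sym C (x \<boxtimes> z) y \<cdot> swap_right x y z = Asc C y x z \<cdot> (Sym C x y \<boxdot> Ide C z)"
  using assms by (simp flip: sym_tens_left)

text \<open>Two pentagons, for the factors in the orders \<open>y\<close>, \<open>w\<close>,
  \<open>z\<close> and \<open>y\<close>, \<open>z\<close>, \<open>w\<close> after \<open>x\<close>,
  with the transposition of \<open>z\<close> and \<open>w\<close> between them.\<close>

lemma swap_right_middle:
  assumes "x \<in> Obj C" "y \<in> Obj C" "z \<in> Obj C" "w \<in> Obj C"
  shows "Asc C x (y \<boxtimes> w) z \<cdot> (Asc C x y w \<boxdot> Ide C z) \<cdot> swap_right (x \<boxtimes> y) z w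
    = (Ide C x \<boxdot> swap_right y z w) \<cdot> Asc C x (y \<boxtimes> z) w \<cdot> (Asc C x y z \<boxdot> Ide C w)"
proof (rule iso_cancel_left[of "Ide C x \<boxdot> Asc C y w z"])
  have "(Ide C x \<boxdot> Asc C y w z) \<cdot> Asc C x (y \<boxtimes> w) z \<cdot> (Asc C x y w \<boxdot> Ide C z) \<cdot> swap_right (x \<boxtimes> y) z w
      = ((Ide C x \<boxdot> Asc C y w z) \<cdot> Asc C x (y \<boxtimes> w) z \<cdot> (Asc C x y w \<boxdot> Ide C z)) \<cdot> swap_right (x \<boxtimes> y) z w"
    using assms by simp
  also have "\<dots> = Asc C x y (w \<boxtimes> z) \<cdot> (Ide C (x \<boxtimes> y) \<boxdot> Sym C z w) \<cdot> Asc C (x \<boxtimes> y) z w"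
    using assms by (subst pentagon[symmetric]) (simp_all add: swap_right_def)
  also have "\<dots> = Asc C x y (w \<boxtimes> z) \<cdot> ((Ide C x \<boxdot> Ide C y) \<boxdot> Sym C z w) \<cdot> Asc C (x \<boxtimes> y) z w"
    using assms by simp
  also have "\<dots> = (Ide C x \<boxdot> Ide C y \<boxdot> Sym C z w) \<cdot> Asc C x y (z \<boxtimes> w) \<cdot> Asc C (x \<boxtimes> y) z w"
    using assms by (subst asc_nat_tail) (simp_all del: tens_ide)
  also have "\<dots> = (Ide C x \<boxdot> Ide C y \<boxdot> Sym C z w) \<cdot> (Ide C x \<boxdot> Asc C y z w) \<cdot> Asc C x (y \<boxtimes> z) w \<cdot>
      (Asc C x y z \<boxdot> Ide C w)"
    using assms by (subst pentagon) simp_all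
  also have "\<dots> = (Ide C x \<boxdot> Asc C y w z) \<cdot> (Ide C x \<boxdot> swap_right y z w) \<cdot> Asc C x (y \<boxtimes> z) w \<cdot>
      (Asc C x y z \<boxdot> Ide C w)"
    using assms by (simp add: swap_right_def)
  finally show "(Ide C x \<boxdot> Asc C y w z) \<cdot> Asc C x (y \<boxtimes> w) z \<cdot> (Asc C x y w \<boxdot> Ide C z) \<cdot> swap_right (x \<boxtimes> y) z w
    = (Ide C x \<boxdot> Asc C y w z) \<cdot> (Ide C x \<boxdot> swap_right y z w) \<cdot> Asc C x (y \<boxtimes> z) w \<cdot> (Asc C x y z \<boxdot> Ide C w)" .
qed (use assms in auto)

text \<open>The hexagon in the form \<open>sym_tens_left\<close>, with \<open>x\<close> as a
  spectator: \<open>w\<close> passes \<open>y \<boxtimes> z\<close> either at once or one factor at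
  a time.\<close>

lemma swap_right_left:
  assumes "x \<in> Obj C" "y \<in> Obj C" "z \<in> Obj C" "w \<in> Obj C"
  shows "Asc C (x \<boxtimes> w) y z \<cdot> (swap_right x y w \<boxdot> Ide C z) \<cdot> swap_right (x \<boxtimes> y) z w
    = swap_right x (y \<boxtimes> z) w \<cdot> (Asc C x y z \<boxdot> Ide C w)"
proof (rule iso_cancel_left[of "Asc C x w (y \<boxtimes> z)"])
  let ?x = "Ide C x" and ?z = "Ide C z"
  have "Asc C x w (y \<boxtimes> z) \<cdot> Asc C (x \<boxtimes> w) y z \<cdot> (swap_right x y w \<boxdot> ?z) \<cdot> swap_right (x \<boxtimes> y) z w
      = (Asc C x w (y \<boxtimes> z) \<cdot> Asc C (x \<boxtimes> w) y z) \<cdot> (swap_right x y w \<boxdot> ?z) \<cdot> swap_right (x \<boxtimes> y) z w"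
    using assms by simp
  also have "\<dots> = (?x \<boxdot> Asc C w y z) \<cdot> Asc C x (w \<boxtimes> y) z \<cdot> (Asc C x w y \<boxdot> ?z) \<cdot> (swap_right x y w \<boxdot> ?z) \<cdot>
      swap_right (x \<boxtimes> y) z w"
    using assms by (subst pentagon) simp_all
  also have "\<dots> = (?x \<boxdot> Asc C w y z) \<cdot> Asc C x (w \<boxtimes> y) z \<cdot> ((?x \<boxdot> Sym C y w) \<boxdot> ?z) \<cdot> (Asc C x y w \<boxdot> ?z) \<cdot>
      swap_right (x \<boxtimes> y) z w"
    using assms by (simp add: swap_right_def)
  also have "\<dots> = (?x \<boxdot> Asc C w y z) \<cdot> (?x \<boxdot> Sym C y w \<boxdot> ?z) \<cdot> Asc C x (y \<boxtimes> w) z \<cdot> (Asc C x y w \<boxdot> ?z) \<cdot>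
      swap_right (x \<boxtimes> y) z w"
    using assms by (subst asc_nat_tail) simp_all
  also have "\<dots> = (?x \<boxdot> Asc C w y z) \<cdot> (?x \<boxdot> Sym C y w \<boxdot> ?z) \<cdot> (?x \<boxdot> swap_right y z w) \<cdot>
      Asc C x (y \<boxtimes> z) w \<cdot> (Asc C x y z \<boxdot> Ide C w)"
    using assms by (simp only: swap_right_middle)
  also have "\<dots> = (?x \<boxdot> (Asc C w y z \<cdot> (Sym C y w \<boxdot> ?z) \<cdot> swap_right y z w)) \<cdot> Asc C x (y \<boxtimes> z) w \<cdot>
      (Asc C x y z \<boxdot> Ide C w)"
    using assms by simp
  also have "\<dots> = Asc C x w (y \<boxtimes> z) \<cdot> swap_right x (y \<boxtimes> z) w \<cdot> (Asc C x y z \<boxdot> Ide C w)"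
    using assms by (simp only: sym_tens_left) (simp add: swap_right_def)
  finally show "Asc C x w (y \<boxtimes> z) \<cdot> Asc C (x \<boxtimes> w) y z \<cdot> (swap_right x y w \<boxdot> ?z) \<cdot> swap_right (x \<boxtimes> y) z w
    = Asc C x w (y \<boxtimes> z) \<cdot> swap_right x (y \<boxtimes> z) w \<cdot> (Asc C x y z \<boxdot> Ide C w)" .
qed (use assms in auto)

end

section \<open>Generalised elements\<close>

text \<open>\<open>X i\<close> is the type of the variable \<open>i\<close>. It stays a parameter
  because each calculation chooses the types of its own variables.\<close>

locale stages = symmetric_monoidal_category C
  for C :: "('o, 'm, 'z) smcat_scheme" (structure) +
  fixes X :: "nat \<Rightarrow> 'o"
  assumes X_obj [simp]: "X i \<in> Obj C"
begin

text \<open>The product over a set of variables is taken in their natural order. So elements that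
  mention the same variables in different orders have the same domain and can be compared or
  added.\<close>

primrec stage_upto :: "nat \<Rightarrow> nat set \<Rightarrow> 'o" where
  "stage_upto 0 A = Unit C"
| "stage_upto (Suc n) A = (if n \<in> A then stage_upto n A \<boxtimes> X n else stage_upto n A)"

text \<open>The unshuffle \<open>stage_upto n (A \<union> B) -> stage_upto n A \<boxtimes>
  stage_upto n B\<close> for disjoint \<open>A\<close> and \<open>B\<close>. The last variable has
  to pass all of \<open>B\<close> if it belongs to \<open>A\<close>, and only needs rebracketing if
  it belongs to \<open>B\<close>.\<close>

primrec split_upto :: "nat \<Rightarrow> nat set \<Rightarrow> nat set \<Rightarrow> 'm" where
  "split_upto 0 A B = inverse_arrow C (LUnit C (Unit C))"
| "split_upto (Suc n) A B =
     (if n \<in> A then swap_right (stage_upto n A) (stage_upto n B) (X n) \<cdot> (split_upto n A B \<boxdot> Ide C (X n))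
      else if n \<in> B then Asc C (stage_upto n A) (stage_upto n B) (X n) \<cdot> (split_upto n A B \<boxdot> Ide C (X n))
      else split_upto n A B)"

lemma stage_upto_obj [simp]: "stage_upto n A \<in> Obj C"
  by (induction n) auto

lemma arr_split_upto [simp]:
  assumes "A \<inter> B = {}"
  shows "split_upto n A B \<in> Arr C" "Dom C (split_upto n A B) = stage_upto n (A \<union> B)"
    "Cod C (split_upto n A B) = stage_upto n A \<boxtimes> stage_upto n B" "is_iso C (split_upto n A B)"
  using assms by (induction n) (auto simp: disjoint_iff)

lemma sym_split_upto:
  assumes "A \<inter> B = {}"
  shows "Sym C (stage_upto n A) (stage_upto n B) \<cdot> split_upto n A B = split_upto n B A"
proof (induction n)
  case 0
  \<comment> \<open>At the unit, composing \<open>Sym\<close> with \<open>LUnit\<close> gives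
    \<open>RUnit\<close>, which is \<open>LUnit\<close> again.\<close>
  have "Sym C (Unit C) (Unit C) = Ide C (Unit C \<boxtimes> Unit C)"
    by (rule iso_cancel_left[of "LUnit C (Unit C)"])
      (use lunit_sym[of "Unit C"] in \<open>auto simp: lunit_unit\<close>)
  then show ?case
    by simp
next
  case (Suc n)
  have dj: "A \<inter> B = {}" "B \<inter> A = {}" and un: "B \<union> A = A \<union> B"
    using assms by auto
  let ?a = "stage_upto n A" and ?b = "stage_upto n B" and ?x = "X n" and ?s = "split_upto n A B"
  consider "n \<in> A" "n \<notin> B" | "n \<notin> A" "n \<in> B" | "n \<notin> A" "n \<notin> B"
    using assms by auto
  then show ?case
  proof cases
    case 1
    have "Sym C (?a \<boxtimes> ?x) ?b \<cdot> swap_right ?a ?b ?x \<cdot> (?s \<boxdot> Ide C ?x)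
        = Asc C ?b ?a ?x \<cdot> (Sym C ?a ?b \<boxdot> Ide C ?x) \<cdot> (?s \<boxdot> Ide C ?x)"
      by (rule comp_tail[OF sym_swap_right, THEN trans]) (use dj in auto)
    then show ?thesis
      using 1 dj Suc by simp
  next
    case 2
    have "swap_right ?b ?a ?x \<cdot> (split_upto n B A \<boxdot> Ide C ?x)
        = swap_right ?b ?a ?x \<cdot> (Sym C ?a ?b \<boxdot> Ide C ?x) \<cdot> (?s \<boxdot> Ide C ?x)"
      using dj by (simp add: Suc)
    also have "\<dots> = Sym C ?a (?b \<boxtimes> ?x) \<cdot> Asc C ?a ?b ?x \<cdot> (?s \<boxdot> Ide C ?x)"
    proof (rule comp_tail)
      show "swap_right ?b ?a ?x \<cdot> (Sym C ?a ?b \<boxdot> Ide C ?x) = Sym C ?a (?b \<boxtimes> ?x) \<cdot> Asc C ?a ?b ?x"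
      proof (rule iso_cancel_left[of "Sym C (?b \<boxtimes> ?x) ?a"])
        have "Sym C (?b \<boxtimes> ?x) ?a \<cdot> swap_right ?b ?a ?x \<cdot> (Sym C ?a ?b \<boxdot> Ide C ?x)
            = Asc C ?a ?b ?x \<cdot> (Sym C ?b ?a \<boxdot> Ide C ?x) \<cdot> (Sym C ?a ?b \<boxdot> Ide C ?x)"
          by (rule comp_tail[OF sym_swap_right, THEN trans]) auto
        then show "Sym C (?b \<boxtimes> ?x) ?a \<cdot> swap_right ?b ?a ?x \<cdot> (Sym C ?a ?b \<boxdot> Ide C ?x)
            = Sym C (?b \<boxtimes> ?x) ?a \<cdot> Sym C ?a (?b \<boxtimes> ?x) \<cdot> Asc C ?a ?b ?x"
          by simp
      qed auto
    qed (use dj in auto)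
    finally show ?thesis
      using 2 by simp
  next
    case 3
    then show ?thesis
      using Suc by simp
  qed
qed

text \<open>Coassociativity of unshuffling. Depending on whether the last variable lies in
  \<open>A\<close>, \<open>B\<close> or \<open>D\<close>, the induction step is
  \<open>swap_right_left\<close>, \<open>swap_right_middle\<close> or the pentagon. Together with
  \<open>sym_split_upto\<close> and \<open>lunit_split_upto\<close> this carries all the coherence
  that the rules for \<open>Asc\<close>, \<open>Sym\<close> and the unitors on pairs rely
  on.\<close>

lemma asc_split_upto:
  assumes "A \<inter> B = {}" "A \<inter> D = {}" "B \<inter> D = {}"
  shows "Asc C (stage_upto n A) (stage_upto n B) (stage_upto n D) \<cdot>
      (split_upto n A B \<boxdot> Ide C (stage_upto n D)) \<cdot> split_upto n (A \<union> B) D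
    = (Ide C (stage_upto n A) \<boxdot> split_upto n B D) \<cdot> split_upto n A (B \<union> D)"
proof (induction n)
  case 0
  let ?I = "Unit C" and ?i = "Ide C (Unit C)" and ?l = "inverse_arrow C (LUnit C (Unit C))"
  have "Asc C ?I ?I ?I \<cdot> (?l \<boxdot> ?i) = ?i \<boxdot> ?l"
  proof (rule iso_cancel_left[of "?i \<boxdot> LUnit C ?I"])
    have "(?i \<boxdot> LUnit C ?I) \<cdot> Asc C ?I ?I ?I \<cdot> (?l \<boxdot> ?i) = ((?i \<boxdot> LUnit C ?I) \<cdot> Asc C ?I ?I ?I) \<cdot> (?l \<boxdot> ?i)"
      by simp
    also have "\<dots> = (?i \<boxdot> LUnit C ?I) \<cdot> (?i \<boxdot> ?l)"
      by (subst triangle) (simp_all flip: lunit_unit)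
    finally show "(?i \<boxdot> LUnit C ?I) \<cdot> Asc C ?I ?I ?I \<cdot> (?l \<boxdot> ?i) = (?i \<boxdot> LUnit C ?I) \<cdot> (?i \<boxdot> ?l)" .
  qed auto
  from arg_cong[OF this, of "\<lambda>k. k \<cdot> ?l"] show ?case
    by simp
next
  case (Suc n)
  have dj: "A \<inter> B = {}" "A \<inter> D = {}" "B \<inter> D = {}" "(A \<union> B) \<inter> D = {}" "A \<inter> (B \<union> D) = {}"
    "A \<union> (B \<union> D) = (A \<union> B) \<union> D"
    using assms by auto
  let ?a = "stage_upto n A" and ?b = "stage_upto n B" and ?d = "stage_upto n D"
  let ?ab = "stage_upto n (A \<union> B)" and ?bd = "stage_upto n (B \<union> D)"
  let ?x = "X n" and ?i = "Ide C (X n)"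
  consider "n \<in> A" "n \<notin> B" "n \<notin> D" | "n \<notin> A" "n \<in> B" "n \<notin> D" | "n \<notin> A" "n \<notin> B" "n \<in> D"
    | "n \<notin> A" "n \<notin> B" "n \<notin> D"
    using assms by auto
  then show ?case
  proof cases
    case 1
    have "Asc C (?a \<boxtimes> ?x) ?b ?d \<cdot> ((swap_right ?a ?b ?x \<cdot> (split_upto n A B \<boxdot> ?i)) \<boxdot> Ide C ?d) \<cdot>
        swap_right ?ab ?d ?x \<cdot> (split_upto n (A \<union> B) D \<boxdot> ?i)
      = Asc C (?a \<boxtimes> ?x) ?b ?d \<cdot> (swap_right ?a ?b ?x \<boxdot> Ide C ?d) \<cdot>
        (((split_upto n A B \<boxdot> ?i) \<boxdot> Ide C ?d) \<cdot>
        swap_right ?ab ?d ?x) \<cdot> (split_upto n (A \<union> B) D \<boxdot> ?i)"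
      using dj by simp
    also have "\<dots> = Asc C (?a \<boxtimes> ?x) ?b ?d \<cdot> (swap_right ?a ?b ?x \<boxdot> Ide C ?d) \<cdot>
        (swap_right (?a \<boxtimes> ?b) ?d ?x \<cdot> ((split_upto n A B \<boxdot> Ide C ?d) \<boxdot> ?i)) \<cdot> (split_upto n (A \<union> B) D \<boxdot> ?i)"
      using dj by (subst swap_right_nat) simp_all
    also have "\<dots> = (Asc C (?a \<boxtimes> ?x) ?b ?d \<cdot> (swap_right ?a ?b ?x \<boxdot> Ide C ?d) \<cdot>
        swap_right (?a \<boxtimes> ?b) ?d ?x) \<cdot> ((split_upto n A B \<boxdot> Ide C ?d) \<boxdot> ?i) \<cdot> (split_upto n (A \<union> B) D \<boxdot> ?i)"
      using dj by simp
    also have "\<dots> = swap_right ?a (?b \<boxtimes> ?d) ?x \<cdot>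
        ((Asc C ?a ?b ?d \<cdot> (split_upto n A B \<boxdot> Ide C ?d) \<cdot> split_upto n (A \<union> B) D) \<boxdot> ?i)"
      using dj by (subst swap_right_left) simp_all
    also have "\<dots> = (swap_right ?a (?b \<boxtimes> ?d) ?x \<cdot> ((Ide C ?a \<boxdot> split_upto n B D) \<boxdot> ?i)) \<cdot>
        (split_upto n A (B \<union> D) \<boxdot> ?i)"
      using dj by (simp add: Suc)
    also have "\<dots> = ((Ide C ?a \<boxdot> ?i) \<boxdot> split_upto n B D) \<cdot> swap_right ?a ?bd ?x \<cdot>
        (split_upto n A (B \<union> D) \<boxdot> ?i)"
      using dj by (subst swap_right_nat) simp_all
    finally show ?thesis
      using 1 by simp
  next
    case 2
    have "Asc C ?a (?b \<boxtimes> ?x) ?d \<cdot> ((Asc C ?a ?b ?x \<cdot> (split_upto n A B \<boxdot> ?i)) \<boxdot> Ide C ?d) \<cdot>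
        swap_right ?ab ?d ?x \<cdot> (split_upto n (A \<union> B) D \<boxdot> ?i)
      = Asc C ?a (?b \<boxtimes> ?x) ?d \<cdot> (Asc C ?a ?b ?x \<boxdot> Ide C ?d) \<cdot>
        (((split_upto n A B \<boxdot> ?i) \<boxdot> Ide C ?d) \<cdot>
        swap_right ?ab ?d ?x) \<cdot> (split_upto n (A \<union> B) D \<boxdot> ?i)"
      using dj by simp
    also have "\<dots> = Asc C ?a (?b \<boxtimes> ?x) ?d \<cdot> (Asc C ?a ?b ?x \<boxdot> Ide C ?d) \<cdot>
        (swap_right (?a \<boxtimes> ?b) ?d ?x \<cdot> ((split_upto n A B \<boxdot> Ide C ?d) \<boxdot> ?i)) \<cdot> (split_upto n (A \<union> B) D \<boxdot> ?i)"
      using dj by (subst swap_right_nat) simp_all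
    also have "\<dots> = (Asc C ?a (?b \<boxtimes> ?x) ?d \<cdot> (Asc C ?a ?b ?x \<boxdot> Ide C ?d) \<cdot>
        swap_right (?a \<boxtimes> ?b) ?d ?x) \<cdot> ((split_upto n A B \<boxdot> Ide C ?d) \<boxdot> ?i) \<cdot> (split_upto n (A \<union> B) D \<boxdot> ?i)"
      using dj by simp
    also have "\<dots> = (Ide C ?a \<boxdot> swap_right ?b ?d ?x) \<cdot> Asc C ?a (?b \<boxtimes> ?d) ?x \<cdot>
        ((Asc C ?a ?b ?d \<cdot> (split_upto n A B \<boxdot> Ide C ?d) \<cdot> split_upto n (A \<union> B) D) \<boxdot> ?i)"
      using dj by (subst swap_right_middle) simp_all
    also have "\<dots> = (Ide C ?a \<boxdot> swap_right ?b ?d ?x) \<cdot> Asc C ?a (?b \<boxtimes> ?d) ?x \<cdot>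
        ((Ide C ?a \<boxdot> split_upto n B D) \<boxdot> ?i) \<cdot> (split_upto n A (B \<union> D) \<boxdot> ?i)"
      using dj by (simp add: Suc)
    also have "\<dots> = (Ide C ?a \<boxdot> swap_right ?b ?d ?x) \<cdot> (Ide C ?a \<boxdot> split_upto n B D \<boxdot> ?i) \<cdot>
        Asc C ?a ?bd ?x \<cdot> (split_upto n A (B \<union> D) \<boxdot> ?i)"
      using dj by (subst asc_nat_tail) simp_all
    finally show ?thesis
      using 2 dj by simp
  next
    case 3
    have "Asc C ?a ?b (?d \<boxtimes> ?x) \<cdot> (split_upto n A B \<boxdot> Ide C (?d \<boxtimes> ?x)) \<cdot>
        Asc C ?ab ?d ?x \<cdot> (split_upto n (A \<union> B) D \<boxdot> ?i)
      = Asc C ?a ?b (?d \<boxtimes> ?x) \<cdot> ((split_upto n A B \<boxdot> Ide C ?d \<boxdot> ?i) \<cdot>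
        Asc C ?ab ?d ?x) \<cdot> (split_upto n (A \<union> B) D \<boxdot> ?i)"
      using dj by simp
    also have "\<dots> = Asc C ?a ?b (?d \<boxtimes> ?x) \<cdot> (Asc C (?a \<boxtimes> ?b) ?d ?x \<cdot>
        ((split_upto n A B \<boxdot> Ide C ?d) \<boxdot> ?i)) \<cdot> (split_upto n (A \<union> B) D \<boxdot> ?i)"
      using dj by (subst asc_nat) simp_all
    also have "\<dots> = (Asc C ?a ?b (?d \<boxtimes> ?x) \<cdot> Asc C (?a \<boxtimes> ?b) ?d ?x) \<cdot>
        ((split_upto n A B \<boxdot> Ide C ?d) \<boxdot> ?i) \<cdot> (split_upto n (A \<union> B) D \<boxdot> ?i)"
      using dj by simp
    also have "\<dots> = (Ide C ?a \<boxdot> Asc C ?b ?d ?x) \<cdot> Asc C ?a (?b \<boxtimes> ?d) ?x \<cdot>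
        ((Asc C ?a ?b ?d \<cdot> (split_upto n A B \<boxdot> Ide C ?d) \<cdot> split_upto n (A \<union> B) D) \<boxdot> ?i)"
      using dj by (subst pentagon) simp_all
    also have "\<dots> = (Ide C ?a \<boxdot> Asc C ?b ?d ?x) \<cdot> Asc C ?a (?b \<boxtimes> ?d) ?x \<cdot>
        ((Ide C ?a \<boxdot> split_upto n B D) \<boxdot> ?i) \<cdot> (split_upto n A (B \<union> D) \<boxdot> ?i)"
      using dj by (simp add: Suc)
    also have "\<dots> = (Ide C ?a \<boxdot> Asc C ?b ?d ?x) \<cdot> (Ide C ?a \<boxdot> split_upto n B D \<boxdot> ?i) \<cdot>
        Asc C ?a ?bd ?x \<cdot> (split_upto n A (B \<union> D) \<boxdot> ?i)"
      using dj by (subst asc_nat_tail) simp_all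
    finally show ?thesis
      using 3 dj by simp
  next
    case 4
    then show ?thesis
      using Suc by simp
  qed
qed

lemma stage_upto_empty [simp]: "stage_upto n {} = Unit C"
  by (induction n) auto

lemma lunit_split_upto: "LUnit C (stage_upto n B) \<cdot> split_upto n {} B = Ide C (stage_upto n B)"
proof (induction n)
  case (Suc n)
  have "LUnit C (stage_upto n B \<boxtimes> X n) \<cdot> Asc C (Unit C) (stage_upto n B) (X n) \<cdot>
      (split_upto n {} B \<boxdot> Ide C (X n))
    = (LUnit C (stage_upto n B \<boxtimes> X n) \<cdot> Asc C (Unit C) (stage_upto n B) (X n)) \<cdot>
        (split_upto n {} B \<boxdot> Ide C (X n))"
    by simp
  also have "\<dots> = Ide C (stage_upto n B \<boxtimes> X n)"
    by (subst lunit_tens) (simp_all add: Suc)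
  finally show ?case
    using Suc by simp
qed simp

text \<open>No identity below involves more than four variables.\<close>

abbreviation stage :: "nat set \<Rightarrow> 'o" where "stage \<equiv> stage_upto 4"
abbreviation split :: "nat set \<Rightarrow> nat set \<Rightarrow> 'm" where "split \<equiv> split_upto 4"

text \<open>An element records its set of variables because the domain of an arrow does not
  determine it: different sets can have the same stage.\<close>

definition elm :: "nat set \<times> 'm \<Rightarrow> bool" where
  "elm a \<longleftrightarrow> snd a \<in> Arr C \<and> Dom C (snd a) = stage (fst a)"

definition ety :: "nat set \<times> 'm \<Rightarrow> 'o" where
  "ety a = Cod C (snd a)"

definition app :: "'m \<Rightarrow> nat set \<times> 'm \<Rightarrow> nat set \<times> 'm"  (infixr \<open>\<star>\<close> 75) where
  "f \<star> a = (fst a, f \<cdot> snd a)"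

definition pair :: "nat set \<times> 'm \<Rightarrow> nat set \<times> 'm \<Rightarrow> nat set \<times> 'm"  (\<open>\<langle>_,/ _\<rangle>\<close>) where
  "\<langle>a, b\<rangle> = (fst a \<union> fst b, (snd a \<boxdot> snd b) \<cdot> split (fst a) (fst b))"

definition dj :: "nat set \<times> 'm \<Rightarrow> nat set \<times> 'm \<Rightarrow> bool" where
  "dj a b \<longleftrightarrow> fst a \<inter> fst b = {}"

definition star :: "nat set \<times> 'm" where
  "star = ({}, Ide C (Unit C))"

text \<open>For \<open>i < 4\<close> the stage of a single variable is
  \<open>Unit C \<boxtimes> X i\<close>, hence a unitor in place of an identity.\<close>

definition var :: "nat \<Rightarrow> nat set \<times> 'm" where
  "var i = ({i}, LUnit C (X i))"

lemma fst_app [simp]: "fst (f \<star> a) = fst a"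
  by (simp add: app_def)

lemma fst_pair [simp]: "fst \<langle>a, b\<rangle> = fst a \<union> fst b"
  by (simp add: pair_def)

lemma fst_star [simp]: "fst star = {}"
  by (simp add: star_def)

lemma dj_simps [simp]:
  "dj (f \<star> a) b = dj a b" "dj b (f \<star> a) = dj b a"
  "dj \<langle>a, c\<rangle> b \<longleftrightarrow> dj a b \<and> dj c b" "dj b \<langle>a, c\<rangle> \<longleftrightarrow> dj b a \<and> dj b c"
  "dj star b" "dj b star"
  by (auto simp: dj_def)

lemma ety_obj [simp]: "elm a \<Longrightarrow> ety a \<in> Obj C"
  by (auto simp: elm_def ety_def)

lemma elm_app [simp]:
  assumes "elm a" "f \<in> Arr C" "Dom C f = ety a"
  shows "elm (f \<star> a)" "ety (f \<star> a) = Cod C f"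
  using assms by (auto simp: elm_def ety_def app_def)

lemma elm_pair [simp]:
  assumes "elm a" "elm b" "dj a b"
  shows "elm \<langle>a, b\<rangle>" "ety \<langle>a, b\<rangle> = ety a \<boxtimes> ety b"
  using assms by (auto simp: elm_def ety_def pair_def dj_def)

lemma elm_star [simp]: "elm star" "ety star = Unit C"
  by (auto simp: elm_def ety_def star_def)

lemma stage_upto_singleton: "stage_upto n {i} = (if i < n then Unit C \<boxtimes> X i else Unit C)"
proof -
  have "n \<le> i \<Longrightarrow> stage_upto n {i} = Unit C" for n
    by (induction n) auto
  then show ?thesis
    by (induction n) (auto simp: less_Suc_eq)
qed

lemma elm_var [simp]:
  assumes "i < 4"
  shows "elm (var i)" "ety (var i) = X i" "is_iso C (snd (var i))"
  using assms by (auto simp: elm_def ety_def var_def stage_upto_singleton)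

lemma dj_var [simp]: "dj (var i) (var j) \<longleftrightarrow> i \<noteq> j"
  by (auto simp: dj_def var_def)

lemma iso_pair [simp]:
  assumes "elm a" "elm b" "dj a b" "is_iso C (snd a)" "is_iso C (snd b)"
  shows "is_iso C (snd \<langle>a, b\<rangle>)"
  using assms by (auto simp: elm_def pair_def dj_def)

text \<open>The Yoneda principle: an invertible element is generic, so arrows may be compared on it.
  Tuples of distinct variables are generic in any order and bracketing by \<open>iso_pair\<close>,
  so the tuple can be chosen to fit the domain of the arrows.\<close>

lemma elm_ext:
  assumes "is_iso C (snd a)" "elm a" "f \<in> Arr C" "g \<in> Arr C" "Dom C f = ety a" "Dom C g = ety a"
    "f \<star> a = g \<star> a"
  shows "f = g"
  by (rule iso_cancel_right[of "snd a"]) (use assms in \<open>auto simp: elm_def ety_def app_def\<close>)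

lemma app_comp [simp]:
  assumes "elm a" "f \<in> Arr C" "g \<in> Arr C" "Dom C f = ety a" "Dom C g = Cod C f"
  shows "(g \<cdot> f) \<star> a = g \<star> f \<star> a"
  using assms by (simp add: app_def elm_def ety_def)

lemma app_ide [simp]: "elm a \<Longrightarrow> ety a = x \<Longrightarrow> Ide C x \<star> a = a"
  by (auto simp: app_def elm_def ety_def prod_eq_iff)

lemma app_tens [simp]:
  assumes "elm a" "elm b" "dj a b" "f \<in> Arr C" "g \<in> Arr C" "Dom C f = ety a" "Dom C g = ety b"
  shows "(f \<boxdot> g) \<star> \<langle>a, b\<rangle> = \<langle>f \<star> a, g \<star> b\<rangle>"
  using assms by (simp add: app_def pair_def elm_def ety_def dj_def)

lemma app_sym [simp]:
  assumes "elm a" "elm b" "dj a b" "ety a = x" "ety b = y"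
  shows "Sym C x y \<star> \<langle>a, b\<rangle> = \<langle>b, a\<rangle>"
proof -
  have "Sym C x y \<cdot> (snd a \<boxdot> snd b) \<cdot> split (fst a) (fst b)
      = (snd b \<boxdot> snd a) \<cdot> Sym C (stage (fst a)) (stage (fst b)) \<cdot> split (fst a) (fst b)"
    using assms by (subst sym_nat_tail) (auto simp: elm_def ety_def dj_def)
  also have "\<dots> = (snd b \<boxdot> snd a) \<cdot> split (fst b) (fst a)"
    using assms by (subst sym_split_upto) (auto simp: dj_def)
  finally show ?thesis
    by (auto simp: app_def pair_def)
qed

lemma app_asc [simp]:
  assumes "elm a" "elm b" "elm c" "dj a b" "dj a c" "dj b c" "ety a = x" "ety b = y" "ety c = z"
  shows "Asc C x y z \<star> \<langle>\<langle>a, b\<rangle>, c\<rangle> = \<langle>a, \<langle>b, c\<rangle>\<rangle>"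
proof -
  let ?A = "fst a" and ?B = "fst b" and ?D = "fst c"
  have dj: "?A \<inter> ?B = {}" "?A \<inter> ?D = {}" "?B \<inter> ?D = {}" "(?A \<union> ?B) \<inter> ?D = {}" "?A \<inter> (?B \<union> ?D) = {}"
    "?A \<union> (?B \<union> ?D) = (?A \<union> ?B) \<union> ?D"
    using assms by (auto simp: dj_def)
  have arr: "snd a \<in> Arr C" "snd b \<in> Arr C" "snd c \<in> Arr C"
    "Dom C (snd a) = stage ?A" "Dom C (snd b) = stage ?B" "Dom C (snd c) = stage ?D"
    "Cod C (snd a) = x" "Cod C (snd b) = y" "Cod C (snd c) = z"
    using assms by (auto simp: elm_def ety_def)
  have "Asc C x y z \<cdot> (((snd a \<boxdot> snd b) \<cdot> split ?A ?B) \<boxdot> snd c) \<cdot> split (?A \<union> ?B) ?D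
      = Asc C x y z \<cdot> ((snd a \<boxdot> snd b) \<boxdot> snd c) \<cdot> (split ?A ?B \<boxdot> Ide C (stage ?D)) \<cdot> split (?A \<union> ?B) ?D"
    using arr dj by simp
  also have "\<dots> = (snd a \<boxdot> snd b \<boxdot> snd c) \<cdot> Asc C (stage ?A) (stage ?B) (stage ?D) \<cdot>
      (split ?A ?B \<boxdot> Ide C (stage ?D)) \<cdot> split (?A \<union> ?B) ?D"
    using arr dj by (subst asc_nat_tail) simp_all
  also have "\<dots> = (snd a \<boxdot> snd b \<boxdot> snd c) \<cdot> (Ide C (stage ?A) \<boxdot> split ?B ?D) \<cdot> split ?A (?B \<union> ?D)"
    by (simp only: asc_split_upto dj)
  also have "\<dots> = (snd a \<boxdot> ((snd b \<boxdot> snd c) \<cdot> split ?B ?D)) \<cdot> split ?A (?B \<union> ?D)"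
    using arr dj by simp
  finally show ?thesis
    using dj by (simp add: app_def pair_def)
qed

lemma app_inverse:
  assumes "is_iso C f" "f \<star> a = b" "elm a" "ety a = Dom C f"
  shows "inverse_arrow C f \<star> b = a"
  using assms is_iso_arr[of f] by (auto simp flip: app_comp)

lemma app_inverse_asc [simp]:
  assumes "elm a" "elm b" "elm c" "dj a b" "dj a c" "dj b c" "ety a = x" "ety b = y" "ety c = z"
  shows "inverse_arrow C (Asc C x y z) \<star> \<langle>a, \<langle>b, c\<rangle>\<rangle> = \<langle>\<langle>a, b\<rangle>, c\<rangle>"
  by (rule app_inverse[OF _ app_asc]) (use assms in auto)

lemma app_lunit [simp]:
  assumes "elm a" "ety a = x"
  shows "LUnit C x \<star> \<langle>star, a\<rangle> = a"
proof -
  have "LUnit C x \<cdot> (Ide C (Unit C) \<boxdot> snd a) \<cdot> split {} (fst a)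
      = (LUnit C x \<cdot> (Ide C (Unit C) \<boxdot> snd a)) \<cdot> split {} (fst a)"
    using assms by (auto simp: elm_def ety_def)
  also have "\<dots> = snd a \<cdot> LUnit C (stage (fst a)) \<cdot> split {} (fst a)"
    using assms by (subst lunit_nat) (auto simp: elm_def ety_def)
  also have "\<dots> = snd a"
    using assms by (simp add: lunit_split_upto elm_def)
  finally show ?thesis
    by (simp add: app_def pair_def star_def prod_eq_iff)
qed

lemma app_inverse_lunit [simp]:
  assumes "elm a" "ety a = x"
  shows "inverse_arrow C (LUnit C x) \<star> a = \<langle>star, a\<rangle>"
  by (rule app_inverse[OF _ app_lunit]) (use assms in auto)

lemma app_swap_right [simp]:
  assumes "elm a" "elm b" "elm c" "dj a b" "dj a c" "dj b c" "dj c b" "ety a = x" "ety b = y" "ety c = z"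
  shows "swap_right x y z \<star> \<langle>\<langle>a, b\<rangle>, c\<rangle> = \<langle>\<langle>a, c\<rangle>, b\<rangle>"
  using assms by (auto simp: swap_right_def)

text \<open>Here \<open>s\<close> is an element of the unit object, possibly with variables, such as
  a value of an evaluation. The rules below move such scalars out of applications and pairs, where
  they can be compared.\<close>

definition scale :: "nat set \<times> 'm \<Rightarrow> nat set \<times> 'm \<Rightarrow> nat set \<times> 'm"  (infixr \<open>\<bullet>\<close> 75) where
  "s \<bullet> a = LUnit C (ety a) \<star> \<langle>s, a\<rangle>"

lemma dj_scale [simp]:
  "dj (s \<bullet> a) b \<longleftrightarrow> dj s b \<and> dj a b" "dj b (s \<bullet> a) \<longleftrightarrow> dj b s \<and> dj b a"
  by (simp_all add: scale_def)

lemma elm_scale [simp]: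
  assumes "elm s" "elm a" "dj s a" "ety s = Unit C"
  shows "elm (s \<bullet> a)" "ety (s \<bullet> a) = ety a"
  using assms by (auto simp: scale_def)

lemma app_lunit_scale:
  assumes "elm s" "elm a" "dj s a" "ety s = Unit C" "ety a = x"
  shows "LUnit C x \<star> \<langle>s, a\<rangle> = s \<bullet> a"
  using assms by (simp add: scale_def)

lemma app_runit [simp]:
  assumes "elm s" "elm a" "dj a s" "ety s = Unit C" "ety a = x"
  shows "RUnit C x \<star> \<langle>a, s\<rangle> = s \<bullet> a"
  using assms ety_obj[of a] by (simp add: scale_def del: ety_obj flip: lunit_sym)

lemma scale_app:
  assumes "elm s" "elm a" "dj s a" "ety s = Unit C" "f \<in> Arr C" "Dom C f = ety a"
  shows "f \<star> s \<bullet> a = s \<bullet> f \<star> a"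
proof -
  have "s \<bullet> f \<star> a = (LUnit C (Cod C f) \<cdot> (Ide C (Unit C) \<boxdot> f)) \<star> \<langle>s, a\<rangle>"
    using assms by (simp add: scale_def)
  also have "\<dots> = f \<star> s \<bullet> a"
    using assms by (subst lunit_nat) (simp_all add: scale_def)
  finally show ?thesis ..
qed

lemma scale_pair_left:
  assumes "elm s" "elm a" "elm b" "dj s a" "dj s b" "dj a b" "ety s = Unit C"
  shows "\<langle>s \<bullet> a, b\<rangle> = s \<bullet> \<langle>a, b\<rangle>"
proof -
  have "\<langle>s \<bullet> a, b\<rangle> = (LUnit C (ety a) \<boxdot> Ide C (ety b)) \<star> \<langle>\<langle>s, a\<rangle>, b\<rangle>"
    using assms by (simp add: scale_def)
  also have "\<dots> = LUnit C (ety a \<boxtimes> ety b) \<star> Asc C (Unit C) (ety a) (ety b) \<star> \<langle>\<langle>s, a\<rangle>, b\<rangle>"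
    using assms by (simp flip: lunit_tens del: app_asc)
  finally show ?thesis
    using assms by (simp add: scale_def)
qed

text \<open>The two unitors of the unit object coincide, so the left action of \<open>s\<close> on
  \<open>t\<close> is also the right action.\<close>

lemma scale_commute:
  assumes "elm s" "elm t" "dj s t" "dj t s" "ety s = Unit C" "ety t = Unit C"
  shows "s \<bullet> t = t \<bullet> s"
  using assms app_runit[of t s "Unit C"] by (simp add: scale_def flip: lunit_unit)

end

text \<open>Four generic variables, of which a calculation may ignore some. Disjointness is listed
  in both orders since the simplifier does not turn \<open>dj\<close> around.\<close>

definition (in stages) variables where
  "variables a b c d x y z w \<longleftrightarrow>
     elm a \<and> elm b \<and> elm c \<and> elm d \<and>
     ety a = x \<and> ety b = y \<and> ety c = z \<and> ety d = w \<and>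
     is_iso C (snd a) \<and> is_iso C (snd b) \<and> is_iso C (snd c) \<and> is_iso C (snd d) \<and>
     dj a b \<and> dj a c \<and> dj a d \<and> dj b a \<and> dj b c \<and> dj b d \<and>
     dj c a \<and> dj c b \<and> dj c d \<and> dj d a \<and> dj d b \<and> dj d c"

lemma (in symmetric_monoidal_category) obtain_variables:
  assumes "x \<in> Obj C" "y \<in> Obj C" "z \<in> Obj C" "w \<in> Obj C"
  obtains X a b c d where "stages C X" "stages.variables C X a b c d x y z w"
proof -
  define X where "X = (\<lambda>i::nat. if i = 0 then x else if i = 1 then y else if i = 2 then z else w)"
  interpret stages C X
    by unfold_locales (use assms in \<open>auto simp: X_def\<close>)
  have "variables (var 0) (var 1) (var 2) (var 3) x y z w"
    by (simp add: variables_def, simp add: X_def)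
  then show thesis
    by (rule that[OF stages_axioms])
qed

section \<open>Colimits and tensor products\<close>

lemma ex1_eqI: "\<exists>!x. P x \<Longrightarrow> P a \<Longrightarrow> P b \<Longrightarrow> a = b"
  by blast

section \<open>Addition of arrows\<close>

context linear_symmetric_monoidal_category begin

lemma hom_abelian_group: "x \<in> Obj C \<Longrightarrow> y \<in> Obj C \<Longrightarrow> abelian_group (hom_module C x y)"
  using hom_is_module by (rule module.axioms)

lemma hom_module_simps [simp]:
  "carrier (hom_module C x y) = Hom C x y" "add (hom_module C x y) = Plus C"
  "zero (hom_module C x y) = Zero C x y" "module.smult (hom_module C x y) = Scale C"
  by (simp_all add: hom_module_def)

lemma arr_plus [simp]:
  assumes "f \<in> Arr C" "g \<in> Arr C" "Dom C f = Dom C g" "Cod C f = Cod C g"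
  shows "f \<boxplus> g \<in> Arr C" "Dom C (f \<boxplus> g) = Dom C g" "Cod C (f \<boxplus> g) = Cod C g"
  using abelian_monoid.a_closed[OF abelian_group.axioms(1)[OF hom_abelian_group[of "Dom C f" "Cod C f"]], of f g] assms
  by (auto simp: Hom_def)

lemma arr_zero [simp]:
  assumes "x \<in> Obj C" "y \<in> Obj C"
  shows "Zero C x y \<in> Arr C" "Dom C (Zero C x y) = x" "Cod C (Zero C x y) = y"
  using abelian_monoid.zero_closed[OF abelian_group.axioms(1)[OF hom_abelian_group[OF assms]]]
  by (auto simp: Hom_def)

lemma plus_commute:
  assumes "f \<in> Arr C" "g \<in> Arr C" "Dom C f = Dom C g" "Cod C f = Cod C g"
  shows "f \<boxplus> g = g \<boxplus> f"
  using abelian_monoid.a_comm[OF abelian_group.axioms(1)[OF hom_abelian_group[of "Dom C f" "Cod C f"]], of f g] assms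
  by (auto simp: Hom_def)

lemma plus_assoc:
  assumes "f \<in> Arr C" "g \<in> Arr C" "k \<in> Arr C" "Dom C f = Dom C g" "Cod C f = Cod C g"
    "Dom C g = Dom C k" "Cod C g = Cod C k"
  shows "(f \<boxplus> g) \<boxplus> k = f \<boxplus> (g \<boxplus> k)"
  using abelian_monoid.a_assoc[OF abelian_group.axioms(1)[OF hom_abelian_group[of "Dom C f" "Cod C f"]], of f g k] assms
  by (auto simp: Hom_def)

lemma plus_zero [simp]:
  assumes "f \<in> Arr C" "Dom C f = x" "Cod C f = y"
  shows "f \<boxplus> Zero C x y = f" "Zero C x y \<boxplus> f = f"
  using abelian_monoid.l_zero[OF abelian_group.axioms(1)[OF hom_abelian_group[of x y]], of f]
    abelian_monoid.r_zero[OF abelian_group.axioms(1)[OF hom_abelian_group[of x y]], of f] assms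
  by (auto simp: Hom_def)

lemma plus_eq_self:
  assumes "f \<in> Arr C" "g \<in> Arr C" "Dom C f = Dom C g" "Cod C f = Cod C g" "f = f \<boxplus> g"
  shows "g = Zero C (Dom C g) (Cod C g)"
proof -
  interpret abelian_group "hom_module C (Dom C g) (Cod C g)"
    using assms by (intro hom_abelian_group) auto
  show ?thesis
    using add.l_cancel_one'[of f g] assms by (simp add: Hom_def)
qed

lemma plus_eq_zero:
  assumes "f \<in> Arr C" "g \<in> Arr C" "Dom C f = x" "Cod C f = y" "Dom C g = x" "Cod C g = y"
    "f \<boxplus> g = Zero C x y"
  shows "f = \<ominus>\<^bsub>hom_module C x y\<^esub> g"
proof -
  interpret abelian_group "hom_module C x y"
    using assms by (intro hom_abelian_group) auto
  show ?thesis
    using minus_equality[of f g] assms by (simp add: Hom_def plus_commute)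
qed

lemma comp_plus [simp]:
  assumes "f \<in> Arr C" "f' \<in> Arr C" "g \<in> Arr C" "Dom C f = Dom C f'" "Cod C f = Cod C f'"
  shows "Dom C g = Cod C f' \<Longrightarrow> g \<cdot> (f \<boxplus> f') = g \<cdot> f \<boxplus> g \<cdot> f'"
    "Cod C g = Dom C f' \<Longrightarrow> (f \<boxplus> f') \<cdot> g = f \<cdot> g \<boxplus> f' \<cdot> g"
  using comp_plus_right[of f "Dom C f" "Cod C f" f' g "Cod C g"]
    comp_plus_left[of g "Dom C g" "Dom C f" f "Cod C f" f'] assms
  by (auto simp: Hom_def)

lemma tens_plus [simp]:
  assumes "f \<in> Arr C" "f' \<in> Arr C" "g \<in> Arr C" "Dom C f = Dom C f'" "Cod C f = Cod C f'"
  shows "g \<boxdot> (f \<boxplus> f') = g \<boxdot> f \<boxplus> g \<boxdot> f'" "(f \<boxplus> f') \<boxdot> g = f \<boxdot> g \<boxplus> f' \<boxdot> g"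
  using tens_plus_right[of g "Dom C g" "Cod C g" f "Dom C f" "Cod C f" f']
    tens_plus_left[of f "Dom C f" "Cod C f" f' g "Dom C g" "Cod C g"] assms
  by (auto simp: Hom_def)

text \<open>Additivity of composition gives
  \<open>g \<cdot> 0 = g \<cdot> 0 \<boxplus> g \<cdot> 0\<close>, and cancellation in the hom-group
  does the rest.\<close>

lemma comp_zero [simp]:
  assumes "x \<in> Obj C" "y \<in> Obj C" "g \<in> Arr C"
  shows "Dom C g = y \<Longrightarrow> g \<cdot> Zero C x y = Zero C x (Cod C g)"
    "Cod C g = x \<Longrightarrow> Zero C x y \<cdot> g = Zero C (Dom C g) y"
proof -
  assume "Dom C g = y"
  then show "g \<cdot> Zero C x y = Zero C x (Cod C g)"
    using assms comp_plus(1)[of "Zero C x y" "Zero C x y" g]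
      plus_eq_self[of "g \<cdot> Zero C x y" "g \<cdot> Zero C x y"] by (simp del: comp_plus)
next
  assume "Cod C g = x"
  then show "Zero C x y \<cdot> g = Zero C (Dom C g) y"
    using assms comp_plus(2)[of "Zero C x y" "Zero C x y" g]
      plus_eq_self[of "Zero C x y \<cdot> g" "Zero C x y \<cdot> g"] by (simp del: comp_plus)
qed

lemma tens_zero [simp]:
  assumes "x \<in> Obj C" "y \<in> Obj C" "g \<in> Arr C"
  shows "g \<boxdot> Zero C x y = Zero C (Dom C g \<boxtimes> x) (Cod C g \<boxtimes> y)"
    "Zero C x y \<boxdot> g = Zero C (x \<boxtimes> Dom C g) (y \<boxtimes> Cod C g)"
  using assms tens_plus(1)[of "Zero C x y" "Zero C x y" g] tens_plus(2)[of "Zero C x y" "Zero C x y" g]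
    plus_eq_self[of "Zero C x y \<boxdot> g" "Zero C x y \<boxdot> g"] plus_eq_self[of "g \<boxdot> Zero C x y" "g \<boxdot> Zero C x y"]
  by (simp_all del: tens_plus)

lemma scale_one [simp]: "f \<in> Arr C \<Longrightarrow> Scale C \<one>\<^bsub>R\<^esub> f = f"
  using module.smult_one[OF hom_is_module[of "Dom C f" "Cod C f"], of f] by (simp add: Hom_def)

lemma scale_minus_one:
  assumes "f \<in> Arr C"
  shows "Scale C (\<ominus>\<^bsub>R\<^esub> \<one>\<^bsub>R\<^esub>) f \<in> Arr C" "Dom C (Scale C (\<ominus>\<^bsub>R\<^esub> \<one>\<^bsub>R\<^esub>) f) = Dom C f"
    "Cod C (Scale C (\<ominus>\<^bsub>R\<^esub> \<one>\<^bsub>R\<^esub>) f) = Cod C f"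
    "f \<boxplus> Scale C (\<ominus>\<^bsub>R\<^esub> \<one>\<^bsub>R\<^esub>) f = Zero C (Dom C f) (Cod C f)"
proof -
  interpret module R "hom_module C (Dom C f) (Cod C f)"
    using assms by (intro hom_is_module) auto
  have f: "f \<in> carrier (hom_module C (Dom C f) (Cod C f))"
    using assms by (simp add: Hom_def)
  have "Scale C (\<ominus>\<^bsub>R\<^esub> \<one>\<^bsub>R\<^esub>) f \<in> carrier (hom_module C (Dom C f) (Cod C f))"
    using smult_closed[OF _ f, of "\<ominus>\<^bsub>R\<^esub> \<one>\<^bsub>R\<^esub>"] by simp
  then show "Scale C (\<ominus>\<^bsub>R\<^esub> \<one>\<^bsub>R\<^esub>) f \<in> Arr C" "Dom C (Scale C (\<ominus>\<^bsub>R\<^esub> \<one>\<^bsub>R\<^esub>) f) = Dom C f"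
    "Cod C (Scale C (\<ominus>\<^bsub>R\<^esub> \<one>\<^bsub>R\<^esub>) f) = Cod C f"
    by (auto simp: Hom_def)
  have "f \<oplus>\<^bsub>hom_module C (Dom C f) (Cod C f)\<^esub> (\<ominus>\<^bsub>R\<^esub> \<one>\<^bsub>R\<^esub>) \<odot>\<^bsub>hom_module C (Dom C f) (Cod C f)\<^esub> f
    = \<zero>\<^bsub>hom_module C (Dom C f) (Cod C f)\<^esub>"
    using f smult_l_minus[of "\<one>\<^bsub>R\<^esub>" f] M.r_neg[OF f] smult_one[OF f] by simp
  then show "f \<boxplus> Scale C (\<ominus>\<^bsub>R\<^esub> \<one>\<^bsub>R\<^esub>) f = Zero C (Dom C f) (Cod C f)"
    by simp
qed

end

section \<open>Tensor powers and the action of permutations\<close>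

context symmetric_monoidal_category begin

lemma tensor_pow_obj [simp]: "x \<in> Obj C \<Longrightarrow> tensor_pow C x n \<in> Obj C"
  by (induction n) auto

lemma arr_adjacent_swap [simp]:
  assumes "x \<in> Obj C" "Suc k < n"
  shows "adjacent_swap C x n k \<in> Arr C" "Dom C (adjacent_swap C x n k) = tensor_pow C x n"
    "Cod C (adjacent_swap C x n k) = tensor_pow C x n"
  using assms by (induction x n k rule: adjacent_swap.induct) auto

lemma arr_concatenation [simp]:
  assumes "x \<in> Obj C"
  shows "concatenation C x n m \<in> Arr C" "Dom C (concatenation C x n m) = tensor_pow C x n \<boxtimes> tensor_pow C x m"
    "Cod C (concatenation C x n m) = tensor_pow C x (n + m)"
  using assms by (induction m) auto

text \<open>Each \<open>permutation_arrow\<close> is by construction a composite of adjacent swaps,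
  so invariance need only be tested on these. Whether two such composites for the same permutation
  agree does not enter.\<close>

lemma permutation_arrow_invariant:
  assumes "permutation_arrow C x n \<pi> f" "x \<in> Obj C" "q \<in> Arr C" "Dom C q = tensor_pow C x n"
    and "\<And>k. Suc k < n \<Longrightarrow> q \<cdot> adjacent_swap C x n k = q"
  shows "f \<in> Arr C \<and> Dom C f = tensor_pow C x n \<and> Cod C f = tensor_pow C x n \<and> q \<cdot> f = q"
  using assms(1)
proof induction
  case identity
  then show ?case
    using assms by simp
next
  case (adjacent \<pi> f k)
  then have "q \<cdot> adjacent_swap C x n k \<cdot> f = (q \<cdot> adjacent_swap C x n k) \<cdot> f"
    using assms(2-4) by simp
  with adjacent show ?case
    using assms(2-5) by simp
qed

lemma adjacent_swap_in_action:
  assumes "x \<in> Obj C" "Suc k < n"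
  shows "adjacent_swap C x n k \<in> symmetric_group_action C x n"
proof -
  have "permutation_arrow C x n (transpose k (Suc k) \<circ> id) (adjacent_swap C x n k \<cdot> Ide C (tensor_pow C x n))"
    by (intro permutation_arrow.intros assms)
  moreover have "transpose k (Suc k) permutes {..<n}"
    using assms by (intro permutes_swap_id) auto
  ultimately show ?thesis
    using assms by (auto simp: symmetric_group_action_def)
qed

end

section \<open>Coproducts and symmetric algebras as colimits, alone and tensored with an
  object\<close>

context category begin

lemma coproduct_cocone:
  assumes "\<forall>i\<in>I. X i \<in> Obj C"
  shows "is_cocone (discrete_cat I) C X (\<lambda>i. Ide C (X i)) M k \<longleftrightarrow> M \<in> Obj C \<and> (\<forall>i\<in>I. k i \<in> Hom C (X i) M)"
  using assms by (auto simp: is_cocone_def discrete_cat_def Hom_def)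

lemma coproduct_univ:
  assumes "is_coproduct C I X L l" "\<And>i. i \<in> I \<Longrightarrow> X i \<in> Obj C" "M \<in> Obj C"
    "\<And>i. i \<in> I \<Longrightarrow> k i \<in> Hom C (X i) M"
  shows "\<exists>!g. g \<in> Hom C L M \<and> (\<forall>i\<in>I. g \<cdot> l i = k i)"
proof -
  have "is_cocone (discrete_cat I) C X (\<lambda>i. Ide C (X i)) M k"
    using assms coproduct_cocone[of I X M k] by auto
  then have "\<exists>!g. g \<in> Hom C L M \<and> (\<forall>i\<in>Obj (discrete_cat I). g \<cdot> l i = k i)"
    using assms(1) unfolding is_coproduct_def is_colimit_def by blast
  then show ?thesis
    by (simp add: discrete_cat_def)
qed

lemma category_discrete_cat: "category (discrete_cat I)"
  by unfold_locales (auto simp: discrete_cat_def Hom_def)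

lemma coproduct_inj:
  assumes "is_coproduct C I X L l" "\<And>i. i \<in> I \<Longrightarrow> X i \<in> Obj C"
  shows "L \<in> Obj C" "i \<in> I \<Longrightarrow> l i \<in> Hom C (X i) L"
proof -
  have "is_cocone (discrete_cat I) C X (\<lambda>i. Ide C (X i)) L l"
    using assms(1) by (simp add: is_coproduct_def is_colimit_def)
  then show "L \<in> Obj C" "i \<in> I \<Longrightarrow> l i \<in> Hom C (X i) L"
    using coproduct_cocone[of I X L l] assms(2) by auto
qed

end

context symmetric_monoidal_category begin

text \<open>\<open>tensor_cocomplete\<close> speaks of shapes over \<open>'j\<close> alone, while
  arrows of the quiver live in another type. A finite index set can be copied into the infinite type
  \<open>'j\<close>, with \<open>e\<close> as the injection and \<open>d\<close> as its
  inverse.\<close>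

lemma tensor_coproduct_univ:
  fixes I :: "'i set"
  assumes inf: "infinite (UNIV :: 'j set)" and tc: "tensor_cocomplete TYPE('j) C"
    and I: "finite I" and cop: "is_coproduct C I X L l" and X: "\<And>i. i \<in> I \<Longrightarrow> X i \<in> Obj C"
    and z: "z \<in> Obj C" and M: "M \<in> Obj C"
  shows "(\<And>i. i \<in> I \<Longrightarrow> k i \<in> Hom C (X i \<boxtimes> z) M) \<Longrightarrow>
      \<exists>!g. g \<in> Hom C (L \<boxtimes> z) M \<and> (\<forall>i\<in>I. g \<cdot> (l i \<boxdot> Ide C z) = k i)"
    and "(\<And>i. i \<in> I \<Longrightarrow> k i \<in> Hom C (z \<boxtimes> X i) M) \<Longrightarrow>
      \<exists>!g. g \<in> Hom C (z \<boxtimes> L) M \<and> (\<forall>i\<in>I. g \<cdot> (Ide C z \<boxdot> l i) = k i)"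
proof -
  obtain e :: "'i \<Rightarrow> 'j" where e: "inj_on e I"
  proof -
    obtain f :: "nat \<Rightarrow> 'j" where "inj f"
      using infinite_countable_subset[OF inf] by auto
    moreover obtain g :: "'i \<Rightarrow> nat" where "inj_on g I"
      using finite_imp_inj_to_nat_seg[OF I] by blast
    ultimately show thesis
      by (intro that[of "f \<circ> g"] comp_inj_on) (auto intro: inj_on_subset)
  qed
  have X_all: "\<forall>i\<in>I. X i \<in> Obj C" and zX: "\<forall>i\<in>I. z \<boxtimes> X i \<in> Obj C" and Xz: "\<forall>i\<in>I. X i \<boxtimes> z \<in> Obj C"
    using X z by auto
  define d where "d = inv_into I e"
  have d: "d (e i) = i" if "i \<in> I" for i
    using that e by (simp add: d_def)
  have L: "L \<in> Obj C" "\<And>i. i \<in> I \<Longrightarrow> l i \<in> Hom C (X i) L"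
    using coproduct_inj[OF cop] X by auto
  let ?J = "discrete_cat (e ` I)"
  \<comment> \<open>Translates the universal property from the copy back to \<open>I\<close>. It is
    needed for the family itself and for its products with \<open>z\<close> on either side, hence
    the general \<open>Y\<close>.\<close>
  have *: "is_coproduct C (e ` I) (\<lambda>j. Y (d j)) L' (\<lambda>j. l' (d j)) \<longleftrightarrow>
      L' \<in> Obj C \<and> (\<forall>i\<in>I. l' i \<in> Hom C (Y i) L') \<and>
      (\<forall>M k. M \<in> Obj C \<longrightarrow> (\<forall>i\<in>I. k i \<in> Hom C (Y i) M) \<longrightarrow>
          (\<exists>!g. g \<in> Hom C L' M \<and> (\<forall>i\<in>I. g \<cdot> l' i = k i)))"
    if Y: "\<forall>i\<in>I. Y i \<in> Obj C" for Y L' l'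
  proof -
    have Y': "\<forall>j\<in>e ` I. Y (d j) \<in> Obj C"
      using Y d by auto
    have "(\<forall>M k. M \<in> Obj C \<and> (\<forall>i\<in>I. k (e i) \<in> Hom C (Y i) M) \<longrightarrow>
          (\<exists>!g. g \<in> Hom C L' M \<and> (\<forall>i\<in>I. g \<cdot> l' i = k (e i)))) \<longleftrightarrow>
      (\<forall>M k. M \<in> Obj C \<longrightarrow> (\<forall>i\<in>I. k i \<in> Hom C (Y i) M) \<longrightarrow>
          (\<exists>!g. g \<in> Hom C L' M \<and> (\<forall>i\<in>I. g \<cdot> l' i = k i)))" (is "?A \<longleftrightarrow> ?B")
    proof
      assume ?A
      show ?B
      proof (intro allI impI)
        fix M k assume "M \<in> Obj C" "\<forall>i\<in>I. k i \<in> Hom C (Y i) M"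
        then show "\<exists>!g. g \<in> Hom C L' M \<and> (\<forall>i\<in>I. g \<cdot> l' i = k i)"
          using \<open>?A\<close>[rule_format, of M "\<lambda>j. k (d j)"] d by simp
      qed
    qed simp
    then show ?thesis
      unfolding is_coproduct_def is_colimit_def coproduct_cocone[of "e ` I" "\<lambda>j. Y (d j)", OF Y']
      by (simp add: discrete_cat_def d)
  qed
  have "is_coproduct C (e ` I) (\<lambda>j. X (d j)) L (\<lambda>j. l (d j))"
  proof (rule iffD2[OF *[of X, OF X_all]], intro conjI ballI allI impI)
    fix M k assume "M \<in> Obj C" "\<forall>i\<in>I. k i \<in> Hom C (X i) M"
    then show "\<exists>!g. g \<in> Hom C L M \<and> (\<forall>i\<in>I. g \<cdot> l i = k i)"
      using coproduct_univ[OF cop X, of M k] by simp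
  qed (use L in auto)
  then have "is_colimit ?J C (\<lambda>j. X (d j)) (\<lambda>j. Ide C (X (d j))) L (\<lambda>j. l (d j))"
    by (simp add: is_coproduct_def)
  moreover have "is_functor ?J C (\<lambda>j. X (d j)) (\<lambda>j. Ide C (X (d j)))"
    using X d by (auto simp: is_functor_def discrete_cat_def Hom_def)
  ultimately have
    "is_colimit ?J C (\<lambda>j. z \<boxtimes> X (d j)) (\<lambda>j. Ide C z \<boxdot> Ide C (X (d j))) (z \<boxtimes> L) (\<lambda>j. Ide C z \<boxdot> l (d j)) \<and>
     is_colimit ?J C (\<lambda>j. X (d j) \<boxtimes> z) (\<lambda>j. Ide C (X (d j)) \<boxdot> Ide C z) (L \<boxtimes> z) (\<lambda>j. l (d j) \<boxdot> Ide C z)"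
    using tc category_discrete_cat z unfolding tensor_cocomplete_def by blast
  moreover have "is_colimit ?J C Fo (\<lambda>j. Ide C z \<boxdot> Ide C (X (d j))) M' k'
      \<longleftrightarrow> is_colimit ?J C Fo (\<lambda>j. Ide C (z \<boxtimes> X (d j))) M' k'"
    "is_colimit ?J C Fo (\<lambda>j. Ide C (X (d j)) \<boxdot> Ide C z) M' k'
      \<longleftrightarrow> is_colimit ?J C Fo (\<lambda>j. Ide C (X (d j) \<boxtimes> z)) M' k'" for Fo M' k'
    using z X d by (auto simp: is_colimit_def is_cocone_def discrete_cat_def)
  ultimately have
    "is_coproduct C (e ` I) (\<lambda>j. z \<boxtimes> X (d j)) (z \<boxtimes> L) (\<lambda>j. Ide C z \<boxdot> l (d j))"
    "is_coproduct C (e ` I) (\<lambda>j. X (d j) \<boxtimes> z) (L \<boxtimes> z) (\<lambda>j. l (d j) \<boxdot> Ide C z)"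
    by (simp_all add: is_coproduct_def)
  note 1 = iffD1[OF *[of "\<lambda>i. z \<boxtimes> X i" "z \<boxtimes> L" "\<lambda>i. Ide C z \<boxdot> l i", OF zX] this(1),
      THEN conjunct2, THEN conjunct2, rule_format, OF M]
    and 2 = iffD1[OF *[of "\<lambda>i. X i \<boxtimes> z" "L \<boxtimes> z" "\<lambda>i. l i \<boxdot> Ide C z", OF Xz] this(2),
      THEN conjunct2, THEN conjunct2, rule_format, OF M]
  show "(\<And>i. i \<in> I \<Longrightarrow> k i \<in> Hom C (X i \<boxtimes> z) M) \<Longrightarrow>
      \<exists>!g. g \<in> Hom C (L \<boxtimes> z) M \<and> (\<forall>i\<in>I. g \<cdot> (l i \<boxdot> Ide C z) = k i)"
    by (rule 2)
  show "(\<And>i. i \<in> I \<Longrightarrow> k i \<in> Hom C (z \<boxtimes> X i) M) \<Longrightarrow>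
      \<exists>!g. g \<in> Hom C (z \<boxtimes> L) M \<and> (\<forall>i\<in>I. g \<cdot> (Ide C z \<boxdot> l i) = k i)"
    by (rule 1)
qed

text \<open>One factor at a time: for fixed \<open>j\<close> the components glue to
  \<open>f j\<close> on \<open>L \<boxtimes> X j\<close>, and these glue to \<open>g\<close> on
  \<open>L \<boxtimes> L\<close>.\<close>

lemma tensor_coproduct_univ2:
  fixes I :: "'i set"
  assumes inf: "infinite (UNIV :: 'j set)" and tc: "tensor_cocomplete TYPE('j) C"
    and I: "finite I" and cop: "is_coproduct C I X L l" and X: "\<And>i. i \<in> I \<Longrightarrow> X i \<in> Obj C"
    and M: "M \<in> Obj C"
    and k: "\<And>i j. i \<in> I \<Longrightarrow> j \<in> I \<Longrightarrow> k i j \<in> Hom C (X i \<boxtimes> X j) M"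
  shows "\<exists>!g. g \<in> Hom C (L \<boxtimes> L) M \<and> (\<forall>i\<in>I. \<forall>j\<in>I. g \<cdot> (l i \<boxdot> l j) = k i j)"
proof -
  note right = tensor_coproduct_univ(1)[OF inf tc I cop X]
  note left = tensor_coproduct_univ(2)[OF inf tc I cop X]
  have L: "L \<in> Obj C" "\<And>i. i \<in> I \<Longrightarrow> l i \<in> Arr C" "\<And>i. i \<in> I \<Longrightarrow> Dom C (l i) = X i"
    "\<And>i. i \<in> I \<Longrightarrow> Cod C (l i) = L"
    using coproduct_inj[OF cop] X by (auto simp: Hom_def)
  have l: "l i \<boxdot> l j = (Ide C L \<boxdot> l j) \<cdot> (l i \<boxdot> Ide C (X j))" if "i \<in> I" "j \<in> I" for i j
    using that L X by simp
  have "\<exists>f. f \<in> Hom C (L \<boxtimes> X j) M \<and> (\<forall>i\<in>I. f \<cdot> (l i \<boxdot> Ide C (X j)) = k i j)" if "j \<in> I" for j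
    by (intro ex1_implies_ex right) (use that M X k in auto)
  then have "\<forall>j. \<exists>f. j \<in> I \<longrightarrow> f \<in> Hom C (L \<boxtimes> X j) M \<and> (\<forall>i\<in>I. f \<cdot> (l i \<boxdot> Ide C (X j)) = k i j)"
    by blast
  then obtain f where f: "\<And>j. j \<in> I \<Longrightarrow> f j \<in> Hom C (L \<boxtimes> X j) M"
    "\<And>i j. i \<in> I \<Longrightarrow> j \<in> I \<Longrightarrow> f j \<cdot> (l i \<boxdot> Ide C (X j)) = k i j"
    by metis
  obtain g where g: "g \<in> Hom C (L \<boxtimes> L) M" "\<And>j. j \<in> I \<Longrightarrow> g \<cdot> (Ide C L \<boxdot> l j) = f j"
  proof -
    have "\<exists>g. g \<in> Hom C (L \<boxtimes> L) M \<and> (\<forall>j\<in>I. g \<cdot> (Ide C L \<boxdot> l j) = f j)"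
      by (intro ex1_implies_ex left) (use L M f in auto)
    then show thesis
      using that by blast
  qed
  have assoc': "g' \<cdot> (l i \<boxdot> l j) = (g' \<cdot> (Ide C L \<boxdot> l j)) \<cdot> (l i \<boxdot> Ide C (X j))"
    if "g' \<in> Hom C (L \<boxtimes> L) M" "i \<in> I" "j \<in> I" for g' i j
    using that L X unfolding l[OF that(2,3)] Hom_def by (simp del: interchange)
  show ?thesis
  proof (rule ex1I[of _ g])
    show "g \<in> Hom C (L \<boxtimes> L) M \<and> (\<forall>i\<in>I. \<forall>j\<in>I. g \<cdot> (l i \<boxdot> l j) = k i j)"
      using g f by (simp add: assoc')
    fix g' assume g': "g' \<in> Hom C (L \<boxtimes> L) M \<and> (\<forall>i\<in>I. \<forall>j\<in>I. g' \<cdot> (l i \<boxdot> l j) = k i j)"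
    have "g' \<cdot> (Ide C L \<boxdot> l j) = f j" if j: "j \<in> I" for j
    proof -
      have "g' \<cdot> (Ide C L \<boxdot> l j) \<in> Hom C (L \<boxtimes> X j) M"
        using g' j L by (auto simp: Hom_def)
      moreover have "\<forall>i\<in>I. (g' \<cdot> (Ide C L \<boxdot> l j)) \<cdot> (l i \<boxdot> Ide C (X j)) = k i j"
        using g' j assoc' by metis
      ultimately show ?thesis
        by (intro ex1_eqI[OF right[of "X j" M "\<lambda>i. k i j"]]) (use j X M k f in auto)
    qed
    then show "g' = g"
      by (intro ex1_eqI[OF left[of L M f], of g' g]) (use L M f g g' in auto)
  qed
qed

text \<open>Collapses the coproduct of coinvariants into a single colimit over all tensor powers,
  whose cocones are the families invariant under adjacent swaps. In this form one appeal to
  cocompleteness handles tensoring with \<open>z\<close>.\<close>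

lemma symmetric_algebra_univ:
  assumes sa: "symmetric_algebra C h p S \<mu> \<eta>" and M: "M \<in> Obj C"
    and k: "\<And>n. k n \<in> Hom C (tensor_pow C h n) M"
    and inv: "\<And>n i. Suc i < n \<Longrightarrow> k n \<cdot> adjacent_swap C h n i = k n"
  shows "\<exists>!g. g \<in> Hom C S M \<and> (\<forall>n. g \<cdot> p n = k n)"
proof -
  obtain y q i where h: "h \<in> Obj C"
    and q: "\<And>n. is_coinvariants C (tensor_pow C h n) (symmetric_group_action C h n) (y n) (q n)"
    and i: "is_coproduct C (UNIV :: nat set) y S i" and p: "\<And>n. p n = i n \<cdot> q n"
    using sa unfolding symmetric_algebra_def by blast
  have y: "y n \<in> Obj C" "q n \<in> Arr C" "Dom C (q n) = tensor_pow C h n" "Cod C (q n) = y n" for n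
    using q[of n] by (auto simp: is_coinvariants_def Hom_def)
  have S: "S \<in> Obj C" "i n \<in> Arr C" "Dom C (i n) = y n" "Cod C (i n) = S" for n
    using coproduct_inj[OF i] y by (auto simp: Hom_def)
  have k': "k n \<in> Arr C" "Dom C (k n) = tensor_pow C h n" "Cod C (k n) = M" for n
    using k[of n] by (auto simp: Hom_def)
  have "k n \<cdot> f = k n" if "f \<in> symmetric_group_action C h n" for n f
    using that permutation_arrow_invariant[of h n _ f "k n"] h inv k' unfolding symmetric_group_action_def
    by auto
  then have ex1: "\<exists>!f. f \<in> Hom C (y n) M \<and> f \<cdot> q n = k n" for n
    using q[of n] k[of n] unfolding is_coinvariants_def by blast
  then obtain f where f: "f n \<in> Hom C (y n) M" "f n \<cdot> q n = k n" for n
    by metis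
  obtain g where g: "g \<in> Hom C S M" "\<And>n. g \<cdot> i n = f n"
    using coproduct_univ[OF i, of M f] y M f by auto
  have assoc': "g' \<cdot> p n = (g' \<cdot> i n) \<cdot> q n" if "g' \<in> Hom C S M" for g' n
    using that y S unfolding p Hom_def by simp
  show ?thesis
  proof (rule ex1I[of _ g])
    show "g \<in> Hom C S M \<and> (\<forall>n. g \<cdot> p n = k n)"
      using g f assoc' by simp
    fix g' assume g': "g' \<in> Hom C S M \<and> (\<forall>n. g' \<cdot> p n = k n)"
    have "g' \<cdot> i n = f n" for n
    proof -
      have "g' \<cdot> i n \<in> Hom C (y n) M"
        using g' S by (auto simp: Hom_def)
      moreover have "(g' \<cdot> i n) \<cdot> q n = k n"
        using g' assoc' by metis
      ultimately show ?thesis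
        by (intro ex1_eqI[OF ex1[of n]]) (use f in auto)
    qed
    then show "g' = g"
      by (intro ex1_eqI[OF coproduct_univ[OF i, of M f], of g' g]) (use y M f g g' in auto)
  qed
qed

lemma symmetric_algebra_arr:
  assumes "symmetric_algebra C h p S \<mu> \<eta>"
  shows "h \<in> Obj C" "S \<in> Obj C" "p n \<in> Arr C" "Dom C (p n) = tensor_pow C h n" "Cod C (p n) = S"
    "Suc i < n \<Longrightarrow> p n \<cdot> adjacent_swap C h n i = p n"
proof -
  obtain y q j where h: "h \<in> Obj C"
    and q: "\<And>n. is_coinvariants C (tensor_pow C h n) (symmetric_group_action C h n) (y n) (q n)"
    and j: "is_coproduct C (UNIV :: nat set) y S j" and p: "\<And>n. p n = j n \<cdot> q n"
    using assms unfolding symmetric_algebra_def by blast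
  have y: "y n \<in> Obj C" "q n \<in> Arr C" "Dom C (q n) = tensor_pow C h n" "Cod C (q n) = y n" for n
    using q[of n] by (auto simp: is_coinvariants_def Hom_def)
  have S: "S \<in> Obj C" "j n \<in> Arr C" "Dom C (j n) = y n" "Cod C (j n) = S" for n
    using coproduct_inj[OF j] y by (auto simp: Hom_def)
  show "h \<in> Obj C" "S \<in> Obj C" "p n \<in> Arr C" "Dom C (p n) = tensor_pow C h n" "Cod C (p n) = S"
    using h S y by (auto simp: p)
  assume "Suc i < n"
  then have "q n \<cdot> adjacent_swap C h n i = q n"
    using q[of n] adjacent_swap_in_action[OF h] unfolding is_coinvariants_def by blast
  then show "p n \<cdot> adjacent_swap C h n i = p n"
    using h S y \<open>Suc i < n\<close> by (simp add: p)
qed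

text \<open>The shape has objects \<open>(n, 0)\<close> and \<open>(n, 1)\<close>, both sent to the \<open>n\<close>-th tensor power, and
  arrows \<open>(n, k + 2)\<close> from the former to the latter, sent to the adjacent transpositions and
  (for large \<open>k\<close>) to the identity. So no relation between permutations enters.\<close>

lemma tensor_symmetric_algebra_univ:
  assumes inf: "infinite (UNIV :: 'j set)" and tc: "tensor_cocomplete TYPE('j) C"
    and sa: "symmetric_algebra C h p S \<mu> \<eta>" and z: "z \<in> Obj C" and M: "M \<in> Obj C"
    and k: "\<And>n. k n \<in> Hom C (tensor_pow C h n \<boxtimes> z) M"
    and inv: "\<And>n i. Suc i < n \<Longrightarrow> k n \<cdot> (adjacent_swap C h n i \<boxdot> Ide C z) = k n"
  shows "\<exists>!g. g \<in> Hom C (S \<boxtimes> z) M \<and> (\<forall>n. g \<cdot> (p n \<boxdot> Ide C z) = k n)"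
proof -
  obtain e :: "nat \<times> nat \<Rightarrow> 'j" where e: "inj e"
  proof -
    obtain f :: "nat \<Rightarrow> 'j" where "inj f"
      using infinite_countable_subset[OF inf] by auto
    then show thesis
      by (intro that[of "f \<circ> prod_encode"] inj_compose inj_prod_encode)
  qed
  define d where "d = inv_into UNIV e"
  have d [simp]: "d (e u) = u" for u
    using e by (simp add: d_def)
  have inj [simp]: "e u = e v \<longleftrightarrow> u = v" for u v
    using e by (auto dest: injD)
  \<comment> \<open>Second components 0 and 1 mark the identities. As every other arrow runs from
    \<open>(n, 0)\<close> to \<open>(n, 1)\<close>, one of two composable arrows is always an
    identity, and \<open>Comp\<close> returns the other one.\<close>
  define J :: "('j, 'j) cat" where "J = \<lparr>Obj = e ` {(n, k). k < 2}, Arr = range e,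
    Dom = (\<lambda>u. if snd (d u) = 1 then u else e (fst (d u), 0)),
    Cod = (\<lambda>u. if snd (d u) = 0 then u else e (fst (d u), 1)),
    Ide = (\<lambda>u. u), Comp = (\<lambda>g f. if snd (d g) < 2 then f else g)\<rparr>"
  have J: "Obj J = e ` {(n, k). k < 2}" "Arr J = range e"
    "\<And>u. Dom J u = (if snd (d u) = 1 then u else e (fst (d u), 0))"
    "\<And>u. Cod J u = (if snd (d u) = 0 then u else e (fst (d u), 1))"
    "\<And>u. Ide J u = u" "\<And>g f. Comp J g f = (if snd (d g) < 2 then f else g)"
    by (simp_all add: J_def)
  have cat: "category J"
    by unfold_locales (auto simp: J Hom_def split: if_splits)
  note h = symmetric_algebra_arr[OF sa]
  define Fa where "Fa = (\<lambda>u. case d u of (n, k) \<Rightarrow>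
    if 2 \<le> k \<and> Suc (k - 2) < n then adjacent_swap C h n (k - 2) else Ide C (tensor_pow C h n))"
  let ?Fo = "\<lambda>u. tensor_pow C h (fst (d u))"
  have Fa: "is_functor J C ?Fo Fa"
    using h by (auto simp: is_functor_def J Fa_def Hom_def)
  \<comment> \<open>Stated for arbitrary objects \<open>G\<close> and arrows \<open>s\<close>
    because it serves twice, before and after tensoring with \<open>z\<close>.\<close>
  have cocone: "is_cocone J C Go Ga M' k' \<longleftrightarrow> M' \<in> Obj C \<and>
      (\<forall>n. k' (e (n, 0)) \<in> Hom C (G n) M' \<and> k' (e (n, 1)) = k' (e (n, 0)) \<and>
         (\<forall>i. Suc i < n \<longrightarrow> k' (e (n, 0)) \<cdot> s n i = k' (e (n, 0))))"
    if G: "\<And>n k. Go (e (n, k)) = G n" "\<And>n. G n \<in> Obj C"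
      "\<And>n k. Ga (e (n, k)) = (if 2 \<le> k \<and> Suc (k - 2) < n then s n (k - 2) else Ide C (G n))"
    for Go Ga M' k' G s
  proof
    assume L: "is_cocone J C Go Ga M' k'"
    have 0: "k' (e (n, 0)) \<in> Hom C (G n) M'" "k' (e (n, 1)) \<in> Hom C (G n) M'" for n
      using L unfolding is_cocone_def J by (auto simp: G)
    have *: "k' (Cod J (e (n, i))) \<cdot> Ga (e (n, i)) = k' (Dom J (e (n, i)))" for n i
      using L unfolding is_cocone_def J(2) by blast
    \<comment> \<open>The arrow with index \<open>n + 2\<close> lies beyond the transpositions,
      hence goes to an identity and forces both legs to agree.\<close>
    have 1: "k' (e (n, 1)) = k' (e (n, 0))" for n
      using *[of n "n + 2"] 0[of n] by (simp add: J G Hom_def)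
    have "k' (e (n, 0)) \<cdot> s n i = k' (e (n, 0))" if "Suc i < n" for n i
      using *[of n "i + 2"] that by (simp add: J G 1[symmetric])
    with 0 1 L show "M' \<in> Obj C \<and>
      (\<forall>n. k' (e (n, 0)) \<in> Hom C (G n) M' \<and> k' (e (n, 1)) = k' (e (n, 0)) \<and>
         (\<forall>i. Suc i < n \<longrightarrow> k' (e (n, 0)) \<cdot> s n i = k' (e (n, 0))))"
      by (auto simp: is_cocone_def)
  next
    assume R: "M' \<in> Obj C \<and>
      (\<forall>n. k' (e (n, 0)) \<in> Hom C (G n) M' \<and> k' (e (n, 1)) = k' (e (n, 0)) \<and>
         (\<forall>i. Suc i < n \<longrightarrow> k' (e (n, 0)) \<cdot> s n i = k' (e (n, 0))))"
    show "is_cocone J C Go Ga M' k'"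
      unfolding is_cocone_def
    proof (intro conjI ballI)
      show "M' \<in> Obj C"
        using R by simp
    next
      fix u assume "u \<in> Obj J"
      then obtain n i where "u = e (n, i)" "i = 0 \<or> i = 1"
        by (auto simp: J less_2_cases_iff)
      then show "k' u \<in> Hom C (Go u) M'"
        using R G by auto
    next
      fix u assume "u \<in> Arr J"
      then obtain n i where u: "u = e (n, i)"
        by (auto simp: J)
      show "k' (Cod J u) \<cdot> Ga u = k' (Dom J u)"
        using R comp_ide[of "k' (e (n, 0))" "G n" M'] unfolding u J G by auto
    qed
  qed
  have "is_colimit J C ?Fo Fa S (\<lambda>u. p (fst (d u)))"
    unfolding is_colimit_def
  proof (intro conjI allI impI)
    note cocone' = cocone[of ?Fo "tensor_pow C h" Fa "adjacent_swap C h"]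
    show "is_cocone J C ?Fo Fa S (\<lambda>u. p (fst (d u)))"
      by (subst cocone') (use h in \<open>auto simp: Fa_def Hom_def\<close>)
    fix M' k' assume "is_cocone J C ?Fo Fa M' k'"
    then have k': "M' \<in> Obj C \<and> (\<forall>n. k' (e (n, 0)) \<in> Hom C (tensor_pow C h n) M' \<and>
        k' (e (n, 1)) = k' (e (n, 0)) \<and>
        (\<forall>i. Suc i < n \<longrightarrow> k' (e (n, 0)) \<cdot> adjacent_swap C h n i = k' (e (n, 0))))"
      by (subst (asm) cocone') (use h in \<open>auto simp: Fa_def\<close>)
    then have "\<exists>!g. g \<in> Hom C S M' \<and> (\<forall>n. g \<cdot> p n = k' (e (n, 0)))"
      by (intro symmetric_algebra_univ[OF sa]) auto
    moreover have "(\<forall>u\<in>Obj J. g \<cdot> p (fst (d u)) = k' u) \<longleftrightarrow> (\<forall>n. g \<cdot> p n = k' (e (n, 0)))" for g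
      using k' by (force simp: J less_2_cases_iff)
    ultimately show "\<exists>!g. g \<in> Hom C S M' \<and> (\<forall>u\<in>Obj J. g \<cdot> p (fst (d u)) = k' u)"
      by simp
  qed
  then have "is_colimit J C (\<lambda>u. ?Fo u \<boxtimes> z) (\<lambda>u. Fa u \<boxdot> Ide C z) (S \<boxtimes> z) (\<lambda>u. p (fst (d u)) \<boxdot> Ide C z)"
    using tc cat Fa z unfolding tensor_cocomplete_def by blast
  moreover have "is_cocone J C (\<lambda>u. ?Fo u \<boxtimes> z) (\<lambda>u. Fa u \<boxdot> Ide C z) M (\<lambda>u. k (fst (d u)))"
    by (subst cocone[of _ "\<lambda>n. tensor_pow C h n \<boxtimes> z" _ "\<lambda>n i. adjacent_swap C h n i \<boxdot> Ide C z"])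
      (use h z M k inv in \<open>auto simp: Fa_def\<close>)
  ultimately have "\<exists>!g. g \<in> Hom C (S \<boxtimes> z) M \<and> (\<forall>u\<in>Obj J. g \<cdot> (p (fst (d u)) \<boxdot> Ide C z) = k (fst (d u)))"
    unfolding is_colimit_def by blast
  moreover have "(\<forall>u\<in>Obj J. g \<cdot> (p (fst (d u)) \<boxdot> Ide C z) = k (fst (d u))) \<longleftrightarrow>
      (\<forall>n. g \<cdot> (p n \<boxdot> Ide C z) = k n)" for g
    by (force simp: J)
  ultimately show ?thesis
    by simp
qed

end

section \<open>Derivations of free commutative algebras\<close>

locale linear_stages = linear_symmetric_monoidal_category R C + stages C X
  for R :: "('r, 'u) ring_scheme" and C :: "('o, 'm, 'r, 'z) linear_smcat_scheme" (structure) and X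
begin

text \<open>Meaningful for summands with the same variables. For pairs these are unions, which is
  why \<open>Un_ac\<close> accompanies most calculations with sums.\<close>

definition sum_elm :: "nat set \<times> 'm \<Rightarrow> nat set \<times> 'm \<Rightarrow> nat set \<times> 'm"  (infixl \<open>\<uplus>\<close> 65) where
  "a \<uplus> b = (fst a, snd a \<boxplus> snd b)"

definition zero_elm :: "nat set \<Rightarrow> 'o \<Rightarrow> nat set \<times> 'm" where
  "zero_elm A y = (A, Zero C (stage A) y)"

lemma fst_sum_elm [simp]: "fst (a \<uplus> b) = fst a" "fst (zero_elm A y) = A"
  by (simp_all add: sum_elm_def zero_elm_def)

lemma dj_sum_elm [simp]:
  "dj (a \<uplus> b) c = dj a c" "dj c (a \<uplus> b) = dj c a"
  "dj (zero_elm (fst a) y) c = dj a c" "dj c (zero_elm (fst a) y) = dj c a"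
  "dj (zero_elm (A \<union> B) y) c \<longleftrightarrow> dj (zero_elm A y) c \<and> dj (zero_elm B y) c"
  "dj c (zero_elm (A \<union> B) y) \<longleftrightarrow> dj c (zero_elm A y) \<and> dj c (zero_elm B y)"
  by (auto simp: dj_def)

lemma elm_sum_elm [simp]:
  assumes "elm a" "elm b" "fst a = fst b" "ety a = ety b"
  shows "elm (a \<uplus> b)" "ety (a \<uplus> b) = ety b"
  using assms by (auto simp: elm_def ety_def sum_elm_def)

lemma elm_zero_elm [simp]:
  assumes "y \<in> Obj C"
  shows "elm (zero_elm A y)" "ety (zero_elm A y) = y"
  using assms by (auto simp: elm_def ety_def zero_elm_def)

lemma app_sum_elm [simp]:
  assumes "elm a" "elm b" "fst a = fst b" "ety a = ety b" "f \<in> Arr C" "Dom C f = ety b"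
  shows "f \<star> (a \<uplus> b) = f \<star> a \<uplus> f \<star> b"
  using assms by (auto simp: elm_def ety_def sum_elm_def app_def)

lemma app_plus [simp]:
  assumes "elm a" "f \<in> Arr C" "g \<in> Arr C" "Dom C f = ety a" "Dom C g = ety a" "Cod C f = Cod C g"
  shows "(f \<boxplus> g) \<star> a = f \<star> a \<uplus> g \<star> a"
  using assms by (auto simp: elm_def ety_def sum_elm_def app_def)

lemma pair_sum_elm [simp]:
  assumes "elm a" "elm b" "fst a = fst b" "ety a = ety b" "elm c"
  shows "dj b c \<Longrightarrow> \<langle>a \<uplus> b, c\<rangle> = \<langle>a, c\<rangle> \<uplus> \<langle>b, c\<rangle>" "dj c b \<Longrightarrow> \<langle>c, a \<uplus> b\<rangle> = \<langle>c, a\<rangle> \<uplus> \<langle>c, b\<rangle>"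
  using assms by (auto simp: elm_def ety_def sum_elm_def pair_def dj_def)

lemma app_zero_elm [simp]:
  assumes "f \<in> Arr C" "Dom C f = y"
  shows "f \<star> zero_elm A y = zero_elm A (Cod C f)"
  using assms by (auto simp: app_def zero_elm_def)

lemma app_zero [simp]:
  assumes "elm a" "ety a = x" "y \<in> Obj C"
  shows "Zero C x y \<star> a = zero_elm (fst a) y"
  using assms by (auto simp: app_def zero_elm_def elm_def ety_def)

lemma pair_zero_elm [simp]:
  assumes "elm c" "y \<in> Obj C" "dj c (zero_elm A y)"
  shows "\<langle>zero_elm A y, c\<rangle> = zero_elm (A \<union> fst c) (y \<boxtimes> ety c)"
    "\<langle>c, zero_elm A y\<rangle> = zero_elm (fst c \<union> A) (ety c \<boxtimes> y)"
proof -
  have "A \<inter> fst c = {}" "fst c \<inter> A = {}"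
    using assms by (auto simp: dj_def)
  then show "\<langle>zero_elm A y, c\<rangle> = zero_elm (A \<union> fst c) (y \<boxtimes> ety c)"
    "\<langle>c, zero_elm A y\<rangle> = zero_elm (fst c \<union> A) (ety c \<boxtimes> y)"
    using assms by (auto simp: pair_def zero_elm_def elm_def ety_def)
qed

lemma sum_elm_commute:
  assumes "elm a" "elm b" "fst a = fst b" "ety a = ety b"
  shows "a \<uplus> b = b \<uplus> a"
  using assms plus_commute[of "snd a" "snd b"] by (auto simp: elm_def ety_def sum_elm_def)

lemma sum_elm_assoc:
  assumes "elm a" "elm b" "elm c" "fst a = fst b" "ety a = ety b" "fst b = fst c" "ety b = ety c"
  shows "(a \<uplus> b) \<uplus> c = a \<uplus> (b \<uplus> c)"
  using assms plus_assoc[of "snd a" "snd b" "snd c"] by (auto simp: elm_def ety_def sum_elm_def)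

lemma sum_elm_left_commute:
  assumes "elm a" "elm b" "elm c" "fst a = fst b" "ety a = ety b" "fst b = fst c" "ety b = ety c"
  shows "a \<uplus> (b \<uplus> c) = b \<uplus> (a \<uplus> c)"
  using assms sum_elm_assoc[of a b c] sum_elm_assoc[of b a c] sum_elm_commute[of a b] by simp

lemma sum_elm_zero [simp]:
  assumes "elm a" "fst a = A" "ety a = y"
  shows "a \<uplus> zero_elm A y = a" "zero_elm A y \<uplus> a = a"
  using assms by (auto simp: elm_def ety_def sum_elm_def zero_elm_def prod_eq_iff)

lemma sum_elm_eq_self:
  assumes "elm a" "a = a \<uplus> a"
  shows "a = zero_elm (fst a) (ety a)"
proof -
  have "snd a = snd a \<boxplus> snd a"
    using assms by (simp add: sum_elm_def prod_eq_iff)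
  then show ?thesis
    using assms plus_eq_self[of "snd a" "snd a"] by (simp add: elm_def ety_def zero_elm_def prod_eq_iff)
qed

lemma scale_zero_elm [simp]:
  assumes "elm s" "y \<in> Obj C" "dj s (zero_elm A y)" "ety s = Unit C"
  shows "s \<bullet> zero_elm A y = zero_elm (fst s \<union> A) y"
  using assms by (simp add: scale_def)

end

text \<open>Collects the consequences of \<open>symmetric_algebra\<close> and cocompleteness that
  the rest uses. The type \<open>'j\<close> and the shapes of diagrams disappear behind
  \<open>univ\<close>.\<close>

locale free_commutative_algebra = linear_symmetric_monoidal_category R C
  for R :: "('r, 'u) ring_scheme" and C :: "('o, 'm, 'r, 'z) linear_smcat_scheme" (structure) +
  fixes h S :: 'o and p :: "nat \<Rightarrow> 'm" and \<mu> \<eta> :: 'm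
  assumes obj [simp]: "h \<in> Obj C" "S \<in> Obj C"
    and arr_p [simp]: "p n \<in> Arr C" "Dom C (p n) = tensor_pow C h n" "Cod C (p n) = S"
    and p_swap: "Suc i < n \<Longrightarrow> p n \<cdot> adjacent_swap C h n i = p n"
    and monoid: "commutative_monoid C S \<mu> \<eta>"
    and unit_p: "\<eta> = p 0"
    and mult_p: "\<mu> \<cdot> (p n \<boxdot> p m) = p (n + m) \<cdot> concatenation C h n m"
    and univ: "\<lbrakk>z \<in> Obj C; M \<in> Obj C; \<And>n. k n \<in> Hom C (tensor_pow C h n \<boxtimes> z) M;
        \<And>n i. Suc i < n \<Longrightarrow> k n \<cdot> (adjacent_swap C h n i \<boxdot> Ide C z) = k n\<rbrakk> \<Longrightarrow>
      \<exists>!g. g \<in> Hom C (S \<boxtimes> z) M \<and> (\<forall>n. g \<cdot> (p n \<boxdot> Ide C z) = k n)"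
begin

lemma arr_mult [simp]:
  "\<mu> \<in> Arr C" "Dom C \<mu> = S \<boxtimes> S" "Cod C \<mu> = S" "\<eta> \<in> Arr C" "Dom C \<eta> = Unit C" "Cod C \<eta> = S"
  using monoid by (auto simp: commutative_monoid_def Hom_def)

abbreviation "\<iota> \<equiv> generator_inclusion C h p"

lemma arr_generator [simp]: "\<iota> \<in> Arr C" "Dom C \<iota> = h" "Cod C \<iota> = S"
  by (simp_all add: generator_inclusion_def)

lemma free_ext:
  assumes "f \<in> Arr C" "g \<in> Arr C" "Dom C f = S \<boxtimes> z" "Dom C g = S \<boxtimes> z" "Cod C f = Cod C g" "z \<in> Obj C"
    and "\<And>n. f \<cdot> (p n \<boxdot> Ide C z) = g \<cdot> (p n \<boxdot> Ide C z)"
  shows "f = g"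
proof (rule ex1_eqI[OF univ[of z "Cod C g" "\<lambda>n. f \<cdot> (p n \<boxdot> Ide C z)"]])
  fix n i assume i: "Suc i < n"
  show "(f \<cdot> (p n \<boxdot> Ide C z)) \<cdot> (adjacent_swap C h n i \<boxdot> Ide C z) = f \<cdot> (p n \<boxdot> Ide C z)"
    using assms(1-6) i p_swap[OF i] by simp
qed (use assms in \<open>auto simp: Hom_def\<close>)

text \<open>In elements, \<open>D (a b, w) = a D (b, w) + D (a, w) b\<close>. The parameter
  \<open>w\<close> of type \<open>z\<close> carries the remaining arguments of a bracket or of the
  Jacobiator.\<close>

definition derivation :: "'o \<Rightarrow> 'm \<Rightarrow> bool" where
  "derivation z D \<longleftrightarrow> D \<in> Arr C \<and> Dom C D = S \<boxtimes> z \<and> Cod C D = S \<and>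
     D \<cdot> (\<mu> \<boxdot> Ide C z) = \<mu> \<cdot> (Ide C S \<boxdot> D) \<cdot> Asc C S S z \<boxplus> \<mu> \<cdot> (D \<boxdot> Ide C S) \<cdot> swap_right S S z"

lemma derivation_arr: "derivation z D \<Longrightarrow> D \<in> Arr C" "derivation z D \<Longrightarrow> Dom C D = S \<boxtimes> z"
  "derivation z D \<Longrightarrow> Cod C D = S"
  by (auto simp: derivation_def)

end

section \<open>Calculating in the free algebra with generalised elements\<close>

locale free_stages = free_commutative_algebra R C h S p \<mu> \<eta> + linear_stages R C X
  for R :: "('r, 'u) ring_scheme" and C :: "('o, 'm, 'r, 'z) linear_smcat_scheme" (structure)
    and h S p \<mu> \<eta> X
begin

abbreviation mult  (infixl \<open>\<odot>\<close> 70) where "a \<odot> b \<equiv> \<mu> \<star> \<langle>a, b\<rangle>"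

lemma mult_commute:
  assumes "elm a" "elm b" "dj a b" "ety a = S" "ety b = S"
  shows "a \<odot> b = b \<odot> a"
proof -
  have "a \<odot> b = (\<mu> \<cdot> Sym C S S) \<star> \<langle>a, b\<rangle>"
    using monoid by (simp add: commutative_monoid_def)
  then show ?thesis
    using assms by simp
qed

lemma mult_assoc:
  assumes "elm a" "elm b" "elm c" "dj a b" "dj a c" "dj b c" "ety a = S" "ety b = S" "ety c = S"
  shows "(a \<odot> b) \<odot> c = a \<odot> (b \<odot> c)"
proof -
  have "(a \<odot> b) \<odot> c = (\<mu> \<cdot> (\<mu> \<boxdot> Ide C S)) \<star> \<langle>\<langle>a, b\<rangle>, c\<rangle>"
    using assms by simp
  also have "\<dots> = (\<mu> \<cdot> (Ide C S \<boxdot> \<mu>) \<cdot> Asc C S S S) \<star> \<langle>\<langle>a, b\<rangle>, c\<rangle>"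
    using monoid by (simp add: commutative_monoid_def)
  finally show ?thesis
    using assms by simp
qed

lemma mult_left_commute:
  assumes "elm a" "elm b" "elm c" "dj a b" "dj b a" "dj a c" "dj b c" "ety a = S" "ety b = S" "ety c = S"
  shows "a \<odot> (b \<odot> c) = b \<odot> (a \<odot> c)"
  using assms mult_assoc[of a b c] mult_assoc[of b a c] mult_commute[of a b] by simp

lemma mult_unit:
  assumes "elm a" "elm s" "dj a s" "ety a = S" "ety s = Unit C"
  shows "a \<odot> (\<eta> \<star> s) = s \<bullet> a"
proof -
  have "a \<odot> (\<eta> \<star> s) = (\<mu> \<cdot> (Ide C S \<boxdot> \<eta>)) \<star> \<langle>a, s\<rangle>"
    using assms by simp
  also have "\<dots> = RUnit C S \<star> \<langle>a, s\<rangle>"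
    using monoid by (simp add: commutative_monoid_def)
  finally show ?thesis
    using assms by simp
qed

lemma scale_star [simp]: "elm a \<Longrightarrow> star \<bullet> a = a"
  by (simp add: scale_def)

lemma p_concatenation:
  assumes "elm u" "elm v" "dj u v" "ety u = tensor_pow C h n" "ety v = tensor_pow C h m"
  shows "p (n + m) \<star> concatenation C h n m \<star> \<langle>u, v\<rangle> = (p n \<star> u) \<odot> (p m \<star> v)"
proof -
  have "p (n + m) \<star> concatenation C h n m \<star> \<langle>u, v\<rangle> = (p (n + m) \<cdot> concatenation C h n m) \<star> \<langle>u, v\<rangle>"
    using assms by simp
  also have "\<dots> = (p n \<star> u) \<odot> (p m \<star> v)"
    using assms by (simp flip: mult_p)
  finally show ?thesis .
qed

text \<open>Concatenation with a word of length one. The first tensor power is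
  \<open>Unit C \<boxtimes> h\<close>, so \<open>star\<close> fills its unit factor.\<close>

lemma p_Suc:
  assumes "elm u" "elm v" "dj u v" "ety u = tensor_pow C h n" "ety v = h"
  shows "p (Suc n) \<star> \<langle>u, v\<rangle> = (p n \<star> u) \<odot> (\<iota> \<star> v)"
proof -
  have "p (n + 1) \<star> concatenation C h n 1 \<star> \<langle>u, \<langle>star, v\<rangle>\<rangle> = (p n \<star> u) \<odot> (p 1 \<star> \<langle>star, v\<rangle>)"
    using assms by (intro p_concatenation) auto
  then show ?thesis
    using assms by (simp add: generator_inclusion_def)
qed

lemma p_swap_app:
  assumes "elm u" "ety u = tensor_pow C h n" "Suc i < n"
  shows "p n \<star> adjacent_swap C h n i \<star> u = p n \<star> u"
  using assms by (simp add: p_swap flip: app_comp)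

lemma derivation_mult:
  assumes "derivation z D" "elm a" "elm b" "elm w" "dj a b" "dj a w" "dj b w" "dj w b"
    "ety a = S" "ety b = S" "ety w = z"
  shows "D \<star> \<langle>a \<odot> b, w\<rangle> = a \<odot> (D \<star> \<langle>b, w\<rangle>) \<uplus> (D \<star> \<langle>a, w\<rangle>) \<odot> b"
proof -
  note D = derivation_arr[OF assms(1)]
  have z: "z \<in> Obj C"
    using assms ety_obj by blast
  have "D \<star> \<langle>a \<odot> b, w\<rangle> = (D \<cdot> (\<mu> \<boxdot> Ide C z)) \<star> \<langle>\<langle>a, b\<rangle>, w\<rangle>"
    using D z assms by simp
  also have "\<dots> = (\<mu> \<cdot> (Ide C S \<boxdot> D) \<cdot> Asc C S S z \<boxplus> \<mu> \<cdot> (D \<boxdot> Ide C S) \<cdot> swap_right S S z) \<star> \<langle>\<langle>a, b\<rangle>, w\<rangle>"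
    using assms(1) by (simp add: derivation_def)
  finally show ?thesis
    using D z assms by simp
qed

text \<open>The unit \<open>e\<close> satisfies \<open>e = e e\<close>, so \<open>D (e, w)\<close>
  is the sum of two copies of itself and vanishes. A general \<open>\<eta> \<star> s\<close> is the
  multiple \<open>s \<bullet> e\<close>, and the scalar can be pulled out of
  \<open>D\<close>.\<close>

lemma derivation_unit:
  assumes "derivation z D" "elm s" "elm w" "dj s w" "dj w s" "ety s = Unit C" "ety w = z"
  shows "D \<star> \<langle>\<eta> \<star> s, w\<rangle> = zero_elm (fst s \<union> fst w) S"
proof -
  note D = derivation_arr[OF assms(1)]
  have z: "z \<in> Obj C"
    using assms ety_obj by blast
  let ?e = "\<eta> \<star> star"
  have ee: "?e \<odot> ?e = ?e"
    by (simp add: mult_unit)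
  have "D \<star> \<langle>?e, w\<rangle> = D \<star> \<langle>?e, w\<rangle> \<uplus> D \<star> \<langle>?e, w\<rangle>"
    using derivation_mult[OF assms(1), of ?e ?e w] assms D z
    by (simp add: ee mult_unit mult_commute[of ?e])
  then have "D \<star> \<langle>?e, w\<rangle> = zero_elm (fst w) S"
    using sum_elm_eq_self[of "D \<star> \<langle>?e, w\<rangle>"] assms D z by simp
  moreover have "\<eta> \<star> s = s \<bullet> ?e"
    using assms by (simp add: scale_app scale_commute[of s star] flip: scale_app)
  ultimately show ?thesis
    using assms D z by (simp add: scale_pair_left scale_app)
qed

end

context free_commutative_algebra begin

lemma free_stagesI: "stages C X \<Longrightarrow> free_stages R C h S p \<mu> \<eta> X"
  by unfold_locales (rule stages.X_obj)

end

text \<open>\<open>free_ext\<close> tests only the leftmost factor, so it is applied twice with a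
  reordering in between.\<close>

lemma (in free_commutative_algebra) free_ext2:
  assumes "f \<in> Arr C" "g \<in> Arr C" "Dom C f = (S \<boxtimes> S) \<boxtimes> z" "Dom C g = (S \<boxtimes> S) \<boxtimes> z" "Cod C f = Cod C g"
    and z: "z \<in> Obj C"
    and eq: "\<And>n m. f \<cdot> ((p n \<boxdot> p m) \<boxdot> Ide C z) = g \<cdot> ((p n \<boxdot> p m) \<boxdot> Ide C z)"
  shows "f = g"
proof (rule iso_cancel_right[of "inverse_arrow C (Asc C S S z)"])
  let ?a = "inverse_arrow C (Asc C S S z)"
  show "f \<cdot> ?a = g \<cdot> ?a"
  proof (rule free_ext[of _ _ "S \<boxtimes> z"])
    fix n
    let ?h = "tensor_pow C h n"
    \<comment> \<open>An isomorphism from \<open>S \<boxtimes> (?h \<boxtimes> z)\<close> to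
      \<open>?h \<boxtimes> (S \<boxtimes> z)\<close>: precomposing with it puts the remaining copy
      of \<open>S\<close> in front.\<close>
    let ?t = "Asc C ?h S z \<cdot> (Sym C S ?h \<boxdot> Ide C z) \<cdot> inverse_arrow C (Asc C S ?h z)"
    have t: "is_iso C ?t"
      using z by simp
    show "(f \<cdot> ?a) \<cdot> (p n \<boxdot> Ide C (S \<boxtimes> z)) = (g \<cdot> ?a) \<cdot> (p n \<boxdot> Ide C (S \<boxtimes> z))"
    proof (rule iso_cancel_right[OF t])
      show "((f \<cdot> ?a) \<cdot> (p n \<boxdot> Ide C (S \<boxtimes> z))) \<cdot> ?t = ((g \<cdot> ?a) \<cdot> (p n \<boxdot> Ide C (S \<boxtimes> z))) \<cdot> ?t"
      proof (rule free_ext[of _ _ "?h \<boxtimes> z"])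
        fix m
        let ?k = "tensor_pow C h m"
        let ?s = "(Sym C ?k ?h \<boxdot> Ide C z) \<cdot> inverse_arrow C (Asc C ?k ?h z)"
        have *: "(((k \<cdot> ?a) \<cdot> (p n \<boxdot> Ide C (S \<boxtimes> z))) \<cdot> ?t) \<cdot> (p m \<boxdot> Ide C (?h \<boxtimes> z))
            = (k \<cdot> ((p n \<boxdot> p m) \<boxdot> Ide C z)) \<cdot> ?s"
          if k: "k \<in> Arr C" "Dom C k = (S \<boxtimes> S) \<boxtimes> z" for k
        proof -
          obtain X a b c d where X: "stages C X" and v: "stages.variables C X a b c d ?k ?h z z"
            by (rule obtain_variables[of ?k ?h z z]) (use z in auto)
          interpret stages C X by fact
          show ?thesis
            by (rule elm_ext[of "pair a (pair b c)"])
              (use k z v[unfolded variables_def] in simp_all)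
        qed
        show "(((f \<cdot> ?a) \<cdot> (p n \<boxdot> Ide C (S \<boxtimes> z))) \<cdot> ?t) \<cdot> (p m \<boxdot> Ide C (?h \<boxtimes> z))
            = (((g \<cdot> ?a) \<cdot> (p n \<boxdot> Ide C (S \<boxtimes> z))) \<cdot> ?t) \<cdot> (p m \<boxdot> Ide C (?h \<boxtimes> z))"
          using assms by (simp only: *)
      qed (use assms in auto)
    qed (use assms in auto)
  qed (use assms in auto)
qed (use assms in auto)

text \<open>Induction on the length of words: the empty word is a multiple of the unit, and a longer
  word is a shorter one times a generator by \<open>p_Suc\<close>, to which the Leibniz rule
  applies.\<close>

lemma (in free_commutative_algebra) derivation_unique:
  assumes D: "derivation z D" "derivation z D'" and z: "z \<in> Obj C"
    and eq: "D \<cdot> (\<iota> \<boxdot> Ide C z) = D' \<cdot> (\<iota> \<boxdot> Ide C z)"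
  shows "D = D'"
proof (rule free_ext[of _ _ z])
  note a = derivation_arr[OF D(1)] derivation_arr[OF D(2)]
  fix n
  show "D \<cdot> (p n \<boxdot> Ide C z) = D' \<cdot> (p n \<boxdot> Ide C z)"
  proof (induction n)
    case 0
    obtain X s w c d where X: "stages C X" and v: "stages.variables C X s w c d (Unit C) z z z"
      by (rule obtain_variables[of "Unit C" z z z]) (use z in auto)
    interpret free_stages R C h S p \<mu> \<eta> X
      using X by (rule free_stagesI)
    show ?case
      by (rule elm_ext[of "pair s w"])
        (use a z v[unfolded variables_def] D in \<open>simp_all add: derivation_unit flip: unit_p\<close>)
  next
    case (Suc n)
    obtain X u v w d where X: "stages C X" and v: "stages.variables C X u v w d (tensor_pow C h n) h z z"
      by (rule obtain_variables[of "tensor_pow C h n" h z z]) (use z in auto)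
    interpret free_stages R C h S p \<mu> \<eta> X
      using X by (rule free_stagesI)
    note v = v[unfolded variables_def]
    have "app D (pair (app (p n) u) w) = app D' (pair (app (p n) u) w)"
      using arg_cong[OF Suc, of "\<lambda>k. app k (pair u w)"] a z v by simp
    moreover have "app D (pair (app \<iota> v) w) = app D' (pair (app \<iota> v) w)"
      using arg_cong[OF eq, of "\<lambda>k. app k (pair v w)"] a z v by simp
    ultimately show ?case
      by (intro elm_ext[of "pair (pair u v) w"])
        (use a z v D in \<open>simp_all add: p_Suc derivation_mult[OF D(1)] derivation_mult[OF D(2)]\<close>)
  qed
qed (use derivation_arr[OF D(1)] derivation_arr[OF D(2)] z in auto)

section \<open>Extending a map on generators to a derivation\<close>

context free_commutative_algebra begin

context
  fixes z \<phi>
  assumes z [simp]: "z \<in> Obj C" and arr_phi [simp]: "\<phi> \<in> Arr C" "Dom C \<phi> = h \<boxtimes> z" "Cod C \<phi> = S"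
begin

text \<open>Unfolded, this is the sum over the letters of a word in which one letter
  \<open>v\<close> is replaced by \<open>\<phi> (v, w)\<close>. The recursion splits off the last
  letter because \<open>tensor_pow\<close> grows on the right.\<close>

primrec power_derivation :: "nat \<Rightarrow> 'm" where
  "power_derivation 0 = Zero C (Unit C \<boxtimes> z) S"
| "power_derivation (Suc n) =
     \<mu> \<cdot> (p n \<boxdot> \<phi>) \<cdot> Asc C (tensor_pow C h n) h z \<boxplus>
     \<mu> \<cdot> (power_derivation n \<boxdot> \<iota>) \<cdot> swap_right (tensor_pow C h n) h z"

lemma arr_power_derivation [simp]:
  "power_derivation n \<in> Arr C" "Dom C (power_derivation n) = tensor_pow C h n \<boxtimes> z"
  "Cod C (power_derivation n) = S"
  by (induction n) simp_all

text \<open>The recursion in elements. The family \<open>X\<close> is explicit because it is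
  obtained anew inside each proof.\<close>

lemma power_derivation_Suc:
  assumes "free_stages R C h S p \<mu> \<eta> X"
  assumes "stages.elm C X u" "stages.elm C X v" "stages.elm C X w"
    "stages.dj u v" "stages.dj u w" "stages.dj v w" "stages.dj w v"
    "stages.ety C u = tensor_pow C h n" "stages.ety C v = h" "stages.ety C w = z"
  shows "stages.app C (power_derivation (Suc n)) (stages.pair C X (stages.pair C X u v) w)
    = linear_stages.sum_elm C
       (stages.app C \<mu> (stages.pair C X (stages.app C (p n) u) (stages.app C \<phi> (stages.pair C X v w))))
       (stages.app C \<mu> (stages.pair C X (stages.app C (power_derivation n) (stages.pair C X u w))
           (stages.app C \<iota> v)))"
proof -
  interpret free_stages R C h S p \<mu> \<eta> X by fact
  show ?thesis
    using assms by simp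
qed

text \<open>Transposing the last two letters exchanges the two terms in which one of them meets
  \<open>\<phi>\<close>, and the third term is symmetric by commutativity. An earlier transposition
  leaves the last letter alone, so invariance of \<open>p\<close> and the induction hypothesis
  apply.\<close>

lemma power_derivation_swap:
  assumes "Suc k < n"
  shows "power_derivation n \<cdot> (adjacent_swap C h n k \<boxdot> Ide C z) = power_derivation n"
  using assms
proof (induction n)
  case (Suc n')
  then obtain m where m: "n' = Suc m" "k \<le> m"
    by (cases n') auto
  show ?case
  proof (cases "k = m")
    case True
    obtain X u v v' w where X: "stages C X" and v: "stages.variables C X u v v' w (tensor_pow C h m) h h z"
      by (rule obtain_variables[of "tensor_pow C h m" h h z]) auto
    interpret free_stages R C h S p \<mu> \<eta> X
      using X by (rule free_stagesI)
    note v = v[unfolded variables_def]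
    note PS = power_derivation_Suc[OF free_stages_axioms]
    have "adjacent_swap C h (Suc (Suc m)) m = swap_right (tensor_pow C h m) h h"
      by (simp add: swap_right_def)
    then show ?thesis
      unfolding m True
      by (intro elm_ext[of "pair (pair (pair u v) v') w"])
        (use v in \<open>simp_all add: PS p_Suc mult_assoc mult_commute mult_left_commute
          sum_elm_assoc sum_elm_commute sum_elm_left_commute Un_ac
          del: power_derivation.simps adjacent_swap.simps\<close>)
  next
    case False
    then have k: "Suc k < n'"
      using m by simp
    obtain X u v w d where X: "stages C X" and v: "stages.variables C X u v w d (tensor_pow C h n') h z z"
      by (rule obtain_variables[of "tensor_pow C h n'" h z z]) auto
    interpret free_stages R C h S p \<mu> \<eta> X
      using X by (rule free_stagesI)
    note v = v[unfolded variables_def]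
    note PS = power_derivation_Suc[OF free_stages_axioms]
    have "adjacent_swap C h (Suc n') k = adjacent_swap C h n' k \<boxdot> Ide C h"
      using False m by simp
    moreover have "app (power_derivation n') (pair (app (adjacent_swap C h n' k) u) w)
        = app (power_derivation n') (pair u w)"
      using arg_cong[OF Suc.IH[OF k], of "\<lambda>l. app l (pair u w)"] v k by simp
    ultimately show ?thesis
      by (intro elm_ext[of "pair (pair u v) w"])
        (use v k in \<open>simp_all add: PS p_swap_app del: power_derivation.simps adjacent_swap.simps\<close>)
  qed
qed simp

text \<open>The Leibniz rule on words, by induction on the second one. For the empty word,
  \<open>p 0\<close> is the unit and \<open>power_derivation 0\<close> vanishes.\<close>

lemma power_derivation_concatenation:
  "power_derivation (n + m) \<cdot> (concatenation C h n m \<boxdot> Ide C z) =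
     \<mu> \<cdot> (p n \<boxdot> power_derivation m) \<cdot> Asc C (tensor_pow C h n) (tensor_pow C h m) z \<boxplus>
     \<mu> \<cdot> (power_derivation n \<boxdot> p m) \<cdot> swap_right (tensor_pow C h n) (tensor_pow C h m) z"
proof (induction m)
  case 0
  obtain X u s w d where X: "stages C X" and v: "stages.variables C X u s w d (tensor_pow C h n) (Unit C) z z"
    by (rule obtain_variables[of "tensor_pow C h n" "Unit C" z z]) auto
  interpret free_stages R C h S p \<mu> \<eta> X
    using X by (rule free_stagesI)
  note v = v[unfolded variables_def]
  show ?case
    by (rule elm_ext[of "pair (pair u s) w"])
      (use v in \<open>simp_all add: mult_unit scale_pair_left scale_app Un_ac flip: unit_p\<close>)
next
  case (Suc m)
  obtain X u v t w where X: "stages C X"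
    and v: "stages.variables C X u v t w (tensor_pow C h n) (tensor_pow C h m) h z"
    by (rule obtain_variables[of "tensor_pow C h n" "tensor_pow C h m" h z]) auto
  interpret free_stages R C h S p \<mu> \<eta> X
    using X by (rule free_stagesI)
  note v = v[unfolded variables_def]
  note PS = power_derivation_Suc[OF free_stages_axioms]
  have "app (power_derivation (n + m)) (pair (app (concatenation C h n m) (pair u v)) w)
      = sum_elm (mult (app (p n) u) (app (power_derivation m) (pair v w)))
          (mult (app (power_derivation n) (pair u w)) (app (p m) v))"
    using arg_cong[OF Suc, of "\<lambda>k. app k (pair (pair u v) w)"] v by simp
  then show ?case
    by (intro elm_ext[of "pair (pair u (pair v t)) w"])
      (use v in \<open>simp_all add: PS p_Suc p_concatenation mult_assoc mult_commute mult_left_commute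
          sum_elm_assoc sum_elm_commute sum_elm_left_commute Un_ac del: power_derivation.simps\<close>)
qed

lemma derivation_exists: "\<exists>D. derivation z D \<and> D \<cdot> (\<iota> \<boxdot> Ide C z) = \<phi>"
proof -
  obtain D where D: "D \<in> Arr C" "Dom C D = S \<boxtimes> z" "Cod C D = S"
      "\<And>n. D \<cdot> (p n \<boxdot> Ide C z) = power_derivation n"
    using ex1_implies_ex[OF univ[of z S power_derivation]] power_derivation_swap by (auto simp: Hom_def)
  have "derivation z D"
    unfolding derivation_def
  proof (intro conjI)
    show "D \<cdot> (\<mu> \<boxdot> Ide C z) = \<mu> \<cdot> (Ide C S \<boxdot> D) \<cdot> Asc C S S z \<boxplus> \<mu> \<cdot> (D \<boxdot> Ide C S) \<cdot> swap_right S S z"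
    proof (rule free_ext2[of _ _ z])
      fix n m
      let ?n = "tensor_pow C h n" and ?m = "tensor_pow C h m"
      have "(D \<cdot> (\<mu> \<boxdot> Ide C z)) \<cdot> ((p n \<boxdot> p m) \<boxdot> Ide C z)
          = (D \<cdot> (p (n + m) \<boxdot> Ide C z)) \<cdot> (concatenation C h n m \<boxdot> Ide C z)"
        using D(1-3) by (simp add: mult_p)
      also have "\<dots> = \<mu> \<cdot> (p n \<boxdot> power_derivation m) \<cdot> Asc C ?n ?m z \<boxplus>
          \<mu> \<cdot> (power_derivation n \<boxdot> p m) \<cdot> swap_right ?n ?m z"
        by (simp only: D(4) power_derivation_concatenation)
      also have "\<dots> = (\<mu> \<cdot> (Ide C S \<boxdot> D) \<cdot> Asc C S S z \<boxplus> \<mu> \<cdot> (D \<boxdot> Ide C S) \<cdot> swap_right S S z) \<cdot>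
          ((p n \<boxdot> p m) \<boxdot> Ide C z)"
        using D(1-3) by (simp add: asc_nat swap_right_nat D(4))
      finally show "(D \<cdot> (\<mu> \<boxdot> Ide C z)) \<cdot> ((p n \<boxdot> p m) \<boxdot> Ide C z)
        = (\<mu> \<cdot> (Ide C S \<boxdot> D) \<cdot> Asc C S S z \<boxplus> \<mu> \<cdot> (D \<boxdot> Ide C S) \<cdot> swap_right S S z) \<cdot>
          ((p n \<boxdot> p m) \<boxdot> Ide C z)" .
    qed (use D in auto)
  qed (use D in auto)
  moreover have "D \<cdot> (\<iota> \<boxdot> Ide C z) = \<phi>"
  proof -
    obtain X v w c d where X: "stages C X" and v: "stages.variables C X v w c d h z z z"
      by (rule obtain_variables[of h z z z]) auto
    interpret free_stages R C h S p \<mu> \<eta> X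
      using X by (rule free_stagesI)
    note v = v[unfolded variables_def]
    \<comment> \<open>A generator enters the first tensor power as \<open>pair star v\<close>. Of
      the two summands there, one is zero and the other is the unit times
      \<open>\<phi> (v, w)\<close>.\<close>
    have "app D (pair (app (p 1) (pair star v)) w) = app (power_derivation (Suc 0)) (pair (pair star v) w)"
      using arg_cong[OF D(4)[of 1], of "\<lambda>k. app k (pair (pair star v) w)"] v D(1-3) by simp
    also have "\<dots> = app \<phi> (pair v w)"
      using v by (simp add: mult_unit mult_commute[of "app \<eta> star"] flip: unit_p)
    finally show ?thesis
      by (intro elm_ext[of "pair v w"])
        (use v D(1-3) in \<open>simp_all add: generator_inclusion_def\<close>)
  qed
  ultimately show ?thesis
    by blast
qed

end
end

section \<open>Biderivations and the Jacobi identity\<close>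

context free_stages begin

text \<open>The bookkeeping for the Jacobiator of a product \<open>a b\<close>: the \<open>x\<close>
  terms have \<open>a\<close> as a factor, the \<open>y\<close> terms have \<open>b\<close> as a
  factor, and \<open>q\<close>, \<open>q'\<close>, \<open>r\<close>, \<open>r'\<close> are the
  crossed products of two brackets.\<close>

lemma sum_cancel_crossed:
  assumes "elm x1" "elm x2" "elm x3" "elm y1" "elm y2" "elm y3" "elm q" "elm q'" "elm r" "elm r'"
    and fst: "fst x1 = A" "fst x2 = A" "fst x3 = A" "fst y1 = A" "fst y2 = A" "fst y3 = A"
      "fst q = A" "fst q' = A" "fst r = A" "fst r' = A"
    and ety: "ety x1 = S" "ety x2 = S" "ety x3 = S" "ety y1 = S" "ety y2 = S" "ety y3 = S"
      "ety q = S" "ety q' = S" "ety r = S" "ety r' = S"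
    and "q \<uplus> q' = zero_elm A S" "r \<uplus> r' = zero_elm A S"
  shows "(x1 \<uplus> y1) \<uplus> ((y2 \<uplus> q) \<uplus> (r \<uplus> x2)) \<uplus> ((q' \<uplus> x3) \<uplus> (y3 \<uplus> r')) = (x1 \<uplus> x2 \<uplus> x3) \<uplus> (y1 \<uplus> y2 \<uplus> y3)"
proof -
  have "(x1 \<uplus> y1) \<uplus> ((y2 \<uplus> q) \<uplus> (r \<uplus> x2)) \<uplus> ((q' \<uplus> x3) \<uplus> (y3 \<uplus> r'))
      = (x1 \<uplus> x2 \<uplus> x3) \<uplus> (y1 \<uplus> y2 \<uplus> y3) \<uplus> (q \<uplus> q') \<uplus> (r \<uplus> r')"
    using assms(1-10) fst ety by (simp add: sum_elm_assoc sum_elm_commute sum_elm_left_commute)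
  also have "\<dots> = (x1 \<uplus> x2 \<uplus> x3) \<uplus> (y1 \<uplus> y2 \<uplus> y3)"
    using assms by simp
  finally show ?thesis .
qed

end

context free_commutative_algebra begin

lemma derivationI:
  assumes D: "D \<in> Arr C" "Dom C D = S \<boxtimes> z" "Cod C D = S" and z: "z \<in> Obj C"
    and mult: "\<And>X a b w d. free_stages R C h S p \<mu> \<eta> X \<Longrightarrow> stages.variables C X a b w d S S z z \<Longrightarrow>
      stages.app C D (stages.pair C X (stages.app C \<mu> (stages.pair C X a b)) w) =
      linear_stages.sum_elm C (stages.app C \<mu> (stages.pair C X a (stages.app C D (stages.pair C X b w))))
        (stages.app C \<mu> (stages.pair C X (stages.app C D (stages.pair C X a w)) b))"
  shows "derivation z D"
  unfolding derivation_def
proof (intro conjI)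
  obtain X a b w d where X: "stages C X" and v: "stages.variables C X a b w d S S z z"
    by (rule obtain_variables[of S S z z]) (use z in auto)
  interpret free_stages R C h S p \<mu> \<eta> X
    using X by (rule free_stagesI)
  note m = mult[OF free_stages_axioms v]
  note v = v[unfolded variables_def]
  show "D \<cdot> (\<mu> \<boxdot> Ide C z) = \<mu> \<cdot> (Ide C S \<boxdot> D) \<cdot> Asc C S S z \<boxplus> \<mu> \<cdot> (D \<boxdot> Ide C S) \<cdot> swap_right S S z"
    by (rule elm_ext[of "pair (pair a b) w"]) (use v D z m in simp_all)
qed (use D in auto)

lemma derivation_Zero: "z \<in> Obj C \<Longrightarrow> derivation z (Zero C (S \<boxtimes> z) S)"
  by (simp add: derivation_def)

lemma biderivation_derivation:
  assumes "biderivation C S \<mu> \<eta> d"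
  shows "derivation S d"
  using assms by (auto simp: biderivation_def derivation_def swap_right_def Hom_def)

lemma biderivation_arr:
  assumes "biderivation C S \<mu> \<eta> d"
  shows "d \<in> Arr C" "Dom C d = S \<boxtimes> S" "Cod C d = S"
  using assms by (auto simp: biderivation_def Hom_def)

end

context free_stages begin

lemmas biderivation_mult_left = derivation_mult[OF biderivation_derivation]

lemma biderivation_mult_right:
  assumes "biderivation C S \<mu> \<eta> d" "elm a" "elm b" "elm c"
    "dj a b" "dj b a" "dj a c" "dj b c" "ety a = S" "ety b = S" "ety c = S"
  shows "d \<star> \<langle>a, b \<odot> c\<rangle> = (d \<star> \<langle>a, b\<rangle>) \<odot> c \<uplus> b \<odot> (d \<star> \<langle>a, c\<rangle>)"
proof -
  note d = biderivation_arr[OF assms(1)]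
  have "d \<star> \<langle>a, b \<odot> c\<rangle> = (d \<cdot> (Ide C S \<boxdot> \<mu>)) \<star> \<langle>a, \<langle>b, c\<rangle>\<rangle>"
    using d assms by simp
  also have "\<dots> = (\<mu> \<cdot> (d \<boxdot> Ide C S) \<cdot> inverse_arrow C (Asc C S S S) \<boxplus>
       \<mu> \<cdot> (Ide C S \<boxdot> d) \<cdot>
         Asc C S S S \<cdot> (Sym C S S \<boxdot> Ide C S) \<cdot> inverse_arrow C (Asc C S S S)) \<star> \<langle>a, \<langle>b, c\<rangle>\<rangle>"
    using assms(1) by (simp add: biderivation_def)
  finally show ?thesis
    using d assms by simp
qed

lemma biderivation_unit_right:
  assumes "biderivation C S \<mu> \<eta> d" "elm a" "elm s" "dj a s" "ety a = S" "ety s = Unit C"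
  shows "d \<star> \<langle>a, \<eta> \<star> s\<rangle> = zero_elm (fst a \<union> fst s) S"
proof -
  note d = biderivation_arr[OF assms(1)]
  have "d \<star> \<langle>a, \<eta> \<star> s\<rangle> = (d \<cdot> (Ide C S \<boxdot> \<eta>)) \<star> \<langle>a, s\<rangle>"
    using d assms by simp
  also have "\<dots> = Zero C (S \<boxtimes> Unit C) S \<star> \<langle>a, s\<rangle>"
    using assms(1) by (simp add: biderivation_def)
  finally show ?thesis
    using assms by simp
qed

end

context free_commutative_algebra begin

text \<open>The unit conditions follow from the Leibniz rules. In the right argument,
  \<open>derivation_unit\<close> is applied to \<open>d \<cdot> Sym C S S\<close>.\<close>

lemma biderivationI:
  assumes d: "derivation S d"
    and right: "\<And>X a b c e. free_stages R C h S p \<mu> \<eta> X \<Longrightarrow> stages.variables C X a b c e S S S S \<Longrightarrow>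
      stages.app C d (stages.pair C X a (stages.app C \<mu> (stages.pair C X b c))) =
      linear_stages.sum_elm C (stages.app C \<mu> (stages.pair C X (stages.app C d (stages.pair C X a b)) c))
        (stages.app C \<mu> (stages.pair C X b (stages.app C d (stages.pair C X a c))))"
  shows "biderivation C S \<mu> \<eta> d"
  unfolding biderivation_def
proof (intro conjI)
  note arr = derivation_arr[OF d]
  show "d \<in> Hom C (S \<boxtimes> S) S"
    using arr by (simp add: Hom_def)
  show "d \<cdot> (\<mu> \<boxdot> Ide C S) = \<mu> \<cdot> (Ide C S \<boxdot> d) \<cdot> Asc C S S S \<boxplus>
       \<mu> \<cdot> (d \<boxdot> Ide C S) \<cdot> inverse_arrow C (Asc C S S S) \<cdot> (Ide C S \<boxdot> Sym C S S) \<cdot> Asc C S S S"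
    using d by (simp add: derivation_def swap_right_def)
  obtain X a b c e where X: "stages C X" and v: "stages.variables C X a b c e S S S S"
    by (rule obtain_variables[of S S S S]) auto
  interpret free_stages R C h S p \<mu> \<eta> X
    using X by (rule free_stagesI)
  note r = right[OF free_stages_axioms v]
  note v = v[unfolded variables_def]
  show "d \<cdot> (Ide C S \<boxdot> \<mu>) = \<mu> \<cdot> (d \<boxdot> Ide C S) \<cdot> inverse_arrow C (Asc C S S S) \<boxplus>
       \<mu> \<cdot> (Ide C S \<boxdot> d) \<cdot> Asc C S S S \<cdot> (Sym C S S \<boxdot> Ide C S) \<cdot> inverse_arrow C (Asc C S S S)"
    by (rule elm_ext[of "pair a (pair b c)"]) (use v arr r in simp_all)
next
  note arr = derivation_arr[OF d]
  obtain X s a b c where X: "stages C X" and v: "stages.variables C X s a b c (Unit C) S S S"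
    by (rule obtain_variables[of "Unit C" S S S]) auto
  interpret free_stages R C h S p \<mu> \<eta> X
    using X by (rule free_stagesI)
  note v = v[unfolded variables_def]
  show "d \<cdot> (\<eta> \<boxdot> Ide C S) = Zero C (Unit C \<boxtimes> S) S"
    by (rule elm_ext[of "pair s a"]) (use v arr in \<open>simp_all add: derivation_unit[OF d]\<close>)
next
  note arr = derivation_arr[OF d]
  have der: "derivation S (d \<cdot> Sym C S S)"
  proof (rule derivationI)
    fix X a b w e
    assume "free_stages R C h S p \<mu> \<eta> X" and v: "stages.variables C X a b w e S S S S"
    then interpret free_stages R C h S p \<mu> \<eta> X
      by simp
    have "variables w a b e S S S S"
      using v by (auto simp: variables_def)
    note r = right[OF free_stages_axioms this]
    note v = v[unfolded variables_def]
    show "app (d \<cdot> Sym C S S) (pair (mult a b) w) =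
        sum_elm (mult a (app (d \<cdot> Sym C S S) (pair b w))) (mult (app (d \<cdot> Sym C S S) (pair a w)) b)"
      using v arr r by (simp add: sum_elm_commute Un_ac)
  qed (use arr in auto)
  obtain X s a b c where X: "stages C X" and v: "stages.variables C X s a b c (Unit C) S S S"
    by (rule obtain_variables[of "Unit C" S S S]) auto
  interpret free_stages R C h S p \<mu> \<eta> X
    using X by (rule free_stagesI)
  note v = v[unfolded variables_def]
  have "app (d \<cdot> Sym C S S) (pair (app \<eta> s) a) = zero_elm (fst s \<union> fst a) S"
    using v by (intro derivation_unit[OF der]) auto
  then show "d \<cdot> (Ide C S \<boxdot> \<eta>) = Zero C (S \<boxtimes> Unit C) S"
    by (intro elm_ext[of "pair a s"]) (use v arr in \<open>simp_all add: Un_ac\<close>)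
qed

text \<open>\<open>derivation_unique\<close> twice, with parameter \<open>S\<close> and then, once
  the first argument is a generator, with parameter \<open>h\<close>; in between the symmetry brings
  the second argument to the front.\<close>

lemma biderivation_unique:
  assumes d: "biderivation C S \<mu> \<eta> d" and d': "biderivation C S \<mu> \<eta> d'"
    and eq: "d \<cdot> (\<iota> \<boxdot> \<iota>) = d' \<cdot> (\<iota> \<boxdot> \<iota>)"
  shows "d = d'"
proof (rule derivation_unique[OF biderivation_derivation[OF d] biderivation_derivation[OF d']])
  note arr = biderivation_arr[OF d] biderivation_arr[OF d']
  have der: "derivation h (k \<cdot> (\<iota> \<boxdot> Ide C S) \<cdot> Sym C S h)" if k: "biderivation C S \<mu> \<eta> k" for k
  proof (rule derivationI)
    note arr = biderivation_arr[OF k]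
    fix X a b w e
    assume "free_stages R C h S p \<mu> \<eta> X" and v: "stages.variables C X a b w e S S h h"
    then interpret free_stages R C h S p \<mu> \<eta> X
      by simp
    note v = v[unfolded variables_def]
    show "app (k \<cdot> (\<iota> \<boxdot> Ide C S) \<cdot> Sym C S h) (pair (mult a b) w) =
      sum_elm (mult a (app (k \<cdot> (\<iota> \<boxdot> Ide C S) \<cdot> Sym C S h) (pair b w)))
        (mult (app (k \<cdot> (\<iota> \<boxdot> Ide C S) \<cdot> Sym C S h) (pair a w)) b)"
      using v arr by (simp add: biderivation_mult_right[OF k] sum_elm_commute Un_ac)
  qed (use biderivation_arr[OF k] in auto)
  have "d \<cdot> (\<iota> \<boxdot> Ide C S) \<cdot> Sym C S h = d' \<cdot> (\<iota> \<boxdot> Ide C S) \<cdot> Sym C S h"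
  proof (rule derivation_unique[OF der[OF d] der[OF d']])
    have *: "(k \<cdot> (\<iota> \<boxdot> Ide C S) \<cdot> Sym C S h) \<cdot> (\<iota> \<boxdot> Ide C h) = (k \<cdot> (\<iota> \<boxdot> \<iota>)) \<cdot> Sym C h h"
      if "k \<in> Arr C" "Dom C k = S \<boxtimes> S" for k
      using that by (simp add: sym_nat)
    show "(d \<cdot> (\<iota> \<boxdot> Ide C S) \<cdot> Sym C S h) \<cdot> (\<iota> \<boxdot> Ide C h) = (d' \<cdot> (\<iota> \<boxdot> Ide C S) \<cdot> Sym C S h) \<cdot> (\<iota> \<boxdot> Ide C h)"
      using arr by (simp only: * eq)
  qed auto
  then have eq': "(d \<cdot> (\<iota> \<boxdot> Ide C S)) \<cdot> Sym C S h = (d' \<cdot> (\<iota> \<boxdot> Ide C S)) \<cdot> Sym C S h"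
    using arr by simp
  show "d \<cdot> (\<iota> \<boxdot> Ide C S) = d' \<cdot> (\<iota> \<boxdot> Ide C S)"
    by (rule iso_cancel_right[OF _ _ _ _ _ eq']) (use arr in simp_all)
qed auto

lemma biderivation_exists:
  assumes \<phi>: "\<phi> \<in> Arr C" "Dom C \<phi> = h \<boxtimes> h" "Cod C \<phi> = S"
  shows "\<exists>d. biderivation C S \<mu> \<eta> d \<and> d \<cdot> (\<iota> \<boxdot> \<iota>) = \<phi>"
proof -
  \<comment> \<open>\<open>D (y, u)\<close> is to be the bracket of a generator \<open>u\<close>
    with any \<open>y\<close>, the latter in front so that it can be extended. Extending
    \<open>u\<close> in turn gives \<open>d\<close>, and on generators the two symmetries
    cancel.\<close>
  obtain D where D: "derivation h D" "D \<cdot> (\<iota> \<boxdot> Ide C h) = \<phi> \<cdot> Sym C h h"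
    using derivation_exists[of h "\<phi> \<cdot> Sym C h h"] \<phi> by auto
  note DA = derivation_arr[OF D(1)]
  obtain d where d: "derivation S d" "d \<cdot> (\<iota> \<boxdot> Ide C S) = D \<cdot> Sym C h S"
    using derivation_exists[of S "D \<cdot> Sym C h S"] DA by auto
  note dA = derivation_arr[OF d(1)]
  let ?l = "d \<cdot> (Ide C S \<boxdot> \<mu>)"
  let ?r = "\<mu> \<cdot> (d \<boxdot> Ide C S) \<cdot> inverse_arrow C (Asc C S S S) \<boxplus>
       \<mu> \<cdot> (Ide C S \<boxdot> d) \<cdot> Asc C S S S \<cdot> (Sym C S S \<boxdot> Ide C S) \<cdot> inverse_arrow C (Asc C S S S)"
  \<comment> \<open>The Leibniz rule in the second argument does not come with the construction of
    \<open>d\<close>. Both of its sides are derivations in the first argument, so that argument may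
    be taken to be a generator; there \<open>d\<close> is given by \<open>D\<close>, and the rule is
    the one for \<open>D\<close>.\<close>
  have lr: "?l = ?r"
  proof (rule derivation_unique)
    show "derivation (S \<boxtimes> S) ?l"
    proof (rule derivationI)
      fix X a b w e
      assume "free_stages R C h S p \<mu> \<eta> X" and v: "stages.variables C X a b w e S S (S \<boxtimes> S) (S \<boxtimes> S)"
      then interpret free_stages R C h S p \<mu> \<eta> X
        by simp
      note v = v[unfolded variables_def]
      show "app ?l (pair (mult a b) w) = sum_elm (mult a (app ?l (pair b w))) (mult (app ?l (pair a w)) b)"
        using v dA by (simp add: derivation_mult[OF d(1)])
    qed (use dA in auto)
    show "derivation (S \<boxtimes> S) ?r"
      unfolding derivation_def
    proof (intro conjI)
      obtain X a b x y where X: "stages C X" and v: "stages.variables C X a b x y S S S S"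
        by (rule obtain_variables[of S S S S]) auto
      interpret free_stages R C h S p \<mu> \<eta> X
        using X by (rule free_stagesI)
      note v = v[unfolded variables_def]
      show "?r \<cdot> (\<mu> \<boxdot> Ide C (S \<boxtimes> S)) = \<mu> \<cdot> (Ide C S \<boxdot> ?r) \<cdot> Asc C S S (S \<boxtimes> S) \<boxplus>
          \<mu> \<cdot> (?r \<boxdot> Ide C S) \<cdot> swap_right S S (S \<boxtimes> S)"
        by (rule elm_ext[of "pair (pair a b) (pair x y)"])
          (use v dA in \<open>simp_all add: derivation_mult[OF d(1)] mult_assoc mult_commute mult_left_commute
             sum_elm_assoc sum_elm_commute sum_elm_left_commute Un_ac del: comp_plus tens_plus\<close>)
    qed (use dA in auto)
    obtain X u x y e where X: "stages C X" and v: "stages.variables C X u x y e h S S S"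
      by (rule obtain_variables[of h S S S]) auto
    interpret free_stages R C h S p \<mu> \<eta> X
      using X by (rule free_stagesI)
    note v = v[unfolded variables_def]
    have *: "app d (pair (app \<iota> u) x) = app D (pair x u)"
      if "elm u" "elm x" "dj u x" "dj x u" "ety u = h" "ety x = S" for u x
      using arg_cong[OF d(2), of "\<lambda>k. app k (pair u x)"] that dA DA by simp
    show "?l \<cdot> (\<iota> \<boxdot> Ide C (S \<boxtimes> S)) = ?r \<cdot> (\<iota> \<boxdot> Ide C (S \<boxtimes> S))"
      by (rule elm_ext[of "pair u (pair x y)"])
        (use v dA DA in \<open>simp_all add: * derivation_mult[OF D(1)] mult_commute sum_elm_commute Un_ac
            del: comp_plus tens_plus\<close>)
  qed auto
  have "biderivation C S \<mu> \<eta> d"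
  proof (rule biderivationI[OF d(1)])
    fix X a b c e
    assume "free_stages R C h S p \<mu> \<eta> X" and v: "stages.variables C X a b c e S S S S"
    then interpret free_stages R C h S p \<mu> \<eta> X
      by simp
    note v = v[unfolded variables_def]
    show "app d (pair a (mult b c)) = sum_elm (mult (app d (pair a b)) c) (mult b (app d (pair a c)))"
      using arg_cong[OF lr, of "\<lambda>k. app k (pair a (pair b c))"] v dA by simp
  qed
  moreover have "d \<cdot> (\<iota> \<boxdot> \<iota>) = \<phi>"
  proof -
    have "d \<cdot> (\<iota> \<boxdot> \<iota>) = (d \<cdot> (\<iota> \<boxdot> Ide C S)) \<cdot> (Ide C h \<boxdot> \<iota>)"
      using dA by simp
    also have "\<dots> = (D \<cdot> (\<iota> \<boxdot> Ide C h)) \<cdot> Sym C h h"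
      using DA unfolding d(2) by (simp add: sym_nat)
    also have "\<dots> = \<phi>"
      using \<phi> unfolding D(2) by simp
    finally show ?thesis .
  qed
  ultimately show ?thesis
    by blast
qed

text \<open>As a vanishing sum, skewness becomes an equation between biderivations: the Leibniz
  rules of \<open>d\<close> in its two arguments are exchanged by the symmetry, so the sum satisfies
  both.\<close>

lemma biderivation_antisymmetric:
  assumes d: "biderivation C S \<mu> \<eta> d"
    and gen: "d \<cdot> (\<iota> \<boxdot> \<iota>) = \<eta> \<cdot> \<beta>" and \<beta>: "\<beta> \<in> Arr C" "Dom C \<beta> = h \<boxtimes> h" "Cod C \<beta> = Unit C"
    and anti: "\<beta> \<boxplus> \<beta> \<cdot> Sym C h h = Zero C (h \<boxtimes> h) (Unit C)"
  shows "d \<cdot> Sym C S S \<boxplus> d = Zero C (S \<boxtimes> S) S"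
proof (rule biderivation_unique)
  note arr = biderivation_arr[OF d]
  let ?d = "d \<cdot> Sym C S S \<boxplus> d"
  show "biderivation C S \<mu> \<eta> ?d"
  proof (rule biderivationI)
    show "derivation S ?d"
    proof (rule derivationI)
      fix X a b w e
      assume "free_stages R C h S p \<mu> \<eta> X" and v: "stages.variables C X a b w e S S S S"
      then interpret free_stages R C h S p \<mu> \<eta> X
        by simp
      note v = v[unfolded variables_def]
      show "app ?d (pair (mult a b) w) = sum_elm (mult a (app ?d (pair b w))) (mult (app ?d (pair a w)) b)"
        using v arr by (simp add: biderivation_mult_left[OF d] biderivation_mult_right[OF d]
            sum_elm_assoc sum_elm_commute sum_elm_left_commute Un_ac)
    qed (use arr in auto)
    fix X a b c e
    assume "free_stages R C h S p \<mu> \<eta> X" and v: "stages.variables C X a b c e S S S S"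
    then interpret free_stages R C h S p \<mu> \<eta> X
      by simp
    note v = v[unfolded variables_def]
    show "app ?d (pair a (mult b c)) = sum_elm (mult (app ?d (pair a b)) c) (mult b (app ?d (pair a c)))"
      using v arr by (simp add: biderivation_mult_left[OF d] biderivation_mult_right[OF d]
            sum_elm_assoc sum_elm_commute sum_elm_left_commute Un_ac)
  qed
  show "biderivation C S \<mu> \<eta> (Zero C (S \<boxtimes> S) S)"
    by (simp add: biderivation_def Hom_def)
  have "?d \<cdot> (\<iota> \<boxdot> \<iota>) = (d \<cdot> (\<iota> \<boxdot> \<iota>)) \<cdot> Sym C h h \<boxplus> d \<cdot> (\<iota> \<boxdot> \<iota>)"
    using arr by (simp add: sym_nat)
  also have "\<dots> = \<eta> \<cdot> (\<beta> \<boxplus> \<beta> \<cdot> Sym C h h)"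
    using \<beta> unfolding gen by (simp add: plus_commute)
  also have "\<dots> = Zero C (S \<boxtimes> S) S \<cdot> (\<iota> \<boxdot> \<iota>)"
    unfolding anti by simp
  finally show "?d \<cdot> (\<iota> \<boxdot> \<iota>) = Zero C (S \<boxtimes> S) S \<cdot> (\<iota> \<boxdot> \<iota>)" .
qed

text \<open>Since the Jacobiator is invariant under cyclic permutations, it suffices that it is a derivation in
  its first argument, and its arguments can be replaced by generators one after the other.\<close>

lemma biderivation_jacobi:
  assumes d: "biderivation C S \<mu> \<eta> d"
    and gen: "d \<cdot> (\<iota> \<boxdot> \<iota>) = \<eta> \<cdot> \<beta>" and \<beta>: "\<beta> \<in> Arr C" "Dom C \<beta> = h \<boxtimes> h" "Cod C \<beta> = Unit C"
    and anti: "d \<cdot> Sym C S S \<boxplus> d = Zero C (S \<boxtimes> S) S"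
  shows "d \<cdot> (Ide C S \<boxdot> d) \<cdot> cyclic_sum C S = Zero C (S \<boxtimes> S \<boxtimes> S) S"
proof -
  note arr = biderivation_arr[OF d]
  define J where "J = d \<cdot> (Ide C S \<boxdot> d) \<cdot> cyclic_sum C S"
  have J: "J \<in> Arr C" "Dom C J = S \<boxtimes> S \<boxtimes> S" "Cod C J = S"
    using arr by (simp_all add: J_def cyclic_sum_def cyclic_permutation_def)
  have J_app: "stages.app C J (stages.pair C X a (stages.pair C X b c)) =
      linear_stages.sum_elm C (linear_stages.sum_elm C
        (stages.app C d (stages.pair C X a (stages.app C d (stages.pair C X b c))))
        (stages.app C d (stages.pair C X b (stages.app C d (stages.pair C X c a)))))
        (stages.app C d (stages.pair C X c (stages.app C d (stages.pair C X a b))))"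
    if "free_stages R C h S p \<mu> \<eta> X" "stages.elm C X a" "stages.elm C X b" "stages.elm C X c"
      "stages.dj a b" "stages.dj b a" "stages.dj a c" "stages.dj c a" "stages.dj b c" "stages.dj c b"
      "stages.ety C a = S" "stages.ety C b = S" "stages.ety C c = S" for X a b c
  proof -
    interpret free_stages R C h S p \<mu> \<eta> X by fact
    show ?thesis
      using that arr by (simp add: J_def cyclic_sum_def cyclic_permutation_def Un_ac)
  qed
  have J_rotate: "stages.app C J (stages.pair C X a (stages.pair C X b c)) =
      stages.app C J (stages.pair C X b (stages.pair C X c a))"
    if "free_stages R C h S p \<mu> \<eta> X" "stages.elm C X a" "stages.elm C X b" "stages.elm C X c"
      "stages.dj a b" "stages.dj b a" "stages.dj a c" "stages.dj c a" "stages.dj b c" "stages.dj c b"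
      "stages.ety C a = S" "stages.ety C b = S" "stages.ety C c = S" for X a b c
  proof -
    interpret free_stages R C h S p \<mu> \<eta> X by fact
    show ?thesis
      using that arr by (simp add: J_app[OF that(1)] sum_elm_assoc sum_elm_commute sum_elm_left_commute Un_ac)
  qed
  have derJ: "derivation (S \<boxtimes> S) J"
    unfolding derivation_def
  proof (intro conjI)
    obtain X a b x y where X: "stages C X" and v: "stages.variables C X a b x y S S S S"
      by (rule obtain_variables[of S S S S]) auto
    interpret free_stages R C h S p \<mu> \<eta> X
      using X by (rule free_stagesI)
    note v = v[unfolded variables_def]
    have cancel: "sum_elm (mult u (app d (pair v w))) (mult u (app d (pair w v)))
        = zero_elm (fst u \<union> fst v \<union> fst w) S"
      "sum_elm (mult (app d (pair v w)) u) (mult (app d (pair w v)) u) = zero_elm (fst v \<union> fst w \<union> fst u) S"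
      if "elm u" "elm v" "elm w" "dj u v" "dj u w" "dj v u" "dj w u" "dj v w" "dj w v" "ety u
          = S" "ety v = S" "ety w = S" for u v w
    proof -
      have "sum_elm (app d (pair w v)) (app d (pair v w)) = zero_elm (fst v \<union> fst w) S"
        using arg_cong[OF anti, of "\<lambda>k. app k (pair v w)"] that arr by (simp add: Un_ac)
      then have 0: "sum_elm (app d (pair v w)) (app d (pair w v)) = zero_elm (fst v \<union> fst w) S"
        using that arr by (simp add: sum_elm_commute Un_ac)
      have "sum_elm (mult u (app d (pair v w))) (mult u (app d (pair w v))) =
          mult u (sum_elm (app d (pair v w)) (app d (pair w v)))"
        using that arr by (simp add: Un_ac)
      then show "sum_elm (mult u (app d (pair v w))) (mult u (app d (pair w v)))
          = zero_elm (fst u \<union> fst v \<union> fst w) S"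
        unfolding 0 using that by (simp add: Un_ac)
      have "sum_elm (mult (app d (pair v w)) u) (mult (app d (pair w v)) u) =
          mult (sum_elm (app d (pair v w)) (app d (pair w v))) u"
        using that arr by (simp add: Un_ac)
      then show "sum_elm (mult (app d (pair v w)) u) (mult (app d (pair w v)) u)
          = zero_elm (fst v \<union> fst w \<union> fst u) S"
        unfolding 0 using that by (simp add: Un_ac)
    qed
    show "J \<cdot> (\<mu> \<boxdot> Ide C (S \<boxtimes> S)) = \<mu> \<cdot> (Ide C S \<boxdot> J) \<cdot> Asc C S S (S \<boxtimes> S) \<boxplus>
        \<mu> \<cdot> (J \<boxdot> Ide C S) \<cdot> swap_right S S (S \<boxtimes> S)"
    proof (rule elm_ext[of "pair (pair a b) (pair x y)"])
      let ?d = "\<lambda>a b. app d (pair a b)"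
      let ?A = "fst a \<union> fst b \<union> fst x \<union> fst y"
      \<comment> \<open>Expanding \<open>{x, {y, ab}}\<close> and \<open>{y, {ab, x}}\<close> leaves
        four crossed products. They pair off into a common factor times
        \<open>{x, b} + {b, x}\<close> or \<open>{x, a} + {a, x}\<close>.\<close>
      have q: "sum_elm (mult (?d y a) (?d x b)) (mult (?d y a) (?d b x)) = zero_elm ?A S"
        using cancel(1)[of "?d y a" x b] v arr by (simp add: Un_ac)
      have r: "sum_elm (mult (?d x a) (?d y b)) (mult (?d a x) (?d y b)) = zero_elm ?A S"
        using cancel(2)[of "?d y b" x a] v arr by (simp add: Un_ac)
      have "app (J \<cdot> (\<mu> \<boxdot> Ide C (S \<boxtimes> S))) (pair (pair a b) (pair x y)) =
        sum_elm (sum_elm (sum_elm (mult a (?d b (?d x y))) (mult (?d a (?d x y)) b))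
          (sum_elm (sum_elm (mult (?d x (?d y a)) b) (mult (?d y a) (?d x b)))
            (sum_elm (mult (?d x a) (?d y b)) (mult a (?d x (?d y b))))))
          (sum_elm (sum_elm (mult (?d y a) (?d b x)) (mult a (?d y (?d b x))))
            (sum_elm (mult (?d y (?d a x)) b) (mult (?d a x) (?d y b))))"
        using v arr J
        by (simp add: J_app[OF free_stages_axioms] biderivation_mult_left[OF d] biderivation_mult_right[OF d] Un_ac)
      also have "\<dots> = sum_elm
          (sum_elm (sum_elm (mult a (?d b (?d x y))) (mult a (?d x (?d y b)))) (mult a (?d y (?d b x))))
          (sum_elm (sum_elm (mult (?d a (?d x y)) b) (mult (?d x (?d y a)) b)) (mult (?d y (?d a x)) b))"
        by (rule sum_cancel_crossed[OF _ _ _ _ _ _ _ _ _ _ _ _ _ _ _ _ _ _ _ _ _ _ _ _ _ _ _ _ _ _ q r])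
          (use v arr in \<open>auto simp: Un_ac\<close>)
      also have "\<dots> = app (\<mu> \<cdot> (Ide C S \<boxdot> J) \<cdot> Asc C S S (S \<boxtimes> S) \<boxplus> \<mu> \<cdot> (J \<boxdot> Ide C S) \<cdot> swap_right S S (S \<boxtimes> S))
          (pair (pair a b) (pair x y))"
        using v arr J by (simp add: J_app[OF free_stages_axioms] Un_ac)
      finally show "app (J \<cdot> (\<mu> \<boxdot> Ide C (S \<boxtimes> S))) (pair (pair a b) (pair x y)) =
        app (\<mu> \<cdot> (Ide C S \<boxdot> J) \<cdot> Asc C S S (S \<boxtimes> S) \<boxplus> \<mu> \<cdot> (J \<boxdot> Ide C S) \<cdot> swap_right S S (S \<boxtimes> S))
            (pair (pair a b) (pair x y))" .
    qed (use v J in auto)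
  qed (use J in auto)
  have J0: "J \<cdot> (\<iota> \<boxdot> \<iota> \<boxdot> \<iota>) = Zero C (h \<boxtimes> h \<boxtimes> h) S"
  proof -
    obtain X a b c e where X: "stages C X" and v: "stages.variables C X a b c e h h h h"
      by (rule obtain_variables[of h h h h]) auto
    interpret free_stages R C h S p \<mu> \<eta> X
      using X by (rule free_stagesI)
    note v = v[unfolded variables_def]
    have "app d (pair (app \<iota> u) (app \<iota> w)) = app \<eta> (app \<beta> (pair u w))"
      if "elm u" "elm w" "dj u w" "ety u = h" "ety w = h" for u w
      using arg_cong[OF gen, of "\<lambda>k. app k (pair u w)"] that arr \<beta> by simp
    then show ?thesis
      by (intro elm_ext[of "pair a (pair b c)"])
        (use v arr J \<beta> in \<open>simp_all add: J_app[OF free_stages_axioms] biderivation_unit_right[OF d] Un_ac\<close>)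
  qed
  \<comment> \<open>\<open>f\<close> and \<open>g\<close> stand for the arguments not under
    treatment; each of them will be \<open>\<iota>\<close> or the identity of
    \<open>S\<close>.\<close>
  have der: "derivation (y \<boxtimes> z) (J \<cdot> (Ide C S \<boxdot> f \<boxdot> g))"
    if f: "f \<in> Arr C" "Dom C f = y" "Cod C f = S" and g: "g \<in> Arr C" "Dom C g = z" "Cod C g = S" for f g y z
  proof (rule derivationI)
    show yz: "y \<boxtimes> z \<in> Obj C"
      using f g by auto
    let ?J = "J \<cdot> (Ide C S \<boxdot> f \<boxdot> g)"
    fix X a b w e
    assume "free_stages R C h S p \<mu> \<eta> X" and v: "stages.variables C X a b w e S S (y \<boxtimes> z) (y \<boxtimes> z)"
    then interpret free_stages R C h S p \<mu> \<eta> X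
      by simp
    note v = v[unfolded variables_def]
    show "app ?J (pair (mult a b) w) = sum_elm (mult a (app ?J (pair b w))) (mult (app ?J (pair a w)) b)"
      using v J f g by (simp add: derivation_mult[OF derJ])
  qed (use J f g in auto)
  have zero: "J \<cdot> (Ide C S \<boxdot> f \<boxdot> g) = Zero C (S \<boxtimes> Dom C f \<boxtimes> Dom C g) S"
    if f: "f \<in> Arr C" "Cod C f = S" and g: "g \<in> Arr C" "Cod C g = S"
      and "J \<cdot> (\<iota> \<boxdot> f \<boxdot> g) = Zero C (h \<boxtimes> Dom C f \<boxtimes> Dom C g) S" for f g
    by (rule derivation_unique[OF der derivation_Zero]) (use that J in auto)
  \<comment> \<open>After \<open>zero\<close> has freed the first argument, a generator waiting in
    the last place is rotated to the front. Three rounds free all arguments.\<close>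
  have rotate: "J \<cdot> (\<iota> \<boxdot> f \<boxdot> g) = Zero C (h \<boxtimes> Dom C f \<boxtimes> Dom C g) S"
    if f: "f \<in> Arr C" "Cod C f = S" and g: "g \<in> Arr C" "Cod C g = S"
      and 0: "J \<cdot> (f \<boxdot> g \<boxdot> \<iota>) = Zero C (Dom C f \<boxtimes> Dom C g \<boxtimes> h) S" for f g
  proof -
    obtain X a b c e where X: "stages C X" and v: "stages.variables C X a b c e h (Dom C f) (Dom C g) h"
      by (rule obtain_variables[of h "Dom C f" "Dom C g" h]) (use f g in auto)
    interpret free_stages R C h S p \<mu> \<eta> X
      using X by (rule free_stagesI)
    note v = v[unfolded variables_def]
    have "app J (pair (app f b) (pair (app g c) (app \<iota> a))) = zero_elm (fst b \<union> fst c \<union> fst a) S"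
      using arg_cong[OF 0, of "\<lambda>k. app k (pair b (pair c a))"] v f g J by (simp add: Un_ac)
    then have "app J (pair (app \<iota> a) (pair (app f b) (app g c))) = zero_elm (fst b \<union> fst c \<union> fst a) S"
      using v f g by (subst J_rotate[OF free_stages_axioms]) simp_all
    then show ?thesis
      by (intro elm_ext[of "pair a (pair b c)"]) (use v f g J in \<open>simp_all add: Un_ac\<close>)
  qed
  have J1: "J \<cdot> (Ide C S \<boxdot> \<iota> \<boxdot> \<iota>) = Zero C (S \<boxtimes> h \<boxtimes> h) S"
    using zero[of \<iota> \<iota>] J0 by simp
  have J2: "J \<cdot> (Ide C S \<boxdot> Ide C S \<boxdot> \<iota>) = Zero C (S \<boxtimes> S \<boxtimes> h) S"
    using zero[of "Ide C S" \<iota>] rotate[of "Ide C S" \<iota>] J1 by simp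
  have "J \<cdot> (Ide C S \<boxdot> Ide C S \<boxdot> Ide C S) = Zero C (S \<boxtimes> S \<boxtimes> S) S"
    using zero[of "Ide C S" "Ide C S"] rotate[of "Ide C S" "Ide C S"] J2 by simp
  then have "J = Zero C (S \<boxtimes> S \<boxtimes> S) S"
    using J by simp
  then show ?thesis
    by (simp add: J_def)
qed

end

section \<open>The bracket of a quiver\<close>

lemma (in linear_symmetric_monoidal_category) symmetric_algebra_free:
  assumes "infinite (UNIV :: 'j set)" "tensor_cocomplete TYPE('j) C" "symmetric_algebra C h p S \<mu> \<eta>"
  shows "free_commutative_algebra R C h S p \<mu> \<eta>"
  by unfold_locales
    (use symmetric_algebra_arr[OF assms(3)] tensor_symmetric_algebra_univ[OF assms] assms(3)
      in \<open>auto simp: symmetric_algebra_def\<close>)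

text \<open>On \<open>((x, y), (z, w))\<close> both sides multiply the scalars
  \<open>ev i (w, x)\<close> and \<open>ev j (y, z)\<close>, in opposite orders, and scalars
  commute.\<close>

lemma (in symmetric_monoidal_category) double_evaluation:
  assumes "duality C (c i) (d i) (ev i) (coev i)" "duality C (c j) (d j) (ev j) (coev j)"
  shows "double_evaluation C c d ev i j \<in> Hom C ((c i \<boxtimes> d j) \<boxtimes> c j \<boxtimes> d i) (Unit C)"
    and "double_evaluation C c d ev j i \<cdot> Sym C (c i \<boxtimes> d j) (c j \<boxtimes> d i) = double_evaluation C c d ev i j"
proof -
  have obj: "c i \<in> Obj C" "d i \<in> Obj C" "c j \<in> Obj C" "d j \<in> Obj C"
    and ev: "ev i \<in> Arr C" "Dom C (ev i) = d i \<boxtimes> c i" "Cod C (ev i) = Unit C"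
      "ev j \<in> Arr C" "Dom C (ev j) = d j \<boxtimes> c j" "Cod C (ev j) = Unit C"
    using assms by (auto simp: duality_def Hom_def)
  show "double_evaluation C c d ev i j \<in> Hom C ((c i \<boxtimes> d j) \<boxtimes> c j \<boxtimes> d i) (Unit C)"
    using obj ev by (simp add: double_evaluation_def Hom_def)
  obtain X x y z w where X: "stages C X" and v: "stages.variables C X x y z w (c i) (d j) (c j) (d i)"
    by (rule obtain_variables[OF obj(1,4,3,2)])
  interpret stages C X by fact
  note v = v[unfolded variables_def]
  show "double_evaluation C c d ev j i \<cdot> Sym C (c i \<boxtimes> d j) (c j \<boxtimes> d i) = double_evaluation C c d ev i j"
    by (rule elm_ext[of "pair (pair x y) (pair z w)"])
      (use obj ev v scale_commute[of "app (ev i) (pair w x)" "app (ev j) (pair y z)"]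
        in \<open>simp_all add: double_evaluation_def app_lunit_scale scale_pair_left scale_app\<close>)
qed

section \<open>Skewness of the components of the bracket\<close>

context linear_symmetric_monoidal_category begin

context
  fixes Q :: "('v, 'q) pre_digraph" and c d ev coev
  assumes Q: "fin_digraph Q"
    and dual: "\<forall>i\<in>verts (double_quiver Q). duality C (c i) (d i) (ev i) (coev i)"
begin

lemma double_quiver_verts:
  assumes "a \<in> arcs (double_quiver Q)"
  shows "tail (double_quiver Q) a \<in> verts (double_quiver Q)" "head (double_quiver Q) a \<in> verts (double_quiver Q)"
proof -
  interpret fin_digraph Q by (rule Q)
  show "tail (double_quiver Q) a \<in> verts (double_quiver Q)" "head (double_quiver Q) a \<in> verts (double_quiver Q)"
    using assms by (auto simp: double_quiver_def)
qed

lemma arrow_object_obj [simp]: "a \<in> arcs (double_quiver Q) \<Longrightarrow> arrow_object C Q c d a \<in> Obj C"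
  using double_quiver_verts[of a] dual by (auto simp: arrow_object_def duality_def)

text \<open>Exchanging two arrows in involution changes the sign of the pairing but not the double
  evaluation. Otherwise both components are zero.\<close>

lemma bracket_component:
  assumes a: "a \<in> arcs (double_quiver Q)" and b: "b \<in> arcs (double_quiver Q)"
  defines "f \<equiv> bracket_component R C Q c d ev"
  shows "f a b \<in> Hom C (arrow_object C Q c d a \<boxtimes> arrow_object C Q c d b) (Unit C)"
    and "f a b \<boxplus> f b a \<cdot> Sym C (arrow_object C Q c d a) (arrow_object C Q c d b) =
      Zero C (arrow_object C Q c d a \<boxtimes> arrow_object C Q c d b) (Unit C)"
proof -
  let ?o = "arrow_object C Q c d"
  have "f a b \<in> Hom C (?o a \<boxtimes> ?o b) (Unit C) \<and> f a b \<boxplus> f b a \<cdot> Sym C (?o a) (?o b)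
      = Zero C (?o a \<boxtimes> ?o b) (Unit C)"
  proof (cases "involution_pair a b")
    case False
    then have "\<not> involution_pair b a"
      by (auto simp: involution_pair_def)
    with False show ?thesis
      using a b by (simp add: f_def bracket_component_def Hom_def)
  next
    case True
    let ?i = "tail (double_quiver Q) a" and ?j = "head (double_quiver Q) a"
    have ends: "tail (double_quiver Q) b = ?j" "head (double_quiver Q) b = ?i"
      using True by (auto simp: involution_pair_def double_quiver_def)
    have dual_a: "duality C (c ?i) (d ?i) (ev ?i) (coev ?i)" "duality C (c ?j) (d ?j) (ev ?j) (coev ?j)"
      using double_quiver_verts[OF a] dual by auto
    note ev1 = double_evaluation[of c ?i d ev coev ?j, OF dual_a]
    note ev2 = double_evaluation(1)[of c ?j d ev coev ?i, OF dual_a(2,1)]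
    define e where "e = double_evaluation C c d ev ?i ?j"
    define e' where "e' = double_evaluation C c d ev ?j ?i"
    have o: "?o a = c ?i \<boxtimes> d ?j" "?o b = c ?j \<boxtimes> d ?i"
      by (simp_all add: arrow_object_def ends)
    have e: "e \<in> Arr C" "Dom C e = ?o a \<boxtimes> ?o b" "Cod C e = Unit C"
        "e' \<in> Arr C" "Dom C e' = ?o b \<boxtimes> ?o a" "Cod C e' = Unit C" "e' \<cdot> Sym C (?o a) (?o b) = e"
      using ev1 ev2 by (auto simp: Hom_def o e_def e'_def)
    \<comment> \<open>In this locale the ring axioms of \<open>R\<close> come with any hom-module,
      here the endomorphisms of the unit.\<close>
    have minus: "\<ominus>\<^bsub>R\<^esub> \<one>\<^bsub>R\<^esub> \<in> carrier R"
    proof -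
      interpret module R "hom_module C (Unit C) (Unit C)"
        by (intro hom_is_module) auto
      show ?thesis by simp
    qed
    have scale: "Scale C (\<ominus>\<^bsub>R\<^esub> \<one>\<^bsub>R\<^esub>) e' \<cdot> Sym C (?o a) (?o b) = Scale C (\<ominus>\<^bsub>R\<^esub> \<one>\<^bsub>R\<^esub>) e"
      using comp_scale_left[OF minus, of "Sym C (?o a) (?o b)" "?o a \<boxtimes> ?o b" "?o b \<boxtimes> ?o a" e' "Unit C"] e a b
      by (simp add: Hom_def)
    from True consider u where "a = Inl u" "b = Inr u" | u where "a = Inr u" "b = Inl u"
      by (auto simp: involution_pair_def)
    then show ?thesis
    proof cases
      case 1
      then have "f a b = e" "f b a = Scale C (\<ominus>\<^bsub>R\<^esub> \<one>\<^bsub>R\<^esub>) e'"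
        using e ends by (auto simp: f_def bracket_component_def involution_pair_def arrow_pairing_def
            e_def e'_def)
      then show ?thesis
        using e scale_minus_one[of e] by (simp add: scale Hom_def)
    next
      case 2
      then have "f a b = Scale C (\<ominus>\<^bsub>R\<^esub> \<one>\<^bsub>R\<^esub>) e" "f b a = e'"
        using e ends by (auto simp: f_def bracket_component_def involution_pair_def arrow_pairing_def
            e_def e'_def)
      then show ?thesis
        using e scale_minus_one[of e] by (simp add: Hom_def plus_commute)
    qed
  qed
  then show "f a b \<in> Hom C (?o a \<boxtimes> ?o b) (Unit C)"
    and "f a b \<boxplus> f b a \<cdot> Sym C (?o a) (?o b) = Zero C (?o a \<boxtimes> ?o b) (Unit C)"
    by auto
qed

end
end

theorem proposition3p6:
  fixes R :: "('r, 'u) ring_scheme"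
    and Q :: "('v, 'q) pre_digraph"
    and C :: "('o, 'm, 'r, 'z) linear_smcat_scheme"
    and c c_dual :: "'v \<Rightarrow> 'o"
    and ev coev :: "'v \<Rightarrow> 'm"
    and h S :: 'o
    and incl :: "'q + 'q \<Rightarrow> 'm"
    and p :: "nat \<Rightarrow> 'm"
    and \<mu> \<eta> :: 'm
  assumes "cring R"
    and "fin_digraph Q"
    and "linear_symmetric_monoidal_category R C"
    and "infinite (UNIV :: 'j set)"
    and "tensor_cocomplete TYPE('j) C"
    and "\<And>i. i \<in> verts (double_quiver Q) \<Longrightarrow> duality C (c i) (c_dual i) (ev i) (coev i)"
    and "is_coproduct C (arcs (double_quiver Q)) (arrow_object C Q c c_dual) h incl"
    and "symmetric_algebra C h p S \<mu> \<eta>"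
  shows "(\<exists>!br. quiver_bracket R C Q c c_dual ev h incl p S \<mu> \<eta> br) \<and>
         (\<forall>br. quiver_bracket R C Q c c_dual ev h incl p S \<mu> \<eta> br \<longrightarrow>
               poisson_algebra C S \<mu> \<eta> br)"
proof -
  interpret linear_symmetric_monoidal_category R C by fact
  interpret free_commutative_algebra R C h S p \<mu> \<eta>
    by (rule symmetric_algebra_free[OF assms(4,5,8)])
  let ?I = "arcs (double_quiver Q)" and ?o = "arrow_object C Q c c_dual"
  let ?f = "bracket_component R C Q c c_dual ev"
  have fin: "finite ?I"
    using fin_digraph.finite_arcs[OF assms(2)] by (simp add: double_quiver_def)
  have dual: "\<forall>i\<in>verts (double_quiver Q). duality C (c i) (c_dual i) (ev i) (coev i)"
    using assms(6) by blast
  have o: "?o a \<in> Obj C" if "a \<in> ?I" for a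
    using that by (rule arrow_object_obj[OF assms(2) dual])
  note f = bracket_component[OF assms(2) dual]
  have incl: "incl a \<in> Arr C" "Dom C (incl a) = ?o a" "Cod C (incl a) = h" if "a \<in> ?I" for a
    using coproduct_inj(2)[OF assms(7)] o that by (auto simp: Hom_def)
  note univ2 = tensor_coproduct_univ2[OF assms(4,5) fin assms(7)]
  have ext: "k = k'" if "k \<in> Hom C (h \<boxtimes>\<^bsub>C\<^esub> h) M" "k' \<in> Hom C (h \<boxtimes>\<^bsub>C\<^esub> h) M"
      "\<And>a b. a \<in> ?I \<Longrightarrow> b \<in> ?I \<Longrightarrow> k \<cdot>\<^bsub>C\<^esub> (incl a \<boxdot>\<^bsub>C\<^esub> incl b) = k' \<cdot>\<^bsub>C\<^esub> (incl a \<boxdot>\<^bsub>C\<^esub> incl b)" for k k' M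
    by (rule ex1_eqI[OF univ2[of M "\<lambda>a b. k \<cdot>\<^bsub>C\<^esub> (incl a \<boxdot>\<^bsub>C\<^esub> incl b)"]])
      (use that incl o in \<open>auto simp: Hom_def\<close>)
  \<comment> \<open>The components assemble to one pairing on \<open>h\<close>, whose skewness can
    be tested on pairs of arrows.\<close>
  obtain \<beta> where \<beta>: "\<beta> \<in> Arr C" "Dom C \<beta> = h \<boxtimes>\<^bsub>C\<^esub> h" "Cod C \<beta> = Unit C"
    and \<beta>_incl: "\<And>a b. a \<in> ?I \<Longrightarrow> b \<in> ?I \<Longrightarrow> \<beta> \<cdot>\<^bsub>C\<^esub> (incl a \<boxdot>\<^bsub>C\<^esub> incl b) = ?f a b"
    using ex1_implies_ex[OF univ2[of "Unit C" ?f]] f(1) o by (auto simp: Hom_def)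
  have anti: "\<beta> \<boxplus>\<^bsub>C\<^esub> \<beta> \<cdot>\<^bsub>C\<^esub> Sym C h h = Zero C (h \<boxtimes>\<^bsub>C\<^esub> h) (Unit C)"
  proof (rule ext)
    fix a b assume ab: "a \<in> ?I" "b \<in> ?I"
    have "(\<beta> \<boxplus>\<^bsub>C\<^esub> \<beta> \<cdot>\<^bsub>C\<^esub> Sym C h h) \<cdot>\<^bsub>C\<^esub> (incl a \<boxdot>\<^bsub>C\<^esub> incl b) =
        \<beta> \<cdot>\<^bsub>C\<^esub> (incl a \<boxdot>\<^bsub>C\<^esub> incl b) \<boxplus>\<^bsub>C\<^esub> (\<beta> \<cdot>\<^bsub>C\<^esub> (incl b \<boxdot>\<^bsub>C\<^esub> incl a)) \<cdot>\<^bsub>C\<^esub> Sym C (?o a) (?o b)"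
      using \<beta> incl ab o by (simp add: sym_nat)
    then show "(\<beta> \<boxplus>\<^bsub>C\<^esub> \<beta> \<cdot>\<^bsub>C\<^esub> Sym C h h) \<cdot>\<^bsub>C\<^esub> (incl a \<boxdot>\<^bsub>C\<^esub> incl b) =
        Zero C (h \<boxtimes>\<^bsub>C\<^esub> h) (Unit C) \<cdot>\<^bsub>C\<^esub> (incl a \<boxdot>\<^bsub>C\<^esub> incl b)"
      using incl ab f(2)[OF ab] by (simp add: \<beta>_incl)
  qed (use \<beta> in \<open>auto simp: Hom_def\<close>)
  \<comment> \<open>The conditions for all pairs of arrows amount to one equation on
    \<open>h \<boxtimes> h\<close>, because that object is the coproduct of the products of arrow
    objects. The general results on biderivations then apply.\<close>
  have bracket: "quiver_bracket R C Q c c_dual ev h incl p S \<mu> \<eta> br \<longleftrightarrow>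
      biderivation C S \<mu> \<eta> br \<and> br \<cdot>\<^bsub>C\<^esub> (\<iota> \<boxdot>\<^bsub>C\<^esub> \<iota>) = \<eta> \<cdot>\<^bsub>C\<^esub> \<beta>" for br
  proof (cases "biderivation C S \<mu> \<eta> br")
    case True
    note br = biderivation_arr[OF True]
    have "br \<cdot>\<^bsub>C\<^esub> ((\<iota> \<cdot>\<^bsub>C\<^esub> incl a) \<boxdot>\<^bsub>C\<^esub> (\<iota> \<cdot>\<^bsub>C\<^esub> incl b)) = (br \<cdot>\<^bsub>C\<^esub> (\<iota> \<boxdot>\<^bsub>C\<^esub> \<iota>)) \<cdot>\<^bsub>C\<^esub> (incl a \<boxdot>\<^bsub>C\<^esub> incl b)"
      and "\<eta> \<cdot>\<^bsub>C\<^esub> ?f a b = (\<eta> \<cdot>\<^bsub>C\<^esub> \<beta>) \<cdot>\<^bsub>C\<^esub> (incl a \<boxdot>\<^bsub>C\<^esub> incl b)" if "a \<in> ?I" "b \<in> ?I" for a b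
      using that br incl \<beta> by (simp_all flip: \<beta>_incl)
    moreover have "br \<cdot>\<^bsub>C\<^esub> (\<iota> \<boxdot>\<^bsub>C\<^esub> \<iota>) = \<eta> \<cdot>\<^bsub>C\<^esub> \<beta>"
      if "\<And>a b. a \<in> ?I \<Longrightarrow> b \<in> ?I \<Longrightarrow> (br \<cdot>\<^bsub>C\<^esub> (\<iota> \<boxdot>\<^bsub>C\<^esub> \<iota>)) \<cdot>\<^bsub>C\<^esub> (incl a \<boxdot>\<^bsub>C\<^esub> incl b)
          = (\<eta> \<cdot>\<^bsub>C\<^esub> \<beta>) \<cdot>\<^bsub>C\<^esub> (incl a \<boxdot>\<^bsub>C\<^esub> incl b)"
      by (rule ext[OF _ _ that]) (use br \<beta> in \<open>auto simp: Hom_def\<close>)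
    ultimately show ?thesis
      using True unfolding quiver_bracket_def by auto
  qed (simp add: quiver_bracket_def)
  show ?thesis
  proof (intro conjI allI impI)
    obtain br where "biderivation C S \<mu> \<eta> br" "br \<cdot>\<^bsub>C\<^esub> (\<iota> \<boxdot>\<^bsub>C\<^esub> \<iota>) = \<eta> \<cdot>\<^bsub>C\<^esub> \<beta>"
      using biderivation_exists[of "\<eta> \<cdot>\<^bsub>C\<^esub> \<beta>"] \<beta> by auto
    then show "\<exists>!br. quiver_bracket R C Q c c_dual ev h incl p S \<mu> \<eta> br"
      unfolding bracket by (intro ex1I[of _ br]) (auto intro: biderivation_unique)
  next
    fix br assume "quiver_bracket R C Q c c_dual ev h incl p S \<mu> \<eta> br"
    then have br: "biderivation C S \<mu> \<eta> br" "br \<cdot>\<^bsub>C\<^esub> (\<iota> \<boxdot>\<^bsub>C\<^esub> \<iota>) = \<eta> \<cdot>\<^bsub>C\<^esub> \<beta>"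
      by (simp_all add: bracket)
    note arr = biderivation_arr[OF br(1)]
    have skew: "br \<cdot>\<^bsub>C\<^esub> Sym C S S \<boxplus>\<^bsub>C\<^esub> br = Zero C (S \<boxtimes>\<^bsub>C\<^esub> S) S"
      by (rule biderivation_antisymmetric[OF br \<beta> anti])
    have "br \<cdot>\<^bsub>C\<^esub> Sym C S S = \<ominus>\<^bsub>hom_module C (S \<boxtimes>\<^bsub>C\<^esub> S) S\<^esub> br"
      by (rule plus_eq_zero[OF _ _ _ _ _ _ skew]) (use arr in auto)
    then show "poisson_algebra C S \<mu> \<eta> br"
      using biderivation_jacobi[OF br \<beta> skew] monoid br(1) by (simp add: poisson_algebra_def)
  qed
qed

end
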